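(* Let $m$ be a positive integer, and let $\mathcal F_{\pm}$ denote either one of the two Clifford–Fourier transforms $\mathcal F_{+},\mathcal F_{-}$ on $\mathbb R^m$, extended continuously to $L_2(\mathbb R^m)\otimes Cl_{0,m}$. Then for every $f\in L_2(\mathbb R^m)\otimes Cl_{0,m}$, $$\int_{\mathbb R^m}\|x\|_c^2\,\|f(x)\|_c^2\,dx\;\int_{\mathbb R^m}\|\lambda\|_c^2\,\|\mathcal F_{\pm}(f)(\lambda)\|_c^2\,d\lambda\;\ge\;\frac{m^2}{4}\left[\int_{\mathbb R^m}\|f(x)\|_c^2\,dx\right]^2 ,$$ and equality holds if $f(x)=c\,e^{-p\|x\|_c^2}$ for almost every $x\in\mathbb R^m$, for some $p>0$ and some real constant $c$.
   Context: $Cl_{0,m}$ is the real Clifford algebra generated by $e_1,\dots,e_m$ with $e_ie_j=-e_je_i$ for $i\ne j$ and $e_i^2=-1$. It has the basis $e_A=e_{i_1}\cdots e_{i_k}$, $A=\{i_1<\dots<i_k\}\subseteq\{1,\dots,m\}$ (with $e_\emptyset=1$). For $x=\sum_A x_Ae_A$ put $\|x\|_c=(\sum_A|x_A|^2)^{1/2}$; the same formula is used for complex coefficients, i.e. on $Cl_{0,m}\otimes\mathbb C$. A vector $x=(x_1,\dots,x_m)\in\mathbb R^m$ is identified with $\sum_i x_ie_i$, so $\|x\|_c$ is its Euclidean norm; $\langle x,y\rangle=\sum_j x_jy_j$. Gamma operator: $\Gamma_y=-\sum_{j<k}e_je_k(y_j\partial_{y_k}-y_k\partial_{y_j})$. It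 maps the (finite-dimensional) space of homogeneous Clifford-valued polynomials in $y$ of a given degree to itself. Kernel: $K_{\pm}(x,y)=e^{\mp i\frac{\pi}{2}\Gamma_y}e^{-i\langle x,y\rangle}$, meaning $K_{\pm}(x,y)=\sum_{n\ge0}\frac{(-i)^n}{n!}\,e^{\mp i\frac{\pi}{2}\Gamma_y}\big(\langle x,y\rangle^n\big)$, where in each term the exponential of $\Gamma_y$ acts on homogeneous polynomials of degree $n$ in $y$ ($x$ being a parameter). Clifford–Fourier transform: $\mathcal F_{\pm}(f)(y)=(2\pi)^{-m/2}\int_{\mathbb R^m}K_{\pm}(x,y)f(x)\,dx$. $L_2(\mathbb R^m)\otimes Cl_{0,m}$ is the space of square integrable $Cl_{0,m}$-valued functions, with norm $\|f\|_{2,c}=\left(\int_{\mathbb R^m}\|f(x)\|_c^2dx\right)^{1/2}$. It is known that $\mathcal F_{\pm}$ extends from the Schwartz functions $\mathcal S(\mathbb R^m)\otimes Cl_{0,m}$ to a continuous map on $L_2(\mathbb R^m)\otimes Cl_{0,m}$ (values in $Cl_{0,m}\otimes\mathbb C$ in general); $\mathcal F_{\pm}(f)$ for $f\in L_2$ means this extension. The integrals in the inequality take values in $[0,\infty]$. *)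

theory Defs
  imports "HOL-Analysis.Analysis"
begin

section \<open>Clifford algebras\<close>

text \<open>
  The ambient space is \<open>real ^ 'm\<close> with \<open>m = CARD('m)\<close>; the linear order on \<open>'m\<close> plays the role
  of the order on \<open>{1, \<dots>, m}\<close>. An element \<open>\<Sum>\<^sub>A x\<^sub>A e\<^sub>A\<close> of the Clifford algebra with
  coefficients in \<open>'a\<close> is the vector \<open>x :: 'a ^ ('m set)\<close> of its coefficients: \<open>'a = real\<close>
  gives the algebra itself, \<open>'a = complex\<close> its complexification. The library norm on these
  vector types is the Clifford norm \<open>(\<Sum>\<^sub>A \<bar>x\<^sub>A\<bar>\<^sup>2)\<^sup>1\<^sup>/\<^sup>2\<close> (lemma \<open>norm_cl\<close>).
  The library product \<open>*\<close> on \<open>'a ^ ('m set)\<close> is componentwise and is not used.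
\<close>

text \<open>
  \<open>e\<^sub>A e\<^sub>B = \<plusminus> e\<^sub>C\<close> with \<open>C\<close> the symmetric difference of \<open>A\<close> and \<open>B\<close>. Sorting the product
  costs one sign for each pair \<open>j < i\<close> with \<open>i \<in> A\<close>, \<open>j \<in> B\<close> (a transposition) and one
  for each \<open>i \<in> A \<inter> B\<close> (since \<open>e\<^sub>i\<^sup>2 = -1\<close>).
\<close>

definition cl_sign :: "'m::{finite,linorder} set \<Rightarrow> 'm set \<Rightarrow> 'a::comm_ring_1" where
  "cl_sign A B = (-1) ^ card {(i, j). i \<in> A \<and> j \<in> B \<and> j \<le> i}"

definition cl_mult :: "'a::comm_ring_1 ^ ('m::{finite,linorder} set) \<Rightarrow> 'a ^ ('m set) \<Rightarrow> 'a ^ ('m set)"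
    (infixl "\<odot>" 70) where
  "x \<odot> y = (\<chi> C. \<Sum>(A, B) | sym_diff A B = C. cl_sign A B * x $ A * y $ B)"

abbreviation cl_basis :: "'m::{finite,linorder} set \<Rightarrow> 'a::comm_ring_1 ^ ('m set)" where
  "cl_basis A \<equiv> axis A 1"

abbreviation cl_gen :: "'m::{finite,linorder} \<Rightarrow> 'a::comm_ring_1 ^ ('m set)" where
  "cl_gen i \<equiv> cl_basis {i}"

definition cl_scalar :: "'a::comm_ring_1 \<Rightarrow> 'a ^ ('m::{finite,linorder} set)" where
  "cl_scalar c = c *s cl_basis {}"

definition cl_vector :: "real ^ 'm::{finite,linorder} \<Rightarrow> real ^ ('m set)" where
  "cl_vector x = (\<Sum>i\<in>UNIV. (x $ i) *\<^sub>R cl_gen i)"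

definition cl_complexify :: "real ^ ('m::{finite,linorder} set) \<Rightarrow> complex ^ ('m set)" where
  "cl_complexify x = (\<chi> A. complex_of_real (x $ A))"


subsection \<open>Sanity checks\<close>

lemma norm_cl:
  fixes x :: "'a::real_normed_vector ^ ('m::{finite,linorder} set)"
  shows "norm x = sqrt (\<Sum>A\<in>UNIV. (norm (x $ A))\<^sup>2)"
  by (simp add: norm_vec_def L2_set_def)

lemma norm_cl_complexify: "norm (cl_complexify x) = norm x"
  by (simp add: norm_vec_def cl_complexify_def)

lemma cl_vector_nth: "cl_vector x $ A = (\<Sum>i\<in>UNIV. if A = {i} then x $ i else 0)"
  by (auto simp: cl_vector_def axis_def intro!: sum.cong)

lemma norm_cl_vector: "norm (cl_vector x) = norm x"
proof -
  have "(\<Sum>A\<in>UNIV. (cl_vector x $ A)\<^sup>2) = (\<Sum>A\<in>range (\<lambda>i. {i}). (cl_vector x $ A)\<^sup>2)"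
    by (rule sum.mono_neutral_right) (auto simp: cl_vector_nth intro!: sum.neutral)
  also have "\<dots> = (\<Sum>i\<in>UNIV. (x $ i)\<^sup>2)"
    by (subst sum.reindex) (auto simp: cl_vector_nth)
  finally show ?thesis
    by (simp add: norm_vec_def L2_set_def)
qed

lemma cl_basis_mult:
  "cl_basis A \<odot> cl_basis B = (cl_sign A B *s cl_basis (sym_diff A B) :: 'a::comm_ring_1 ^ _)"
proof -
  have "(\<Sum>(A', B') | sym_diff A' B' = C.
            cl_sign A' B' * cl_basis A $ A' * (cl_basis B $ B' :: 'a)) =
        (if sym_diff A B = C then cl_sign A B else 0)" (is "sum ?f ?S = _") for C
  proof -
    have "sum ?f ?S = sum ?f (?S \<inter> {(A, B)})"
      by (rule sum.mono_neutral_right) (auto simp: axis_def split: if_splits)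
    also have "\<dots> = (if sym_diff A B = C then cl_sign A B else 0)"
      by (auto simp: axis_def)
    finally show ?thesis .
  qed
  then show ?thesis
    by (simp add: vec_eq_iff cl_mult_def) (auto simp: axis_def)
qed

lemma cl_mult_add_left: "(x + y) \<odot> z = x \<odot> z + y \<odot> z"
  by (simp add: cl_mult_def vec_eq_iff case_prod_unfold ring_distribs sum.distrib)

lemma cl_mult_add_right: "z \<odot> (x + y) = z \<odot> x + z \<odot> y"
  by (simp add: cl_mult_def vec_eq_iff case_prod_unfold ring_distribs sum.distrib)

lemma cl_mult_smult_left: "(c *s x) \<odot> y = c *s (x \<odot> y)"
  by (simp add: cl_mult_def vec_eq_iff case_prod_unfold sum_distrib_left ac_simps)

lemma cl_mult_smult_right: "x \<odot> (c *s y) = c *s (x \<odot> y)"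
  by (simp add: cl_mult_def vec_eq_iff case_prod_unfold sum_distrib_left ac_simps)

lemma cl_sum_left: "sum f I \<odot> y = (\<Sum>i\<in>I. f i \<odot> y)"
  by (induction I rule: infinite_finite_induct)
     (simp_all add: cl_mult_add_left, simp_all add: cl_mult_def vec_eq_iff)

lemma cl_sum_right: "y \<odot> sum f I = (\<Sum>i\<in>I. y \<odot> f i)"
  by (induction I rule: infinite_finite_induct)
     (simp_all add: cl_mult_add_right, simp_all add: cl_mult_def vec_eq_iff)

lemma cl_expand: "x = (\<Sum>A\<in>UNIV. x $ A *s cl_basis A)"
  by (simp add: vec_eq_iff axis_def if_distrib cong: if_cong)

lemma cl_mult_one_left: "cl_basis {} \<odot> x = x"
  by (subst (1 2) cl_expand[of x])
     (simp add: cl_sum_right cl_mult_smult_right cl_basis_mult cl_sign_def)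

lemma cl_mult_one_right: "x \<odot> cl_basis {} = x"
  by (subst (1 2) cl_expand[of x])
     (simp add: cl_sum_left cl_mult_smult_left cl_basis_mult cl_sign_def)

lemma cl_gen_sq: "cl_gen i \<odot> cl_gen i = (- cl_basis {} :: 'a::comm_ring_1 ^ _)"
proof -
  have "{(i', j). i' \<in> {i} \<and> j \<in> {i} \<and> j \<le> i'} = {(i, i)}" by auto
  then have "cl_sign {i} {i} = (-1 :: 'a)" unfolding cl_sign_def by simp
  then show ?thesis by (simp add: cl_basis_mult vec_eq_iff)
qed

lemma cl_gen_anticommute:
  assumes "i \<noteq> j"
  shows "cl_gen i \<odot> cl_gen j = (- (cl_gen j \<odot> cl_gen i) :: 'a::comm_ring_1 ^ _)"
proof -
  have "{(i', j'). i' \<in> {a} \<and> j' \<in> {b} \<and> j' \<le> i'} = (if b \<le> a then {(a, b)} else {})"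
    for a b :: 'b by auto
  then have "cl_sign {a} {b} = (if b \<le> a then -1 else 1 :: 'a)" for a b :: 'b
    unfolding cl_sign_def by simp
  moreover have "sym_diff {i} {j} = {i, j}" "sym_diff {j} {i} = {i, j}" using assms by auto
  ultimately show ?thesis
    using assms by (simp add: cl_basis_mult vec_eq_iff del: Un_insert_left Un_insert_right) auto
qed

lemma cl_basis_insert:
  assumes "\<And>j. j \<in> A \<Longrightarrow> i < j"
  shows "cl_gen i \<odot> cl_basis A = (cl_basis (insert i A) :: 'a::comm_ring_1 ^ _)"
proof -
  have "{(i', j). i' \<in> {i} \<and> j \<in> A \<and> j \<le> i'} = {}" using assms by fastforce
  then have "cl_sign {i} A = (1 :: 'a)" by (simp only: cl_sign_def card.empty power_0)
  moreover have "sym_diff {i} A = insert i A" using assms by fastforce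
  ultimately show ?thesis by (simp only: cl_basis_mult) simp
qed

lemma cl_sign_sym_diff_left:
  "cl_sign (sym_diff A B) C = (cl_sign A C * cl_sign B C :: 'a::comm_ring_1)"
proof -
  define P where "P D = {(i, j). i \<in> D \<and> j \<in> C \<and> j \<le> i}" for D
  have fin: "finite (P D)" for D by simp
  have "P (sym_diff A B) = (P A - P B) \<union> (P B - P A)" by (auto simp: P_def)
  then have "card (P (sym_diff A B)) = card (P A - P B) + card (P B - P A)"
    by (simp add: card_Un_disjoint Int_Diff disjoint_iff)
  moreover have "card (P A) = card (P A - P B) + card (P A \<inter> P B)"
    by (metis card_Diff_subset_Int card_mono fin finite_Int inf_le1 le_add_diff_inverse2)
  moreover have "card (P B) = card (P B - P A) + card (P A \<inter> P B)"
    by (metis card_Diff_subset_Int card_mono fin finite_Int inf_commute inf_le1 le_add_diff_inverse2)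
  ultimately have "card (P A) + card (P B) = card (P (sym_diff A B)) + 2 * card (P A \<inter> P B)"
    by simp
  then have "(-1::'a) ^ (card (P A) + card (P B)) = (-1) ^ card (P (sym_diff A B))"
    by (simp add: power_add power_mult)
  then show ?thesis by (simp add: cl_sign_def P_def power_add)
qed

lemma cl_sign_sym_diff_right:
  "cl_sign C (sym_diff A B) = (cl_sign C A * cl_sign C B :: 'a::comm_ring_1)"
proof -
  define P where "P D = {(i, j). i \<in> C \<and> j \<in> D \<and> j \<le> i}" for D
  have fin: "finite (P D)" for D by simp
  have "P (sym_diff A B) = (P A - P B) \<union> (P B - P A)" by (auto simp: P_def)
  then have "card (P (sym_diff A B)) = card (P A - P B) + card (P B - P A)"
    by (simp add: card_Un_disjoint Int_Diff disjoint_iff)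
  moreover have "card (P A) = card (P A - P B) + card (P A \<inter> P B)"
    by (metis card_Diff_subset_Int card_mono fin finite_Int inf_le1 le_add_diff_inverse2)
  moreover have "card (P B) = card (P B - P A) + card (P A \<inter> P B)"
    by (metis card_Diff_subset_Int card_mono fin finite_Int inf_commute inf_le1 le_add_diff_inverse2)
  ultimately have "card (P A) + card (P B) = card (P (sym_diff A B)) + 2 * card (P A \<inter> P B)"
    by simp
  then have "(-1::'a) ^ (card (P A) + card (P B)) = (-1) ^ card (P (sym_diff A B))"
    by (simp add: power_add power_mult)
  then show ?thesis by (simp add: cl_sign_def P_def power_add)
qed

lemma cl_basis_assoc:
  "(cl_basis A \<odot> cl_basis B) \<odot> cl_basis C = (cl_basis A \<odot> (cl_basis B \<odot> cl_basis C) :: 'a::comm_ring_1 ^ _)"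
proof -
  have "sym_diff (sym_diff A B) C = sym_diff A (sym_diff B C)" by auto
  then show ?thesis
    by (simp only: cl_basis_mult cl_mult_smult_left cl_mult_smult_right vector_smult_assoc
        cl_sign_sym_diff_left cl_sign_sym_diff_right ac_simps)
qed

lemma cl_mult_assoc: "(x \<odot> y) \<odot> z = x \<odot> (y \<odot> z)"
  by (subst (1 2) cl_expand[of x], subst (1 2) cl_expand[of y], subst (1 2) cl_expand[of z])
     (simp only: cl_sum_left cl_sum_right cl_mult_smult_left cl_mult_smult_right cl_basis_assoc)

section \<open>The Clifford--Fourier transforms\<close>

definition partial_derivative ::
    "'m \<Rightarrow> (real ^ 'm \<Rightarrow> 'b::real_normed_vector) \<Rightarrow> real ^ 'm \<Rightarrow> 'b" where
  "partial_derivative k g y = frechet_derivative g (at y) (axis k 1)"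

definition cl_gamma :: "(real ^ 'm::{finite,linorder} \<Rightarrow> complex ^ ('m set)) \<Rightarrow>
    real ^ 'm::{finite,linorder} \<Rightarrow> complex ^ ('m set)" where
  "cl_gamma g y = - (\<Sum>(j, k) | j < k. cl_gen j \<odot> cl_gen k \<odot>
      (y $ j *\<^sub>R partial_derivative k g y - y $ k *\<^sub>R partial_derivative j g y))"

text \<open>
  \<open>e\<^sup>a\<^sup>\<Gamma>\<close> as an exponential series. It is only applied to homogeneous polynomials of a fixed
  degree; these form a finite-dimensional space invariant under \<open>\<Gamma>\<close>, so the series converges
  there and may be evaluated pointwise.
\<close>

definition cl_exp_gamma :: "complex \<Rightarrow> (real ^ 'm::{finite,linorder} \<Rightarrow> complex ^ ('m set)) \<Rightarrow>
    real ^ 'm::{finite,linorder} \<Rightarrow> complex ^ ('m set)" where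
  "cl_exp_gamma a g y = (\<Sum>n. (a ^ n / fact n) *s (cl_gamma ^^ n) g y)"

text \<open>
  The parameter \<open>\<sigma> \<in> {1, -1}\<close> selects the sign: \<open>\<sigma> = 1\<close> gives \<open>K\<^sub>+\<close> and \<open>\<F>\<^sub>+\<close>,
  \<open>\<sigma> = -1\<close> gives \<open>K\<^sub>-\<close> and \<open>\<F>\<^sub>-\<close>. Note the opposite sign in the exponent of \<open>\<Gamma>\<close>.
\<close>

definition cft_kernel :: "real \<Rightarrow> real ^ 'm::{finite,linorder} \<Rightarrow> real ^ 'm::{finite,linorder} \<Rightarrow>
    complex ^ ('m set)" where
  "cft_kernel \<sigma> x y = (\<Sum>n. ((- \<i>) ^ n / fact n) *s
      cl_exp_gamma (- complex_of_real \<sigma> * \<i> * (complex_of_real pi / 2))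
        (\<lambda>z. cl_scalar (complex_of_real ((x \<bullet> z) ^ n))) y)"

definition cft :: "real \<Rightarrow> (real ^ 'm::{finite,linorder} \<Rightarrow> real ^ ('m set)) \<Rightarrow>
    real ^ 'm::{finite,linorder} \<Rightarrow> complex ^ ('m set)" where
  "cft \<sigma> f y = ((2 * pi) powr (- real CARD('m) / 2)) *\<^sub>R
      (\<integral>x. cft_kernel \<sigma> x y \<odot> cl_complexify (f x) \<partial>lebesgue)"


subsection \<open>Extension from Schwartz functions to square integrable functions\<close>

text \<open>
  All iterated partial derivatives (the list gives the directions) exist, are differentiable,
  and decay faster than any power.
\<close>

definition schwartz :: "(real ^ 'm \<Rightarrow> 'b::real_normed_vector) \<Rightarrow> bool" where
  "schwartz f \<longleftrightarrow> (\<forall>ks :: 'm list.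
      (\<forall>x. fold partial_derivative ks f differentiable at x) \<and>
      (\<forall>N::nat. bounded (range (\<lambda>x. norm x ^ N *\<^sub>R fold partial_derivative ks f x))))"

definition l2_norm_sq :: "('a::euclidean_space \<Rightarrow> 'b::real_normed_vector) \<Rightarrow> ennreal" where
  "l2_norm_sq f = (\<integral>\<^sup>+x. ennreal ((norm (f x))\<^sup>2) \<partial>lebesgue)"

definition square_integrable :: "('a::euclidean_space \<Rightarrow> 'b::real_normed_vector) \<Rightarrow> bool" where
  "square_integrable f \<longleftrightarrow> f \<in> borel_measurable lebesgue \<and> l2_norm_sq f < \<infinity>"

text \<open>
  Functions stand for their classes modulo almost everywhere equality. Continuity is sequential,
  with respect to the square of the \<open>L\<^sub>2\<close> distance; as constant sequences are allowed, \<open>T\<close> is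
  compatible with almost everywhere equality.
\<close>

definition is_cft_extension :: "real \<Rightarrow>
    ((real ^ 'm::{finite,linorder} \<Rightarrow> real ^ ('m set)) \<Rightarrow>
     real ^ 'm::{finite,linorder} \<Rightarrow> complex ^ ('m set)) \<Rightarrow> bool" where
  "is_cft_extension \<sigma> T \<longleftrightarrow>
     (\<forall>f. square_integrable f \<longrightarrow> square_integrable (T f)) \<and>
     (\<forall>f. schwartz f \<longrightarrow> (AE y in lebesgue. T f y = cft \<sigma> f y)) \<and>
     (\<forall>f g. square_integrable f \<and> (\<forall>n. square_integrable (g n)) \<and>
        (\<lambda>n. l2_norm_sq (\<lambda>x. g n x - f x)) \<longlonglongrightarrow> 0 \<longrightarrow>
        (\<lambda>n. l2_norm_sq (\<lambda>y. T (g n) y - T f y)) \<longlonglongrightarrow> 0)"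

text \<open>The extension is unique up to almost everywhere equality of its values.\<close>

definition cft_l2 :: "real \<Rightarrow> (real ^ 'm::{finite,linorder} \<Rightarrow> real ^ ('m set)) \<Rightarrow>
    real ^ 'm::{finite,linorder} \<Rightarrow> complex ^ ('m set)" where
  "cft_l2 \<sigma> = (SOME T. is_cft_extension \<sigma> T)"

end

theory Submission
  imports Defs "HOL-Probability.Probability"
begin

text \<open>
  The operators \<open>\<Gamma>\<^sub>y\<close> are symmetric for the inner product of polynomials weighted by a centred
  Gaussian, so \<open>e\<^bsup>\<mp>i\<pi>/2 \<Gamma>\<^esup>\<close> is an isometry for it. Hence inner products of Clifford--Fourier kernels
  against a Gaussian weight in \<open>y\<close> are the same as those of the ordinary Fourier kernel, which gives
  \<open>\<integral> |F f|\<^sup>2 exp (- |y|\<^sup>2/4a) dy = \<integral>\<integral> h\<^sub>a(x' - x) \<langle>f x, f x'\<rangle> dx dx'\<close> with \<open>h\<^sub>a\<close> a heat kernel approximating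
  the identity. Letting \<open>a\<close> tend to infinity yields Plancherel's formula, and the second moment of \<open>F f\<close>
  is the limit of \<open>2a\<close> times the heat energy
  \<open>\<integral>\<integral> h\<^sub>a(x' - x) |f x' - f x|\<^sup>2 dx dx'\<close>. The inequality thus becomes one between
  \<open>\<integral> |x|\<^sup>2 |f|\<^sup>2\<close> and the heat energy of \<open>f\<close>, in which \<open>F\<close> no longer occurs; Gaussians attain it
  by explicit computation.
\<close>

section \<open>Gaussian integrals and the heat kernel\<close>

text \<open>The obstacle is that the only bound at hand for the kernel is |K(x,y)| \<le> exp(C |x|
  |y|), which by itself does not make the integral of K against an integrable f converge. The
  Gaussian weight overcomes this in two ways. It dominates the growth in y for fixed x and x', and,
  being rotation invariant, it is annihilated by the rotation fields in Gamma, which makes Gamma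
  symmetric. The diagonal case x = x' then says that y \<mapsto> K(x,y) f(x) has a weighted L2 norm
  proportional to |f(x)|, with no trace of the exponential; this replaces kernel bounds in every use
  of Fubini. No intertwining of F with derivatives is used and no derivative of a general f: the
  second moment of F f is read off from weighted norms through 1 - exp(-s) ~ s for s = |y|^2/(4a).
  The rate 1/(4a) is chosen so that the cosine transform of the weight is a multiple of
  \<open>heat a\<close>, a probability density of variance 1/(2a) in each coordinate. Inequalities
  suffice for the comparison: 1 - exp(-s) \<le> s bounds the product of the moments from below,
  Fatou's lemma handles the Gaussians.\<close>

lemma integral_lborel_prod:
  fixes f :: "'a::euclidean_space \<Rightarrow> real \<Rightarrow> 'b::{real_normed_field,banach,second_countable_topology}"
  assumes f: "\<And>b. b \<in> Basis \<Longrightarrow> integrable lborel (f b)"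
  shows "integrable lborel (\<lambda>x::'a. \<Prod>b\<in>Basis. f b (x \<bullet> b))"
    and "(\<integral>x. (\<Prod>b\<in>Basis. f b (x \<bullet> b)) \<partial>lborel) = (\<Prod>b\<in>Basis. integral\<^sup>L lborel (f b))"
proof -
  interpret product_sigma_finite "\<lambda>_::'a. lborel :: real measure" ..
  note [measurable] = borel_measurable_integrable[OF f]
  have m: "(\<lambda>x::'a. \<Prod>b\<in>Basis. f b (x \<bullet> b)) \<in> borel_measurable borel" by measurable
  have "integrable (\<Pi>\<^sub>M b\<in>Basis. lborel) (\<lambda>x. \<Prod>b\<in>Basis. f b ((\<Sum>b\<in>Basis. x b *\<^sub>R b) \<bullet> (b::'a)))"
    using product_integrable_prod[of "Basis :: 'a set" f] f by simp
  then show "integrable lborel (\<lambda>x::'a. \<Prod>b\<in>Basis. f b (x \<bullet> b))"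
    by (subst lborel_eq) (simp add: integrable_distr_eq m)
  show "(\<integral>x. (\<Prod>b\<in>Basis. f b (x \<bullet> b)) \<partial>lborel) = (\<Prod>b\<in>Basis. integral\<^sup>L lborel (f b))"
    using product_integral_prod[of "Basis :: 'a set" f] f
    by (subst lborel_eq) (simp add: integral_distr m)
qed

text \<open>Rescaling by \<open>s\<close> with \<open>s\<^sup>2 = 2 * e\<close> turns the weight
  into the standard normal density, whose characteristic function is known.\<close>

lemma gaussian_fourier_real:
  fixes e u :: real
  assumes e: "e > 0"
  shows "integrable lborel (\<lambda>y. complex_of_real (exp (- e * y\<^sup>2)) * exp (\<i> * (u * y)))" (is ?int)
    and "(\<integral>y. complex_of_real (exp (- e * y\<^sup>2)) * exp (\<i> * (u * y)) \<partial>lborel) =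
      complex_of_real (sqrt (pi / e) * exp (- u\<^sup>2 / (4 * e)))" (is ?eq)
proof -
  define s where "s = sqrt (2 * e)"
  have s: "s > 0" "s\<^sup>2 = 2 * e" using e by (auto simp: s_def)
  define F where "F x = complex_of_real (std_normal_density x) * exp (\<i> * (u / s * x))" for x
  have intF: "integrable lborel F"
  proof (rule Bochner_Integration.integrable_bound[of _ std_normal_density])
    show "F \<in> borel_measurable lborel" unfolding F_def by measurable
  qed (auto simp: F_def norm_mult)
  have "char std_normal_distribution (u / s) = integral\<^sup>L lborel F"
    unfolding char_def F_def
    by (subst integral_density) (auto simp: scaleR_conv_of_real)
  then have valF: "integral\<^sup>L lborel F = complex_of_real (exp (- (u / s)\<^sup>2 / 2))"
    by (simp add: char_std_normal_distribution)
  have Fs: "F (0 + s * y) = (1 / sqrt (2 * pi)) *\<^sub>R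
      (complex_of_real (exp (- e * y\<^sup>2)) * exp (\<i> * (u * y)))" for y
    using s by (simp add: F_def std_normal_density_def scaleR_conv_of_real power_mult_distrib)
  have "integrable lborel (\<lambda>y. F (0 + s * y))"
    using lborel_integrable_real_affine[OF intF, of s 0] s by simp
  then have "integrable lborel (\<lambda>y. sqrt (2 * pi) *\<^sub>R F (0 + s * y))" by (rule integrable_scaleR_right)
  then show ?int unfolding Fs by simp
  have "integral\<^sup>L lborel F = s *\<^sub>R (\<integral>y. F (0 + s * y) \<partial>lborel)"
    using lborel_integral_real_affine[of s F 0] s by simp
  also have "\<dots> = (s / sqrt (2 * pi)) *\<^sub>R
     (\<integral>y. complex_of_real (exp (- e * y\<^sup>2)) * exp (\<i> * (u * y)) \<partial>lborel)"
    unfolding Fs by (subst integral_scaleR_right) auto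
  finally have "(\<integral>y. complex_of_real (exp (- e * y\<^sup>2)) * exp (\<i> * (u * y)) \<partial>lborel)
     = (sqrt (2 * pi) / s) *\<^sub>R complex_of_real (exp (- (u / s)\<^sup>2 / 2))"
    using s valF by simp
  moreover have "sqrt (2 * pi) / s = sqrt (pi / e)"
    using e by (simp add: s_def real_sqrt_divide[symmetric])
  moreover have "- (u / s)\<^sup>2 / 2 = - u\<^sup>2 / (4 * e)" using s e by (simp add: power_divide)
  ultimately show ?eq by (simp add: scaleR_conv_of_real)
qed

lemma norm_sq_Basis: "(norm (y::'a::euclidean_space))\<^sup>2 = (\<Sum>b\<in>Basis. (y \<bullet> b)\<^sup>2)"
  unfolding power2_norm_eq_inner by (subst euclidean_inner) (simp add: power2_eq_square)

text \<open>Product of the one-dimensional formulas. Only the real part is kept, because inner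
  products of kernels will produce cosines.\<close>

lemma gaussian_fourier:
  fixes u :: "'a::euclidean_space"
  assumes e: "e > 0"
  shows "integrable lborel (\<lambda>y::'a. exp (- e * (norm y)\<^sup>2))"
    and "(\<integral>y. exp (- e * (norm y)\<^sup>2) * cos (u \<bullet> y) \<partial>lborel) =
      (pi / e) powr (DIM('a) / 2) * exp (- (norm u)\<^sup>2 / (4 * e))"
proof -
  define f where "f b y = complex_of_real (exp (- e * y\<^sup>2)) * exp (\<i> * ((u \<bullet> b) * y))" for b :: 'a and y
  have prod: "(\<Prod>b\<in>Basis. f b (y \<bullet> b)) = complex_of_real (exp (- e * (norm y)\<^sup>2)) * exp (\<i> * (u \<bullet> y))" for y
    by (simp add: f_def prod.distrib exp_sum[symmetric] norm_sq_Basis sum_distrib_left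
        euclidean_inner[of u y] sum_negf[symmetric] flip: of_real_prod of_real_mult)
  have intf: "integrable lborel (f b)" and valf: "integral\<^sup>L lborel (f b) =
      complex_of_real (sqrt (pi / e) * exp (- (u \<bullet> b)\<^sup>2 / (4 * e)))" for b
    using gaussian_fourier_real[OF e, of "u \<bullet> b"] unfolding f_def by simp_all
  have int: "integrable lborel (\<lambda>y. complex_of_real (exp (- e * (norm y)\<^sup>2)) * exp (\<i> * (u \<bullet> y)))"
    using integral_lborel_prod(1)[of f, OF intf] unfolding prod .
  then have "integrable lborel (\<lambda>y. norm (complex_of_real (exp (- e * (norm y)\<^sup>2)) * exp (\<i> * (u \<bullet> y))))"
    by (rule integrable_norm)
  then show "integrable lborel (\<lambda>y::'a. exp (- e * (norm y)\<^sup>2))"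
    by (simp add: norm_mult)
  have "(\<integral>y. complex_of_real (exp (- e * (norm y)\<^sup>2)) * exp (\<i> * (u \<bullet> y)) \<partial>lborel) =
     (\<Prod>b\<in>Basis. complex_of_real (sqrt (pi / e) * exp (- (u \<bullet> b)\<^sup>2 / (4 * e))))"
    using integral_lborel_prod(2)[of f, OF intf] unfolding prod valf .
  also have "\<dots> = complex_of_real (sqrt (pi / e) ^ DIM('a) * exp (- (norm u)\<^sup>2 / (4 * e)))"
    by (simp add: prod.distrib exp_sum[symmetric] norm_sq_Basis sum_divide_distrib sum_negf
        flip: of_real_prod of_real_mult)
  also have "sqrt (pi / e) ^ DIM('a) = (pi / e) powr (DIM('a) / 2)"
    using e by (simp add: powr_half_sqrt[symmetric] powr_realpow[symmetric] powr_powr)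
  finally have "Re (\<integral>y. complex_of_real (exp (- e * (norm y)\<^sup>2)) * exp (\<i> * (u \<bullet> y)) \<partial>lborel) =
    (pi / e) powr (DIM('a) / 2) * exp (- (norm u)\<^sup>2 / (4 * e))" by simp
  moreover have "Re (\<integral>y. complex_of_real (exp (- e * (norm y)\<^sup>2)) * exp (\<i> * (u \<bullet> y)) \<partial>lborel) =
     (\<integral>y. Re (complex_of_real (exp (- e * (norm y)\<^sup>2)) * exp (\<i> * (u \<bullet> y))) \<partial>lborel)"
    using int by (rule integral_Re[symmetric])
  moreover have "Re (complex_of_real (exp (- e * (norm y)\<^sup>2)) * exp (\<i> * (u \<bullet> y)))
     = exp (- e * (norm y)\<^sup>2) * cos (u \<bullet> y)" for y
    using cis_conv_exp[of "u \<bullet> y"] by (simp flip: cis_conv_exp)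
  ultimately show "(\<integral>y. exp (- e * (norm y)\<^sup>2) * cos (u \<bullet> y) \<partial>lborel) =
      (pi / e) powr (DIM('a) / 2) * exp (- (norm u)\<^sup>2 / (4 * e))" by simp
qed

lemma gaussian_integral:
  fixes e :: real
  assumes "e > 0"
  shows "(\<integral>(y::'a::euclidean_space). exp (- e * (norm y)\<^sup>2) \<partial>lborel) = (pi / e) powr (DIM('a) / 2)"
  using gaussian_fourier(2)[OF assms, of "0::'a"] by simp

section \<open>Functions of exponential growth against a Gaussian\<close>

lemma integrable_exp_norm_gaussian:
  fixes e D :: real
  assumes e: "e > 0"
  shows "integrable lborel (\<lambda>y::'a::euclidean_space. exp (D * norm y) * exp (- e * (norm y)\<^sup>2))"
proof (rule Bochner_Integration.integrable_bound)
  show "integrable lborel (\<lambda>y::'a. exp (D\<^sup>2 / (2 * e)) * exp (- (e / 2) * (norm y)\<^sup>2))"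
    by (intro integrable_mult_right gaussian_fourier(1)) (use e in auto)
  \<comment> \<open>Completing the square: half of the decay rate pays for the exponential, the
    other half stays integrable.\<close>
  have "D * t - e * t\<^sup>2 \<le> D\<^sup>2 / (2 * e) - (e / 2) * t\<^sup>2" for t
  proof -
    have "0 \<le> (D - e * t)\<^sup>2 / (2 * e)" using e by simp
    also have "\<dots> = D\<^sup>2 / (2 * e) - (e / 2) * t\<^sup>2 - (D * t - e * t\<^sup>2)"
      using e by (simp add: field_simps power2_eq_square)
    finally show ?thesis by simp
  qed
  then show "AE y in lborel. norm (exp (D * norm (y::'a)) * exp (- e * (norm y)\<^sup>2)) \<le>
      norm (exp (D\<^sup>2 / (2 * e)) * exp (- (e / 2) * (norm y)\<^sup>2))"
    by (auto simp flip: exp_add)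
qed simp

text \<open>Exponential bounds are closed under sums and products without any count of degrees, and
  they have the shape of the bound for the Clifford--Fourier kernel, so one integrability criterion
  serves both.\<close>

lemma real_polynomial_function_exp_bound:
  assumes "real_polynomial_function q"
  shows "\<exists>C D. 0 \<le> C \<and> 0 \<le> D \<and> (\<forall>y. \<bar>q y\<bar> \<le> C * exp (D * norm y))"
  using assms
proof induction
  case (linear f)
  then obtain K where K: "K > 0" "\<And>y. \<bar>f y\<bar> \<le> norm y * K"
    using bounded_linear.pos_bounded[OF linear] by auto
  have "\<bar>f y\<bar> \<le> K * exp (1 * norm y)" for y
  proof -
    have "norm y \<le> exp (norm y)" using exp_ge_add_one_self[of "norm y"] by linarith
    with K(1) have "norm y * K \<le> K * exp (norm y)" by simp
    then show ?thesis using K(2)[of y] by simp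
  qed
  then show ?case using K(1) by (intro exI[of _ K] exI[of _ 1]) auto
next
  case (const c)
  then show ?case by (intro exI[of _ "\<bar>c\<bar>"] exI[of _ 0]) auto
next
  case (add f g)
  then obtain C D C' D' where
    h: "0 \<le> C" "0 \<le> D" "\<And>y. \<bar>f y\<bar> \<le> C * exp (D * norm y)"
       "0 \<le> C'" "0 \<le> D'" "\<And>y. \<bar>g y\<bar> \<le> C' * exp (D' * norm y)" by blast
  have mono: "A * exp (B * norm y) \<le> A * exp (B' * norm y)" if "0 \<le> A" "B \<le> B'" for A B B' and y :: 'a
    using that by (intro mult_left_mono) (simp_all add: mult_right_mono)
  have "\<bar>f y + g y\<bar> \<le> (C + C') * exp ((D + D') * norm y)" for y
  proof -
    have "\<bar>f y\<bar> \<le> C * exp ((D + D') * norm y)"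
      by (rule order_trans[OF h(3) mono]) (use h in simp_all)
    moreover have "\<bar>g y\<bar> \<le> C' * exp ((D + D') * norm y)"
      by (rule order_trans[OF h(6) mono]) (use h in simp_all)
    ultimately show ?thesis by (simp add: distrib_right)
  qed
  then show ?case using h by (intro exI[of _ "C + C'"] exI[of _ "D + D'"]) auto
next
  case (mult f g)
  then obtain C D C' D' where
    h: "0 \<le> C" "0 \<le> D" "\<And>y. \<bar>f y\<bar> \<le> C * exp (D * norm y)"
       "0 \<le> C'" "0 \<le> D'" "\<And>y. \<bar>g y\<bar> \<le> C' * exp (D' * norm y)" by blast
  have "\<bar>f y * g y\<bar> \<le> (C * C') * exp ((D + D') * norm y)" for y
    using mult_mono[OF h(3)[of y] h(6)[of y]] h by (simp add: abs_mult exp_add algebra_simps)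
  then show ?case using h by (intro exI[of _ "C * C'"] exI[of _ "D + D'"]) auto
qed

lemma real_polynomial_function_continuous:
  fixes q :: "'a::euclidean_space \<Rightarrow> real"
  assumes "real_polynomial_function q" shows "continuous_on UNIV q"
  by (rule continuous_at_imp_continuous_on) (use assms continuous_real_polymonial_function in auto)

lemma real_polynomial_function_frechet:
  fixes q :: "'a::euclidean_space \<Rightarrow> real"
  assumes "real_polynomial_function q"
  shows "real_polynomial_function (\<lambda>y. frechet_derivative q (at y) v)"
  using assms
proof induction
  case (linear f)
  then have "frechet_derivative f (at y) = f" for y
    using bounded_linear.has_derivative[OF linear has_derivative_ident]
    by (intro frechet_derivative_at[symmetric])
  then have "(\<lambda>y. frechet_derivative f (at y) v) = (\<lambda>_. f v)" by simp
  then show ?case by (simp only: real_polynomial_function.intros(2))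
next
  case (const c)
  show ?case by (simp add: real_polynomial_function.intros(2))
next
  case (add f g)
  have "frechet_derivative (\<lambda>x. f x + g x) (at y) v =
     frechet_derivative f (at y) v + frechet_derivative g (at y) v" for y
    using add by (subst frechet_derivative_at[symmetric, OF has_derivative_add[OF
        frechet_derivative_works[THEN iffD1] frechet_derivative_works[THEN iffD1]]])
      (simp_all add: differentiable_at_real_polynomial_function)
  then show ?case using add by auto
next
  case (mult f g)
  have "frechet_derivative (\<lambda>x. f x * g x) (at y) v =
     f y * frechet_derivative g (at y) v + frechet_derivative f (at y) v * g y" for y
    using mult by (subst frechet_derivative_at[symmetric, OF has_derivative_mult[OF
        frechet_derivative_works[THEN iffD1] frechet_derivative_works[THEN iffD1]]])
      (simp_all add: differentiable_at_real_polynomial_function)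
  then show ?case using mult by auto
qed

lemma integrable_polynomial_gaussian:
  fixes q :: "'a::euclidean_space \<Rightarrow> real"
  assumes q: "real_polynomial_function q" and e: "e > 0"
  shows "integrable lborel (\<lambda>y. q y * exp (- e * (norm y)\<^sup>2))"
proof -
  obtain C D where CD: "0 \<le> C" "\<And>y. \<bar>q y\<bar> \<le> C * exp (D * norm y)"
    using real_polynomial_function_exp_bound[OF q] by metis
  have [measurable]: "q \<in> borel_measurable borel"
    by (rule borel_measurable_continuous_onI[OF real_polynomial_function_continuous[OF q]])
  show ?thesis
  proof (rule Bochner_Integration.integrable_bound)
    show "integrable lborel (\<lambda>y::'a. C * (exp (D * norm y) * exp (- e * (norm y)\<^sup>2)))"
      by (intro integrable_mult_right integrable_exp_norm_gaussian e)
    show "AE y in lborel. norm (q y * exp (- e * (norm y)\<^sup>2)) \<le>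
       norm (C * (exp (D * norm y) * exp (- e * (norm y)\<^sup>2)))"
      using CD by (auto simp: abs_mult mult.assoc[symmetric] intro!: mult_right_mono)
  qed measurable
qed

section \<open>Translation invariance and integration by parts\<close>

lemma integrable_lborel_translate:
  fixes c :: "'a::euclidean_space" and f :: "'a \<Rightarrow> 'b::{banach,second_countable_topology}"
  assumes f: "integrable lborel f"
  shows "integrable lborel (\<lambda>x. f (c + x))"
proof -
  have "integrable (distr lborel borel ((+) c)) f" using f by (simp add: lborel_distr_plus)
  then show ?thesis using borel_measurable_integrable[OF f] by (simp add: integrable_distr_eq)
qed

lemma integral_lborel_translate:
  fixes c :: "'a::euclidean_space" and f :: "'a \<Rightarrow> 'b::{banach,second_countable_topology}"
  assumes [measurable]: "f \<in> borel_measurable borel"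
  shows "(\<integral>x. f (c + x) \<partial>lborel) = (\<integral>x. f x \<partial>lborel)"
  by (subst (2) lborel_distr_plus[of c, symmetric]) (simp add: integral_distr)

text \<open>By translation invariance the increments of \<open>\<psi>\<close> along \<open>v\<close> integrate to zero; they are
  averages of translates of \<open>\<psi>'\<close>.\<close>

lemma integral_directional_derivative:
  fixes \<psi> \<psi>' :: "'a::euclidean_space \<Rightarrow> real"
  assumes d: "\<And>y t. ((\<lambda>t. \<psi> (y + t *\<^sub>R v)) has_real_derivative \<psi>' (y + t *\<^sub>R v)) (at t)"
    and int: "integrable lborel \<psi>" "integrable lborel \<psi>'" and cont: "continuous_on UNIV \<psi>'"
  shows "(\<integral>y. \<psi>' y \<partial>lborel) = 0"
proof -
  note [measurable] = borel_measurable_integrable[OF int(1)] borel_measurable_integrable[OF int(2)]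
  have m [measurable]: "\<psi>' \<in> borel_measurable borel" "\<psi> \<in> borel_measurable borel"
    using borel_measurable_integrable[OF int(1)] borel_measurable_integrable[OF int(2)] by simp_all
  define F where "F s y = indicator {0..1} s * \<psi>' (y + s *\<^sub>R v)" for s :: real and y
  have trI: "integrable lborel (\<lambda>y. \<psi>' (y + s *\<^sub>R v))" for s
    using integrable_lborel_translate[OF int(2), of "s *\<^sub>R v"] by (simp add: add.commute)
  have tr: "(\<integral>y. \<psi>' (y + s *\<^sub>R v) \<partial>lborel) = integral\<^sup>L lborel \<psi>'" for s
    using integral_lborel_translate[OF m(1), of "s *\<^sub>R v"] by (simp add: add.commute)
  have trn: "(\<integral>y. \<bar>\<psi>' (y + s *\<^sub>R v)\<bar> \<partial>lborel) = (\<integral>y. \<bar>\<psi>' y\<bar> \<partial>lborel)" for s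
    using integral_lborel_translate[of "\<lambda>y. \<bar>\<psi>' y\<bar>" "s *\<^sub>R v"] by (simp add: add.commute)
  have intF: "integrable (lborel \<Otimes>\<^sub>M lborel) (case_prod F)"
  proof (rule lborel_pair.Fubini_integrable)
    show "integrable lborel (\<lambda>s. \<integral>y. norm (case_prod F (s, y)) \<partial>lborel)"
      by (simp add: F_def abs_mult trn)
    show "AE s in lborel. integrable lborel (\<lambda>y. case_prod F (s, y))"
      unfolding F_def prod.case by (auto intro!: integrable_mult_right trI)
  qed (simp add: F_def case_prod_unfold)
  have "\<psi> (v + y) - \<psi> y = (\<integral>s. F s y \<partial>lborel)" for y
  proof -
    have "(\<integral>s. indicator {0..1} s *\<^sub>R \<psi>' (y + s *\<^sub>R v) \<partial>lborel) = \<psi> (y + 1 *\<^sub>R v) - \<psi> (y + 0 *\<^sub>R v)"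
    proof (rule integral_FTC_atLeastAtMost)
      show "continuous_on {0..1} (\<lambda>s. \<psi>' (y + s *\<^sub>R v))"
        by (rule continuous_on_compose2[OF cont]) (auto intro!: continuous_intros)
      show "((\<lambda>s. \<psi> (y + s *\<^sub>R v)) has_vector_derivative \<psi>' (y + s *\<^sub>R v)) (at s within {0..1})" for s
        using d[of y s] by (simp add: has_field_derivative_at_within has_real_derivative_iff_has_vector_derivative[symmetric])
    qed simp
    then show ?thesis by (simp add: F_def add.commute)
  qed
  then have "(\<integral>y. (\<psi> (v + y) - \<psi> y) \<partial>lborel) = (\<integral>y. (\<integral>s. F s y \<partial>lborel) \<partial>lborel)" by simp
  also have "\<dots> = (\<integral>s. (\<integral>y. F s y \<partial>lborel) \<partial>lborel)"
    by (rule lborel_pair.Fubini_integral[OF intF])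
  also have "\<dots> = integral\<^sup>L lborel \<psi>'" by (simp add: F_def tr)
  finally have "integral\<^sup>L lborel \<psi>' = (\<integral>y. (\<psi> (v + y) - \<psi> y) \<partial>lborel)" ..
  also have "\<dots> = (\<integral>y. \<psi> (v + y) \<partial>lborel) - (\<integral>y. \<psi> y \<partial>lborel)"
    by (intro Bochner_Integration.integral_diff integrable_lborel_translate int)
  also have "\<dots> = 0" by (subst integral_lborel_translate) auto
  finally show ?thesis .
qed

text \<open>The integrand is the derivative of \<open>q y * exp (- e * (norm y)\<^sup>2)\<close>
  along \<open>v\<close>. The first and second moments of \<open>heat\<close> and the symmetry of
  Gamma all come from this identity.\<close>

lemma gaussian_by_parts:
  fixes q :: "'a::euclidean_space \<Rightarrow> real"
  assumes q: "real_polynomial_function q" and e: "e > 0"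
  shows "(\<integral>y. (frechet_derivative q (at y) v - 2 * e * (v \<bullet> y) * q y) * exp (- e * (norm y)\<^sup>2) \<partial>lborel) = 0"
proof (rule integral_directional_derivative[where \<psi> = "\<lambda>y. q y * exp (- e * (norm y)\<^sup>2)" and v = v])
  have p: "real_polynomial_function (\<lambda>y. frechet_derivative q (at y) v - 2 * e * (v \<bullet> y) * q y)"
    by (intro real_polynomial_function_diff real_polynomial_function_frechet q
        real_polynomial_function.intros(4) real_polynomial_function.intros(2)
        real_polynomial_function.intros(1) bounded_linear_inner_right)
  show "integrable lborel (\<lambda>y. q y * exp (- e * (norm y)\<^sup>2))"
    by (rule integrable_polynomial_gaussian[OF q e])
  show "integrable lborel (\<lambda>y. (frechet_derivative q (at y) v - 2 * e * (v \<bullet> y) * q y) * exp (- e * (norm y)\<^sup>2))"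
    by (rule integrable_polynomial_gaussian[OF p e])
  show "continuous_on UNIV (\<lambda>y. (frechet_derivative q (at y) v - 2 * e * (v \<bullet> y) * q y) * exp (- e * (norm y)\<^sup>2))"
    by (intro continuous_intros real_polynomial_function_continuous[OF p])
  fix y :: 'a and t :: real
  have "(q has_derivative frechet_derivative q (at (y + t *\<^sub>R v))) (at (y + t *\<^sub>R v))"
    using differentiable_at_real_polynomial_function[OF q] by (simp add: frechet_derivative_works)
  note * = has_derivative_compose[of "\<lambda>t. y + t *\<^sub>R v", OF _ this]
  have lin: "frechet_derivative q (at (y + t *\<^sub>R v)) (h *\<^sub>R v) = h * frechet_derivative q (at (y + t *\<^sub>R v)) v" for h
    using linear_frechet_derivative[OF differentiable_at_real_polynomial_function[OF q]]
    by (simp add: linear_cmul)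
  have 1: "((\<lambda>t. q (y + t *\<^sub>R v)) has_real_derivative frechet_derivative q (at (y + t *\<^sub>R v)) v) (at t)"
    unfolding has_field_derivative_def
    by (rule has_derivative_eq_rhs[OF *]) (auto intro!: derivative_eq_intros simp: lin mult.commute)
  have nrm: "(norm (y + t *\<^sub>R v))\<^sup>2 = y \<bullet> y + 2 * t * (v \<bullet> y) + t\<^sup>2 * (v \<bullet> v)" for t
    unfolding power2_norm_eq_inner by (simp add: algebra_simps inner_commute power2_eq_square)
  have 2: "((\<lambda>t. exp (- e * (norm (y + t *\<^sub>R v))\<^sup>2)) has_real_derivative
     exp (- e * (norm (y + t *\<^sub>R v))\<^sup>2) * (- 2 * e * (v \<bullet> (y + t *\<^sub>R v)))) (at t)"
    unfolding nrm by (auto intro!: derivative_eq_intros simp: algebra_simps)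
  show "((\<lambda>t. q (y + t *\<^sub>R v) * exp (- e * (norm (y + t *\<^sub>R v))\<^sup>2)) has_real_derivative
     (frechet_derivative q (at (y + t *\<^sub>R v)) v - 2 * e * (v \<bullet> (y + t *\<^sub>R v)) * q (y + t *\<^sub>R v)) *
     exp (- e * (norm (y + t *\<^sub>R v))\<^sup>2)) (at t)"
    by (rule DERIV_cong[OF DERIV_mult[OF 1 2]]) (simp add: algebra_simps)
qed

text \<open>The heat kernel at time \<open>1 / (4 * a)\<close>. It concentrates at 0 as
  \<open>a\<close> grows.\<close>

definition heat :: "real \<Rightarrow> 'a::euclidean_space \<Rightarrow> real" where
  "heat a u = (a / pi) powr (DIM('a) / 2) * exp (- a * (norm u)\<^sup>2)"

lemma heat_nonneg [simp]: "0 \<le> heat a u" by (simp add: heat_def)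

lemma heat_measurable [measurable]: "heat a \<in> borel_measurable borel"
  unfolding heat_def by measurable

lemma heat_minus [simp]: "heat a (- u) = heat a u" by (simp add: heat_def)

context
  fixes a :: real
  assumes a: "a > 0"
begin

lemma integrable_heat_polynomial:
  fixes q :: "'a::euclidean_space \<Rightarrow> real"
  assumes q: "real_polynomial_function q"
  shows "integrable lborel (\<lambda>u. heat a u * q u)"
  using integrable_mult_right[OF integrable_polynomial_gaussian[OF q a], of "(a / pi) powr (DIM('a) / 2)"]
  by (simp add: heat_def mult_ac)

lemma integrable_heat: "integrable lborel (heat a :: 'a::euclidean_space \<Rightarrow> real)"
  using integrable_heat_polynomial[of "\<lambda>_. 1"] by auto

lemma integral_heat: "(\<integral>u. heat a (u::'a::euclidean_space) \<partial>lborel) = 1"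
proof -
  have "(a / pi) powr (DIM('a) / 2) * (pi / a) powr (DIM('a) / 2) = (1::real)"
    using a by (simp add: powr_mult[symmetric])
  then show ?thesis using gaussian_integral[OF a, where 'a = 'a] by (simp add: heat_def)
qed

lemma integral_heat_inner: "(\<integral>u. heat a u * (u \<bullet> v) \<partial>lborel) = 0"
proof -
  have "(\<integral>y. (- 2 * a * (v \<bullet> y)) * exp (- a * (norm y)\<^sup>2) \<partial>lborel) = 0"
    using gaussian_by_parts[OF real_polynomial_function.intros(2)[of 1] a, of v] by simp
  then have "(a / pi) powr (DIM('a) / 2) * (\<integral>y. (- 2 * a * (v \<bullet> y)) * exp (- a * (norm y)\<^sup>2) \<partial>lborel) = 0"
    by (simp only: mult_zero_right)
  then have "(\<integral>u. - 2 * a * (heat a u * (u \<bullet> v)) \<partial>lborel) = 0"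
    by (subst (asm) integral_mult_right_zero[symmetric]) (simp add: heat_def inner_commute mult_ac)
  then show ?thesis using a by simp
qed

text \<open>Integration by parts with the linear polynomial \<open>u \<bullet> v\<close>, whose
  derivative along \<open>v\<close> is the constant \<open>v \<bullet> v\<close>.\<close>

lemma integral_heat_inner_sq: "(\<integral>(u::'a::euclidean_space).  heat a u * (u \<bullet> v)\<^sup>2 \<partial>lborel) = (norm v)\<^sup>2 / (2 * a)"
proof -
  have p: "real_polynomial_function (\<lambda>u. u \<bullet> v)"
    by (intro real_polynomial_function.intros(1) bounded_linear_inner_left)
  have fd: "frechet_derivative (\<lambda>u. u \<bullet> v) (at y) = (\<lambda>u. u \<bullet> v)" for y
    by (rule frechet_derivative_at[symmetric]) (auto intro!: derivative_eq_intros)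
  have "(\<integral>y. (v \<bullet> v - 2 * a * (v \<bullet> y) * (y \<bullet> v)) * exp (- a * (norm y)\<^sup>2) \<partial>lborel) = 0"
    using gaussian_by_parts[OF p a, of v] by (simp add: fd)
  then have "0 = (a / pi) powr (DIM('a) / 2) * (\<integral>y. (v \<bullet> v - 2 * a * (v \<bullet> y) * (y \<bullet> v)) * exp (- a * (norm y)\<^sup>2) \<partial>lborel)"
    by (simp only: mult_zero_right)
  also have "\<dots> = (\<integral>y. heat a y * (norm v)\<^sup>2 - 2 * a * (heat a y * (y \<bullet> v)\<^sup>2) \<partial>lborel)"
  proof -
    have "(a / pi) powr (DIM('a) / 2) * ((v \<bullet> v - 2 * a * (v \<bullet> y) * (y \<bullet> v)) * exp (- a * (norm y)\<^sup>2))
       = heat a y * (norm v)\<^sup>2 - 2 * a * (heat a y * (y \<bullet> v)\<^sup>2)" for y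
      unfolding heat_def power2_norm_eq_inner[of v] inner_commute[of v y] power2_eq_square[of "y \<bullet> v"]
      by (simp add: algebra_simps)
    then show ?thesis by (subst integral_mult_right_zero[symmetric]) simp
  qed
  also have "\<dots> = (\<integral>(y::'a). heat a y * (norm v)\<^sup>2 \<partial>lborel) - (\<integral>y. 2 * a * (heat a y * (y \<bullet> v)\<^sup>2) \<partial>lborel)"
    using integrable_heat_polynomial[OF real_polynomial_function.intros(2)[of "(norm v)\<^sup>2"]]
      integrable_mult_right[OF integrable_heat_polynomial[OF real_polynomial_function_power[OF p]], of "2 * a" 2]
    by (rule Bochner_Integration.integral_diff)
  also have "\<dots> = (norm v)\<^sup>2 - 2 * a * (\<integral>y. heat a y * (y \<bullet> v)\<^sup>2 \<partial>lborel)"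
    by (simp add: integral_heat)
  finally show ?thesis using a by (simp add: field_simps)
qed

lemma integrable_heat_inner_sq: "integrable lborel (\<lambda>u. heat a u * (u \<bullet> v)\<^sup>2)"
  by (intro integrable_heat_polynomial real_polynomial_function_power
      real_polynomial_function.intros(1) bounded_linear_inner_left)

lemma integrable_heat_norm_sq: "integrable lborel (\<lambda>u::'a::euclidean_space. heat a u * (norm u)\<^sup>2)"
  unfolding norm_sq_Basis sum_distrib_left by (intro Bochner_Integration.integrable_sum integrable_heat_inner_sq)

lemma integral_heat_norm_sq: "(\<integral>u. heat a (u::'a::euclidean_space) * (norm u)\<^sup>2 \<partial>lborel) = DIM('a) / (2 * a)"
  unfolding norm_sq_Basis sum_distrib_left
  by (subst Bochner_Integration.integral_sum) (simp_all add: integrable_heat_inner_sq integral_heat_inner_sq)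

text \<open>With \<open>s = a * (norm u)\<^sup>2\<close> this is
  \<open>exp (- s) * s \<le> exp (- s / 2)\<close>. A factor \<open>(norm u)\<^sup>2\<close> is
  traded for \<open>1 / a\<close> at the cost of halving the decay rate; that gain makes the
  remainder in \<open>heat_uncertainty\<close> one of lower order.\<close>

lemma heat_norm_sq_le:
  "heat a (u::'a::euclidean_space) * (norm u)\<^sup>2 \<le> 2 powr (DIM('a) / 2) / a * heat (a / 2) u"
proof -
  define s where "s = a * (norm u)\<^sup>2"
  have "2 \<le> exp (1::real)" using exp_ge_add_one_self[of "1::real"] by linarith
  moreover have "s / 2 \<le> exp (s / 2 - 1)" using exp_ge_add_one_self[of "s / 2 - 1"] by linarith
  moreover have "0 \<le> s / 2" using a by (simp add: s_def)
  ultimately have "2 * (s / 2) \<le> exp 1 * exp (s / 2 - 1)" by (intro mult_mono) simp_all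
  also have "\<dots> = exp (s / 2)" by (simp add: mult_exp_exp)
  finally have "s \<le> exp (s / 2)" by simp
  then have "exp (- s) * s \<le> exp (- s) * exp (s / 2)" by (intro mult_left_mono) simp_all
  also have "\<dots> = exp (- s / 2)" by (simp add: mult_exp_exp)
  finally have *: "exp (- s) * s \<le> exp (- s / 2)" .
  have "2 powr (DIM('a) / 2) * (a / 2 / pi) powr (DIM('a) / 2) = (a / pi) powr (DIM('a) / 2)"
    using a by (subst powr_mult[symmetric]) simp_all
  then have "2 powr (DIM('a) / 2) / a * heat (a / 2) u = (a / pi) powr (DIM('a) / 2) / a * exp (- s / 2)"
    by (simp add: heat_def s_def)
  moreover have "heat a u * (norm u)\<^sup>2 = (a / pi) powr (DIM('a) / 2) / a * (exp (- s) * s)"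
    using a by (simp add: heat_def s_def)
  ultimately show ?thesis using * a by (simp add: mult_left_mono divide_right_mono)
qed

end

section \<open>Clifford-valued forms\<close>

lemma norm_smult_complex: "norm (c *s x) = cmod c * norm (x :: complex ^ 'n)"
  by (simp add: norm_vec_def norm_mult L2_set_right_distrib)

text \<open>The inner product of complex vectors is the real one, so a complex scalar crosses it as
  its conjugate but cannot be taken out of it.\<close>

lemma inner_smult_complex: "(c *s x) \<bullet> y = x \<bullet> (cnj c *s (y :: complex ^ 'n))"
  by (simp add: inner_vec_def inner_complex_def algebra_simps)

lemma scaleR_eq_smult: "r *\<^sub>R x = complex_of_real r *s (x :: complex ^ 'n)"
  unfolding vec_eq_iff vector_scaleR_component vector_smult_component by (simp add: scaleR_conv_of_real)

lemma linear_smult_complex: "linear (\<lambda>x :: complex ^ 'n. c *s x)"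
  by (rule linearI) (auto simp: vec_eq_iff algebra_simps)

lemma bounded_bilinear_cl_mult:
  "bounded_bilinear ((\<odot>) :: complex ^ ('m::{finite,linorder} set) \<Rightarrow> _ \<Rightarrow> _)"
  unfolding bilinear_conv_bounded_bilinear[symmetric] bilinear_def
  by (auto intro!: linearI simp: cl_mult_add_left cl_mult_add_right scaleR_eq_smult
      cl_mult_smult_left cl_mult_smult_right)

lemma cl_basis_mult_nth:
  "(cl_basis A \<odot> x) $ C = cl_sign A (sym_diff A C) * (x $ sym_diff A C :: 'a::comm_ring_1)"
proof -
  have *: "sym_diff A B = C \<longleftrightarrow> B = sym_diff A C" for B by auto
  have "(cl_basis A \<odot> x) $ C = (\<Sum>B\<in>UNIV. (x $ B *s (cl_sign A B *s cl_basis (sym_diff A B))) $ C)"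
    by (subst cl_expand[of x]) (simp add: cl_sum_right cl_mult_smult_right cl_basis_mult)
  also have "\<dots> = (\<Sum>B\<in>UNIV. if B = sym_diff A C then cl_sign A B * x $ B else 0)"
    by (intro sum.cong refl) (simp add: axis_def * eq_commute[of C] mult.commute)
  finally show ?thesis by simp
qed

text \<open>Left multiplication by \<open>cl_basis A\<close> permutes the coordinates by
  \<open>sym_diff A\<close> and changes some signs.\<close>

lemma inner_cl_basis_mult:
  fixes x y :: "complex ^ ('m::{finite,linorder} set)"
  shows "(cl_basis A \<odot> x) \<bullet> (cl_basis A \<odot> y) = x \<bullet> y"
proof -
  have s: "cl_sign A B = (1::complex) \<or> cl_sign A B = (-1::complex)" for B
    unfolding cl_sign_def by (cases "even (card {(i, j). i \<in> A \<and> j \<in> B \<and> j \<le> i})") simp_all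
  have inv: "(t * a) \<bullet> (t * b) = a \<bullet> b" if "t = 1 \<or> t = -1" for t a b :: complex
    using that by auto
  have "(cl_basis A \<odot> x) \<bullet> (cl_basis A \<odot> y) = (\<Sum>C\<in>UNIV. x $ sym_diff A C \<bullet> y $ sym_diff A C)"
    unfolding inner_vec_def cl_basis_mult_nth
    by (intro sum.cong refl inv s)
  also have "\<dots> = (\<Sum>C\<in>UNIV. x $ C \<bullet> y $ C)"
    by (rule sum.reindex_bij_witness[of _ "sym_diff A" "sym_diff A"]) auto
  finally show ?thesis by (simp add: inner_vec_def)
qed

lemma norm_cl_basis_mult: "norm (cl_basis A \<odot> x) = norm (x :: complex ^ ('m::{finite,linorder} set))"
  by (simp add: norm_eq_sqrt_inner inner_cl_basis_mult)

text \<open>An isometry whose square is minus the identity is skew.\<close>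

lemma inner_cl_gen_mult:
  fixes x y :: "complex ^ ('m::{finite,linorder} set)"
  shows "(cl_gen j \<odot> x) \<bullet> y = - (x \<bullet> (cl_gen j \<odot> y))"
proof -
  have "cl_gen j \<odot> (cl_gen j \<odot> y) = - cl_basis {} \<odot> y"
    unfolding cl_mult_assoc[symmetric] cl_gen_sq ..
  also have "- cl_basis {} = ((- 1) *s cl_basis {} :: complex ^ ('m set))"
    by (simp add: vec_eq_iff)
  also have "\<dots> \<odot> y = (- 1) *s y" unfolding cl_mult_smult_left cl_mult_one_left ..
  also have "\<dots> = - y" by (simp add: vec_eq_iff)
  finally have "cl_gen j \<odot> (cl_gen j \<odot> y) = - y" .
  then show ?thesis
    using inner_cl_basis_mult[of "{j}" x "cl_gen j \<odot> y"] by simp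
qed

text \<open>Homogeneous forms of degree \<open>n\<close> in \<open>x\<close> and in
  \<open>y\<close>, given by a representation as a sum of products of \<open>n\<close> factors
  \<open>A x \<bullet> y\<close> with contractions \<open>A\<close>. The number \<open>M\<close>
  belongs to the representation and not to the function: it adds up the norms of the constant
  coefficients. This lets the product rule for Gamma be followed by induction with explicit
  constants.\<close>

inductive cl_form :: "nat \<Rightarrow> real \<Rightarrow> (real ^ 'm::{finite,linorder} \<Rightarrow> real ^ 'm::{finite,linorder} \<Rightarrow> complex ^ ('m::{finite,linorder} set)) \<Rightarrow> bool" where
  const: "cl_form 0 (norm c) (\<lambda>x y. c)"
| mult: "linear A \<Longrightarrow> (\<And>x. norm (A x) \<le> norm x) \<Longrightarrow> cl_form n M G \<Longrightarrow> cl_form (Suc n) M (\<lambda>x y. (A x \<bullet> y) *\<^sub>R G x y)"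
| add: "cl_form n M G \<Longrightarrow> cl_form n N H \<Longrightarrow> cl_form n (M + N) (\<lambda>x y. G x y + H x y)"

lemma cl_form_nonneg: "cl_form n M G \<Longrightarrow> 0 \<le> M"
  by (induction rule: cl_form.induct) auto

lemma cl_form_bound: "cl_form n M G \<Longrightarrow> norm (G x y) \<le> M * norm x ^ n * norm y ^ n"
proof (induction rule: cl_form.induct)
  case (mult A n M G)
  have "\<bar>A x \<bullet> y\<bar> \<le> norm x * norm y"
    using Cauchy_Schwarz_ineq2[of "A x" y] mult_right_mono[OF mult.hyps(2)[of x], of "norm y"] by simp
  then have "\<bar>A x \<bullet> y\<bar> * norm (G x y) \<le> (norm x * norm y) * (M * norm x ^ n * norm y ^ n)"
    using mult.IH by (intro mult_mono) auto
  then show ?case by (simp add: algebra_simps)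
next
  case (add n M G N H)
  then show ?case using norm_triangle_ineq[of "G x y" "H x y"] by (simp add: algebra_simps)
qed simp

lemma cl_form_continuous: "cl_form n M G \<Longrightarrow> continuous_on UNIV (\<lambda>p. G (fst p) (snd p))"
proof (induction rule: cl_form.induct)
  case (mult A n M G)
  have "continuous_on UNIV (\<lambda>p :: (real, 'a) vec \<times> (real, 'a) vec. A (fst p))"
    by (intro continuous_on_compose2[OF linear_continuous_on[OF mult.hyps(1)[unfolded linear_conv_bounded_linear], of UNIV]]
        continuous_intros) auto
  with mult.IH show ?case by (auto intro!: continuous_intros)
qed (auto intro!: continuous_intros)

lemma cl_form_polynomial: "cl_form n M G \<Longrightarrow> polynomial_function (G x)"
proof (induction rule: cl_form.induct)
  case (mult A n M G)
  have "polynomial_function (\<lambda>y. A x \<bullet> y)"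
    by (metis bounded_linear_inner_right real_polynomial_function.intros(1) real_polynomial_function_eq)
  then show ?case using mult.IH by (rule polynomial_function_mult)
qed auto

lemma cl_form_zero: "cl_form n 0 (\<lambda>x y. 0)"
proof (induction n)
  case 0
  show ?case using cl_form.const[of 0] by simp
next
  case (Suc n)
  show ?case using cl_form.mult[OF linear_id _ Suc] by simp
qed

lemma cl_form_sum:
  assumes "\<And>i. i \<in> I \<Longrightarrow> cl_form n (M i) (G i)"
  shows "cl_form n (sum M I) (\<lambda>x y. \<Sum>i\<in>I. G i x y)"
  using assms
  by (induction I rule: infinite_finite_induct) (auto intro: cl_form_zero cl_form.add)

lemma cl_form_linear_image:
  assumes L: "linear L" "\<And>u. norm (L u) = k * norm u"
  shows "cl_form n M G \<Longrightarrow> cl_form n (k * M) (\<lambda>x y. L (G x y))"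
proof (induction rule: cl_form.induct)
  case (const c)
  show ?case using cl_form.const[of "L c"] by (simp add: L(2))
next
  case (mult A n M G)
  then show ?case using cl_form.mult[OF mult.hyps(1,2) mult.IH] by (simp add: linear_cmul[OF L(1)])
next
  case (add n M G N H)
  then show ?case using cl_form.add[OF add.IH] by (simp add: linear_add[OF L(1)] distrib_left)
qed

section \<open>Partial derivatives, rotation fields and Gamma on forms\<close>

lemma has_derivative_partial:
  assumes "g differentiable (at y)"
  shows "(g has_derivative (\<lambda>h. frechet_derivative g (at y) h)) (at y)"
  using assms by (simp add: frechet_derivative_works)

lemma partial_derivative_eq:
  assumes "(g has_derivative D) (at y)" shows "partial_derivative k g y = D (axis k 1)"
  using frechet_derivative_at[OF assms] by (simp add: partial_derivative_def)

lemma cl_form_differentiable: "cl_form n M G \<Longrightarrow> G x differentiable (at y)"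
  by (intro differentiable_at_polynomial_function cl_form_polynomial)

lemma partial_derivative_inner_scale:
  assumes "g differentiable (at y)"
  shows "partial_derivative k (\<lambda>z. (v \<bullet> z) *\<^sub>R g z) y = (v $ k) *\<^sub>R g y + (v \<bullet> y) *\<^sub>R partial_derivative k g y"
  unfolding partial_derivative_def[of k g]
  by (subst partial_derivative_eq[OF has_derivative_scaleR[OF _ has_derivative_partial[OF assms]]])
     (auto intro!: derivative_eq_intros simp: inner_axis)

lemma partial_derivative_add:
  assumes "g differentiable (at y)" "h differentiable (at y)"
  shows "partial_derivative k (\<lambda>z. g z + h z) y = partial_derivative k g y + partial_derivative k h y"
  unfolding partial_derivative_def[of k g] partial_derivative_def[of k h]
  by (subst partial_derivative_eq[OF has_derivative_add[OF assms[THEN has_derivative_partial]]]) simp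

lemma partial_derivative_const: "partial_derivative k (\<lambda>z. c) y = 0"
  by (rule partial_derivative_eq[of _ "\<lambda>_. 0"]) auto

definition rotation_field :: "'m \<Rightarrow> 'm \<Rightarrow> (real ^ 'm \<Rightarrow> 'b::real_normed_vector) \<Rightarrow> real ^ 'm \<Rightarrow> 'b" where
  "rotation_field j k g y = y $ j *\<^sub>R partial_derivative k g y - y $ k *\<^sub>R partial_derivative j g y"

lemma cl_gamma_rotation_field:
  "cl_gamma g y = (\<Sum>(j, k) | j < k. - (cl_gen j \<odot> (cl_gen k \<odot> rotation_field j k g y)))"
  unfolding cl_gamma_def rotation_field_def by (simp add: sum_negf case_prod_unfold cl_mult_assoc)

text \<open>By the product rule a rotation field acts on one factor \<open>A x \<bullet> y\<close>
  at a time and turns it into a factor of the same kind, so each pair \<open>j < k\<close>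
  contributes \<open>n\<close> forms of constant \<open>M\<close>. The growth is linear in
  \<open>n\<close>; hence the exponential of Gamma costs in degree \<open>n\<close> only the
  \<open>n\<close>-th power of a constant, which the kernel series absorbs.\<close>

lemma cl_gamma_form:
  assumes "cl_form n M (G :: real ^ 'm::{finite,linorder} \<Rightarrow> real ^ 'm::{finite,linorder} \<Rightarrow> complex ^ ('m set))"
  shows "cl_form n (real (card {(j::'m, k). j < k}) * real n * M) (\<lambda>x. cl_gamma (G x))"
  using assms
proof (induction rule: cl_form.induct)
  case (const c)
  have "cl_gamma (\<lambda>y. c) y = 0" for y :: "(real, 'm) vec"
    by (simp add: bounded_bilinear.zero_right[OF bounded_bilinear_cl_mult] cl_gamma_rotation_field rotation_field_def partial_derivative_const case_prod_unfold)
  then have "cl_gamma (\<lambda>y. c) = (\<lambda>y. 0)" by (rule ext)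
  then show ?case using cl_form_zero by simp
next
  case (mult A n M G)
  \<comment> \<open>The rotation field sends \<open>A x \<bullet> y\<close> to
    \<open>B j k x \<bullet> y\<close>. Here \<open>B j k\<close> is \<open>A\<close> followed by
    the projection to the plane of the axes \<open>j\<close> and \<open>k\<close> and a quarter turn
    in it, hence again a contraction.\<close>
  define B :: "'m \<Rightarrow> 'm \<Rightarrow> (real, 'm) vec \<Rightarrow> (real, 'm) vec"
    where "B j k x = (A x $ k) *\<^sub>R axis j 1 - (A x $ j) *\<^sub>R axis k 1" for j k and x :: "(real, 'm) vec"
  have linB: "linear (B j k)" for j k
    by (rule linearI) (auto simp: B_def linear_add[OF mult.hyps(1)] linear_cmul[OF mult.hyps(1)] algebra_simps)
  have nB: "norm (B j k x) \<le> norm x" if "j < k" for j k x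
  proof -
    have "(norm (B j k x))\<^sup>2 = (\<Sum>i\<in>{j, k}. (A x $ i)\<^sup>2)"
      using that unfolding power2_norm_eq_inner by (simp add: B_def inner_diff_left inner_diff_right inner_axis_axis power2_eq_square)
    also have "\<dots> \<le> (\<Sum>i\<in>UNIV. (A x $ i)\<^sup>2)" by (rule sum_mono2) auto
    also have "\<dots> = (norm (A x))\<^sup>2"
      by (simp add: norm_vec_def L2_set_def sum_nonneg)
    finally have "norm (B j k x) \<le> norm (A x)" by (rule power2_le_imp_le) simp
    then show ?thesis using mult.hyps(2) by (rule order_trans)
  qed
  have Bin: "B j k x \<bullet> y = y $ j * A x $ k - y $ k * A x $ j" for j k x y
    by (simp add: B_def inner_diff_left inner_axis' mult.commute)
  let ?E = "\<lambda>j k u. - (cl_gen j \<odot> (cl_gen k \<odot> u)) :: complex ^ ('m set)"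
  have linE: "linear (?E j k)" for j k
    by (intro linear_compose_neg[unfolded o_def] linear_conv_bounded_linear[THEN iffD2]
        bounded_linear_compose[of "\<lambda>u. cl_gen j \<odot> u" "\<lambda>u. cl_gen k \<odot> u"]
        bounded_bilinear.bounded_linear_right[OF bounded_bilinear_cl_mult])
  have nE: "norm (?E j k u) = 1 * norm u" for j k u by (simp add: norm_cl_basis_mult)
  have eq: "cl_gamma (\<lambda>y. (A x \<bullet> y) *\<^sub>R G x y) y = (\<Sum>(j, k) | j < k. (B j k x \<bullet> y) *\<^sub>R ?E j k (G x y))
      + (A x \<bullet> y) *\<^sub>R cl_gamma (G x) y" for x y
  proof -
    have rf: "rotation_field j k (\<lambda>y. (A x \<bullet> y) *\<^sub>R G x y) y = (B j k x \<bullet> y) *\<^sub>R G x y + (A x \<bullet> y) *\<^sub>R rotation_field j k (G x) y" for j k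
      unfolding rotation_field_def partial_derivative_inner_scale[OF cl_form_differentiable[OF mult.hyps(3)]] Bin
      by (simp add: algebra_simps)
    show ?thesis
      unfolding cl_gamma_rotation_field rf linear_add[OF linE] linear_cmul[OF linE]
      by (simp only: case_prod_unfold sum.distrib scaleR_sum_right)
  qed
  have "cl_form (Suc n) ((\<Sum>(j::'m, k) | j < k. M) + real (card {(j::'m, k). j < k}) * real n * M)
     (\<lambda>x y. (\<Sum>(j, k) | j < k. (B j k x \<bullet> y) *\<^sub>R ?E j k (G x y)) + (A x \<bullet> y) *\<^sub>R cl_gamma (G x) y)"
  proof (intro cl_form.add cl_form.mult mult.IH mult.hyps)
    have "cl_form (Suc n) M (\<lambda>x y. (B j k x \<bullet> y) *\<^sub>R ?E j k (G x y))" if "j < k" for j k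
      using cl_form_linear_image[OF linE nE mult.hyps(3)] linB nB[OF that]
      by (intro cl_form.mult) simp_all
    then show "cl_form (Suc n) (\<Sum>(j::'m, k) | j < k. M) (\<lambda>x y. \<Sum>(j, k) | j < k. (B j k x \<bullet> y) *\<^sub>R ?E j k (G x y))"
      unfolding case_prod_unfold by (intro cl_form_sum) auto
  qed
  moreover have "(\<Sum>(j::'m, k) | j < k. M) + real (card {(j::'m, k). j < k}) * real n * M = real (card {(j::'m, k). j < k}) * real (Suc n) * M"
    by (simp add: algebra_simps)
  ultimately show ?case unfolding eq[abs_def, symmetric] by simp
next
  case (add n M G N H)
  have eq: "cl_gamma (\<lambda>y. G x y + H x y) y = cl_gamma (G x) y + cl_gamma (H x) y" for x y
    unfolding cl_gamma_def partial_derivative_add[OF cl_form_differentiable[OF add.hyps(1)] cl_form_differentiable[OF add.hyps(2)]]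
    by (simp add: case_prod_unfold cl_mult_add_right scaleR_add_right add_diff_add sum.distrib)
  show ?case using cl_form.add[OF add.IH] unfolding eq[abs_def, symmetric] by (simp add: algebra_simps)
qed

lemma cl_gamma_power_form:
  assumes "cl_form n M (G :: real ^ 'm::{finite,linorder} \<Rightarrow> real ^ 'm::{finite,linorder} \<Rightarrow> complex ^ ('m set))"
  shows "cl_form n ((real (card {(j::'m, k). j < k}) * real n) ^ p * M) (\<lambda>x. (cl_gamma ^^ p) (G x))"
proof (induction p)
  case 0
  show ?case using assms by simp
next
  case (Suc p)
  show ?case using cl_gamma_form[OF Suc.IH] by (simp add: mult_ac)
qed

section \<open>The Gamma operator and its exponential\<close>

lemma gaussian_by_parts_axis:
  fixes \<phi> :: "real ^ 'm \<Rightarrow> real"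
  assumes p: "real_polynomial_function \<phi>" and "j \<noteq> k" and e: "e > 0"
  defines "F \<equiv> \<lambda>y. (y $ j * partial_derivative k \<phi> y - 2 * e * y $ k * y $ j * \<phi> y) * exp (- e * (norm y)\<^sup>2)"
  shows "integrable lborel F" "integral\<^sup>L lborel F = 0"
proof -
  define q where "q y = y $ j * \<phi> y" for y
  have pj: "real_polynomial_function (\<lambda>y::real^'m. y $ j)" for j
    by (intro real_polynomial_function.intros(1) bounded_linear_vec_nth)
  have q: "real_polynomial_function q"
    unfolding q_def using pj p by (rule real_polynomial_function.intros(4))
  have fq: "frechet_derivative q (at y) (axis k 1) = y $ j * partial_derivative k \<phi> y" for y
  proof -
    have "((\<lambda>y. y $ j) has_derivative (\<lambda>h. h $ j)) (at y)"
      by (rule bounded_linear.has_derivative[OF bounded_linear_vec_nth has_derivative_ident])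
    from has_derivative_mult[OF this has_derivative_partial[OF differentiable_at_real_polynomial_function[OF p]]]
    have "frechet_derivative q (at y) = (\<lambda>h. y $ j * frechet_derivative \<phi> (at y) h + h $ j * \<phi> y)"
      unfolding q_def by (rule frechet_derivative_at[symmetric])
    then show ?thesis using \<open>j \<noteq> k\<close> by (simp add: axis_def partial_derivative_def)
  qed
  have Fq: "F = (\<lambda>y. (frechet_derivative q (at y) (axis k 1) - 2 * e * (axis k 1 \<bullet> y) * q y) * exp (- e * (norm y)\<^sup>2))"
    by (auto simp: F_def fq inner_axis' q_def)
  show "integral\<^sup>L lborel F = 0" unfolding Fq by (rule gaussian_by_parts[OF q e])
  have "real_polynomial_function (\<lambda>y. frechet_derivative q (at y) (axis k 1) - 2 * e * (axis k 1 \<bullet> y) * q y)"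
    by (intro real_polynomial_function_diff real_polynomial_function_frechet q
        real_polynomial_function.intros(4) real_polynomial_function.intros(2)
        real_polynomial_function.intros(1) bounded_linear_inner_right)
  then show "integrable lborel F" unfolding Fq by (rule integrable_polynomial_gaussian[OF _ e])
qed

text \<open>The terms that come from differentiating the weight are symmetric in \<open>j\<close>
  and \<open>k\<close> and cancel: the weight is invariant under rotations.\<close>

lemma rotation_field_gaussian:
  fixes \<phi> :: "real ^ 'm \<Rightarrow> real"
  assumes p: "real_polynomial_function \<phi>" and jk: "j \<noteq> k" and e: "e > 0"
  shows "integrable lborel (\<lambda>y. rotation_field j k \<phi> y * exp (- e * (norm y)\<^sup>2))"
    and "(\<integral>y. rotation_field j k \<phi> y * exp (- e * (norm y)\<^sup>2) \<partial>lborel) = 0"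
proof -
  note A = gaussian_by_parts_axis[OF p jk e] and B = gaussian_by_parts_axis[OF p jk[symmetric] e]
  have eq: "rotation_field j k \<phi> y * exp (- e * (norm y)\<^sup>2) =
     (y $ j * partial_derivative k \<phi> y - 2 * e * y $ k * y $ j * \<phi> y) * exp (- e * (norm y)\<^sup>2) -
     (y $ k * partial_derivative j \<phi> y - 2 * e * y $ j * y $ k * \<phi> y) * exp (- e * (norm y)\<^sup>2)" for y
    by (simp add: rotation_field_def algebra_simps)
  show "integrable lborel (\<lambda>y. rotation_field j k \<phi> y * exp (- e * (norm y)\<^sup>2))"
    unfolding eq using A(1) B(1) by (rule Bochner_Integration.integrable_diff)
  show "(\<integral>y. rotation_field j k \<phi> y * exp (- e * (norm y)\<^sup>2) \<partial>lborel) = 0"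
    unfolding eq Bochner_Integration.integral_diff[OF A(1) B(1)] A(2) B(2) by simp
qed

lemma polynomial_function_linear_image:
  fixes L :: "'b::euclidean_space \<Rightarrow> 'c::euclidean_space"
  assumes "linear L" "polynomial_function g"
  shows "polynomial_function (\<lambda>y. L (g y))"
  using polynomial_function_compose[OF assms(2) polynomial_function_bounded_linear[of L]] assms(1)
  by (simp add: o_def linear_conv_bounded_linear)

lemma real_polynomial_function_inner:
  fixes f g :: "'a::real_normed_vector \<Rightarrow> 'b::euclidean_space"
  assumes "polynomial_function f" "polynomial_function g"
  shows "real_polynomial_function (\<lambda>x. f x \<bullet> g x)"
  using assms unfolding polynomial_function_iff_Basis_inner
  by (subst euclidean_inner) (intro real_polynomial_function_sum real_polynomial_function.intros(4), auto)

lemma rotation_field_inner: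
  fixes g :: "real ^ 'm \<Rightarrow> 'b::euclidean_space" and h :: "real ^ 'm \<Rightarrow> 'c::euclidean_space"
    and L :: "'b \<Rightarrow> 'd::euclidean_space"
  assumes L: "linear L" "linear L'" and d: "g differentiable (at y)" "h differentiable (at y)"
  shows "rotation_field j k (\<lambda>y. L (g y) \<bullet> L' (h y)) y =
    L (rotation_field j k g y) \<bullet> L' (h y) + L (g y) \<bullet> L' (rotation_field j k h y)"
proof -
  have bl: "bounded_linear L" "bounded_linear L'" using L by (simp_all add: linear_conv_bounded_linear)
  have "partial_derivative k (\<lambda>y. L (g y) \<bullet> L' (h y)) y =
    L (g y) \<bullet> L' (partial_derivative k h y) + L (partial_derivative k g y) \<bullet> L' (h y)" for k
    unfolding partial_derivative_def[of k g] partial_derivative_def[of k h]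
    by (rule partial_derivative_eq[OF has_derivative_inner[OF
        bounded_linear.has_derivative[OF bl(1) has_derivative_partial[OF d(1)]]
        bounded_linear.has_derivative[OF bl(2) has_derivative_partial[OF d(2)]]]])
  then show ?thesis
    by (simp add: rotation_field_def linear_diff[OF L(1)] linear_diff[OF L(2)] linear_cmul[OF L(1)]
        linear_cmul[OF L(2)] inner_diff_left inner_diff_right algebra_simps)
qed

text \<open>Two signs cancel. Integration by parts makes every rotation field skew, and left
  multiplication by \<open>cl_gen j \<odot> cl_gen k\<close> is skew for \<open>j < k\<close>, as a
  product of two anticommuting skew maps. The maps \<open>L\<close> and \<open>L'\<close> will be
  right multiplication by a constant combined with a complex scalar; they commute with the left
  multiplications in Gamma and carry the values of \<open>f\<close> and the series
  coefficients.\<close>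

lemma cl_gamma_symmetric:
  fixes g h :: "real ^ 'm::{finite,linorder} \<Rightarrow> complex ^ ('m set)"
    and L L' :: "complex ^ ('m set) \<Rightarrow> complex ^ ('m set)"
  assumes lin: "linear L" "linear L'"
    and comm: "\<And>j u. L (cl_gen j \<odot> u) = cl_gen j \<odot> L u" "\<And>j u. L' (cl_gen j \<odot> u) = cl_gen j \<odot> L' u"
    and g: "polynomial_function g" "polynomial_function (cl_gamma g)"
    and h: "polynomial_function h" "polynomial_function (cl_gamma h)"
    and e: "e > 0"
  shows "(\<integral>y. (L (cl_gamma g y) \<bullet> L' (h y)) * exp (- e * (norm y)\<^sup>2) \<partial>lborel) =
         (\<integral>y. (L (g y) \<bullet> L' (cl_gamma h y)) * exp (- e * (norm y)\<^sup>2) \<partial>lborel)"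
proof -
  let ?E = "\<lambda>j k u. cl_gen j \<odot> (cl_gen k \<odot> u) :: complex ^ ('m set)"
  let ?w = "\<lambda>y :: (real, 'm) vec. exp (- e * (norm y)\<^sup>2)"
  \<comment> \<open>The two integrands will differ by the sum of the rotation fields of these scalar
    polynomials, each of which has weighted integral zero.\<close>
  define \<phi> where "\<phi> j k y = L (g y) \<bullet> ?E j k (L' (h y))" for j k y
  have linE: "linear (?E j k)" for j k
    by (intro linear_conv_bounded_linear[THEN iffD2]
        bounded_linear_compose[of "\<lambda>u. cl_gen j \<odot> u" "\<lambda>u. cl_gen k \<odot> u"]
        bounded_bilinear.bounded_linear_right[OF bounded_bilinear_cl_mult])
  have linEL: "linear (\<lambda>u. ?E j k (L' u))" for j k
    using linear_compose[OF lin(2) linE] by (simp add: o_def)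
  have skew: "?E j k u \<bullet> v = - (u \<bullet> ?E j k v)" if "j < k" for j k u v
  proof -
    have "cl_gen k \<odot> (cl_gen j \<odot> v) = (- (cl_gen j \<odot> cl_gen k)) \<odot> v"
      unfolding cl_mult_assoc[symmetric] using that by (subst cl_gen_anticommute) auto
    also have "\<dots> = - ?E j k v"
      by (simp add: bounded_bilinear.minus_left[OF bounded_bilinear_cl_mult] cl_mult_assoc)
    finally show ?thesis by (simp add: inner_cl_gen_mult)
  qed
  have pol: "real_polynomial_function (\<lambda>y. L1 (g1 y) \<bullet> L2 (h1 y))"
    if "linear L1" "linear L2" "polynomial_function g1" "polynomial_function h1"
    for L1 L2 :: "complex ^ ('m set) \<Rightarrow> complex ^ ('m set)" and g1 h1 :: "(real, 'm) vec \<Rightarrow> complex ^ ('m set)"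
    by (rule real_polynomial_function_inner[OF polynomial_function_linear_image[OF that(1,3)]
          polynomial_function_linear_image[OF that(2,4)]])
  have d: "g differentiable (at y)" "h differentiable (at y)" for y
    by (intro differentiable_at_polynomial_function g h)+
  have diff: "L (cl_gamma g y) \<bullet> L' (h y) - L (g y) \<bullet> L' (cl_gamma h y) =
     (\<Sum>(j, k) | j < k. rotation_field j k (\<phi> j k) y)" for y
  proof -
    have 1: "L (cl_gamma g y) = (\<Sum>(j, k) | j < k. - ?E j k (L (rotation_field j k g y)))"
      unfolding cl_gamma_rotation_field case_prod_unfold linear_sum[OF lin(1)]
      by (simp add: linear_neg[OF lin(1)] comm)
    have 2: "L' (cl_gamma h y) = (\<Sum>(j, k) | j < k. - ?E j k (L' (rotation_field j k h y)))"
      unfolding cl_gamma_rotation_field case_prod_unfold linear_sum[OF lin(2)]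
      by (simp add: linear_neg[OF lin(2)] comm)
    show ?thesis
      unfolding 1 2 inner_sum_left inner_sum_right case_prod_unfold sum_subtractf[symmetric]
    proof (intro sum.cong refl)
      fix p :: "'m \<times> 'm" assume "p \<in> {p. fst p < snd p}"
      then show "- ?E (fst p) (snd p) (L (rotation_field (fst p) (snd p) g y)) \<bullet> L' (h y) -
          L (g y) \<bullet> - ?E (fst p) (snd p) (L' (rotation_field (fst p) (snd p) h y)) =
          rotation_field (fst p) (snd p) (\<phi> (fst p) (snd p)) y"
        unfolding \<phi>_def rotation_field_inner[OF lin(1) linEL d]
        by (simp add: skew)
    qed
  qed
  have \<phi>p: "real_polynomial_function (\<phi> j k)" for j k
    using pol[OF lin(1) linEL g(1) h(1)] unfolding \<phi>_def .
  have rf: "integrable lborel (\<lambda>y. rotation_field j k (\<phi> j k) y * ?w y)"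
      "(\<integral>y. rotation_field j k (\<phi> j k) y * ?w y \<partial>lborel) = 0" if "j < k" for j k
    using rotation_field_gaussian[OF \<phi>p _ e] that by auto
  have int: "integrable lborel (\<lambda>y. (L (cl_gamma g y) \<bullet> L' (h y)) * ?w y)"
      "integrable lborel (\<lambda>y. (L (g y) \<bullet> L' (cl_gamma h y)) * ?w y)"
    by (rule integrable_polynomial_gaussian[OF pol[OF lin g(2) h(1)] e]
        integrable_polynomial_gaussian[OF pol[OF lin g(1) h(2)] e])+
  have "(\<integral>y. (L (cl_gamma g y) \<bullet> L' (h y)) * ?w y \<partial>lborel) - (\<integral>y. (L (g y) \<bullet> L' (cl_gamma h y)) * ?w y \<partial>lborel)
    = (\<integral>y. (\<Sum>(j, k) | j < k. rotation_field j k (\<phi> j k) y * ?w y) \<partial>lborel)"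
    unfolding Bochner_Integration.integral_diff[OF int, symmetric] left_diff_distrib[symmetric] diff
    by (simp add: sum_distrib_right case_prod_unfold)
  also have "\<dots> = (\<Sum>(j, k) | j < k. (\<integral>y. rotation_field j k (\<phi> j k) y * ?w y \<partial>lborel))"
    unfolding case_prod_unfold
    by (rule Bochner_Integration.integral_sum) (erule CollectE, rule rf(1))
  also have "\<dots> = 0"
    unfolding case_prod_unfold
    by (rule sum.neutral, rule ballI, erule CollectE, rule rf(2))
  finally show ?thesis by simp
qed

lemma cl_gamma_power_move:
  fixes G H :: "real ^ 'm::{finite,linorder} \<Rightarrow> real ^ 'm::{finite,linorder} \<Rightarrow> complex ^ ('m set)"
    and L L' :: "complex ^ ('m set) \<Rightarrow> complex ^ ('m set)"
  assumes lin: "linear L" "linear L'"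
    and comm: "\<And>j u. L (cl_gen j \<odot> u) = cl_gen j \<odot> L u" "\<And>j u. L' (cl_gen j \<odot> u) = cl_gen j \<odot> L' u"
    and GH: "cl_form n M G" "cl_form n' M' H" and e: "e > 0"
  shows "(\<integral>y. (L ((cl_gamma ^^ p) (G x) y) \<bullet> L' ((cl_gamma ^^ q) (H x') y)) * exp (- e * (norm y)\<^sup>2) \<partial>lborel) =
         (\<integral>y. (L ((cl_gamma ^^ (p + q)) (G x) y) \<bullet> L' (H x' y)) * exp (- e * (norm y)\<^sup>2) \<partial>lborel)"
proof (induction q arbitrary: p)
  case 0
  show ?case by simp
next
  case (Suc q)
  have pG: "polynomial_function ((cl_gamma ^^ p) (G x))" for p
    by (rule cl_form_polynomial[OF cl_gamma_power_form[OF GH(1)]])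
  have pH: "polynomial_function ((cl_gamma ^^ p) (H x'))" for p
    by (rule cl_form_polynomial[OF cl_gamma_power_form[OF GH(2)]])
  have "(\<integral>y. (L ((cl_gamma ^^ p) (G x) y) \<bullet> L' ((cl_gamma ^^ Suc q) (H x') y)) * exp (- e * (norm y)\<^sup>2) \<partial>lborel) =
      (\<integral>y. (L ((cl_gamma ^^ Suc p) (G x) y) \<bullet> L' ((cl_gamma ^^ q) (H x') y)) * exp (- e * (norm y)\<^sup>2) \<partial>lborel)"
    using cl_gamma_symmetric[OF lin comm pG[of p] pG[of "Suc p", simplified] pH[of q] pH[of "Suc q", simplified] e]
    by simp
  then show ?case using Suc.IH[of "Suc p"] by simp
qed

section \<open>Limits under the Gaussian weight and the exponential series of Gamma\<close>

lemma gaussian_dominated_convergence: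
  fixes f :: "nat \<Rightarrow> 'a::euclidean_space \<Rightarrow> real"
  assumes e: "e > 0" and [measurable]: "\<And>N. f N \<in> borel_measurable borel"
    and b: "\<And>N y. \<bar>f N y\<bar> \<le> C * exp (D * norm y)" and lim: "\<And>y. (\<lambda>N. f N y) \<longlonglongrightarrow> g y"
  shows "(\<lambda>N. \<integral>y. f N y * exp (- e * (norm y)\<^sup>2) \<partial>lborel) \<longlonglongrightarrow> (\<integral>y. g y * exp (- e * (norm y)\<^sup>2) \<partial>lborel)"
    and "integrable lborel (\<lambda>y. g y * exp (- e * (norm y)\<^sup>2))"
proof -
  have [measurable]: "g \<in> borel_measurable borel"
    by (rule borel_measurable_LIMSEQ_real[OF lim]) auto
  have D: "integrable lborel (\<lambda>y::'a. C * (exp (D * norm y) * exp (- e * (norm y)\<^sup>2)))"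
    by (intro integrable_mult_right integrable_exp_norm_gaussian e)
  have l: "AE y in lborel. (\<lambda>N. f N y * exp (- e * (norm y)\<^sup>2)) \<longlonglongrightarrow> g y * exp (- e * (norm y)\<^sup>2)"
    by (intro AE_I2 tendsto_mult lim tendsto_const)
  have bd: "AE y in lborel. norm (f N y * exp (- e * (norm y)\<^sup>2)) \<le> C * (exp (D * norm y) * exp (- e * (norm y)\<^sup>2))" for N
    using b by (auto simp: abs_mult mult.assoc[symmetric] intro!: mult_right_mono)
  show "(\<lambda>N. \<integral>y. f N y * exp (- e * (norm y)\<^sup>2) \<partial>lborel) \<longlonglongrightarrow> (\<integral>y. g y * exp (- e * (norm y)\<^sup>2) \<partial>lborel)"
    by (rule integral_dominated_convergence[OF _ _ D l bd]) measurable
  show "integrable lborel (\<lambda>y. g y * exp (- e * (norm y)\<^sup>2))"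
    by (rule integrable_dominated_convergence[OF _ _ D l bd]) measurable
qed

lemma power_le_exp: "0 \<le> t \<Longrightarrow> t ^ n \<le> exp (real n * t)"
  using power_mono[of t "exp t" n] exp_ge_add_one_self[of t] by (simp add: exp_of_nat_mult)

text \<open>The sum over the triangle \<open>p + q < N\<close> is exactly \<open>c 0\<close>; the remaining part of the square is
  bounded by the difference of partial sums for \<open>exp D * exp D\<close> and \<open>exp (2 * D)\<close>.\<close>

lemma alternating_double_sum:
  fixes c :: "nat \<Rightarrow> real"
  assumes c: "\<And>n. \<bar>c n\<bar> \<le> K * D ^ n" and D: "0 \<le> D"
  shows "(\<lambda>N. \<Sum>p<N. \<Sum>q<N. (-1) ^ q * c (p + q) / (fact p * fact q)) \<longlonglongrightarrow> c 0"
proof -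
  define f where "f = (\<lambda>(p, q). (-1) ^ q * c (p + q) / (fact p * fact q))"
  define g where "g = (\<lambda>(p, q). D ^ (p + q) / (fact p * fact q))"
  define T where "T N = {(p, q). p + q < (N::nat)}" for N
  have sub: "T N \<subseteq> {..<N} \<times> {..<N}" for N by (auto simp: T_def)
  have tri: "(\<Sum>z\<in>T N. h z) = (\<Sum>k<N. \<Sum>i\<le>k. h (i, k - i))" for h :: "nat \<times> nat \<Rightarrow> real" and N
    using sum.triangle_reindex[of "\<lambda>i j. h (i, j)" N] by (simp add: T_def case_prod_unfold)
  have fT: "(\<Sum>z\<in>T N. f z) = c 0" if "N > 0" for N
  proof -
    \<comment> \<open>Binomial theorem: the diagonal \<open>p + q = k\<close> adds up to a multiple
      of \<open>(1 - 1) ^ k\<close>.\<close>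
    have "(\<Sum>i\<le>k. f (i, k - i)) = (if k = 0 then c 0 else 0)" for k
    proof -
      have "(\<Sum>i\<le>k. f (i, k - i)) = (\<Sum>i\<le>k. c k / fact k * (of_nat (k choose i) * 1 ^ i * (-1) ^ (k - i)))"
        by (intro sum.cong refl) (simp add: f_def binomial_fact field_simps)
      also have "\<dots> = c k / fact k * (1 + (-1)) ^ k"
        by (subst binomial_ring) (simp add: sum_distrib_left)
      finally show ?thesis by simp
    qed
    then show ?thesis using that by (simp add: tri)
  qed
  have gT: "(\<Sum>z\<in>T N. g z) = (\<Sum>k<N. (2 * D) ^ k / fact k)" for N
  proof -
    have "(\<Sum>i\<le>k. g (i, k - i)) = (2 * D) ^ k / fact k" for k
    proof -
      have "(\<Sum>i\<le>k. g (i, k - i)) = (\<Sum>i\<le>k. D ^ k / fact k * (of_nat (k choose i) * 1 ^ i * 1 ^ (k - i)))"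
        by (intro sum.cong refl) (simp add: g_def binomial_fact field_simps)
      also have "\<dots> = D ^ k / fact k * (1 + 1) ^ k"
        by (subst binomial_ring) (simp add: sum_distrib_left)
      finally show ?thesis by (simp add: power_mult_distrib)
    qed
    then show ?thesis by (simp add: tri)
  qed
  have sq: "(\<Sum>p<N. \<Sum>q<N. h (p, q)) = (\<Sum>z\<in>{..<N} \<times> {..<N}. h z)" for h :: "nat \<times> nat \<Rightarrow> real" and N
    by (simp add: sum.cartesian_product)
  have e: "(\<lambda>N. \<Sum>k<N. t ^ k / fact k) \<longlonglongrightarrow> exp t" for t :: real
    using exp_converges[of t] by (simp add: sums_def divide_inverse mult.commute)
  have gS: "(\<Sum>z\<in>{..<N} \<times> {..<N}. g z) = (\<Sum>k<N. D ^ k / fact k) * (\<Sum>k<N. D ^ k / fact k)" for N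
    by (simp add: sq[symmetric] g_def sum_product power_add)
  have "(\<lambda>N. K * ((\<Sum>k<N. D ^ k / fact k) * (\<Sum>k<N. D ^ k / fact k) - (\<Sum>k<N. (2 * D) ^ k / fact k)))
      \<longlonglongrightarrow> K * (exp D * exp D - exp (2 * D))"
    by (intro tendsto_intros e)
  also have "K * (exp D * exp D - exp (2 * D)) = 0" by (simp add: mult_exp_exp)
  finally have lim0: "(\<lambda>N. K * ((\<Sum>z\<in>{..<N} \<times> {..<N}. g z) - (\<Sum>z\<in>T N. g z))) \<longlonglongrightarrow> 0"
    unfolding gS gT .
  have "\<bar>(\<Sum>z\<in>{..<N} \<times> {..<N}. f z) - c 0\<bar> \<le> K * ((\<Sum>z\<in>{..<N} \<times> {..<N}. g z) - (\<Sum>z\<in>T N. g z))" if "N > 0" for N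
  proof -
    have "(\<Sum>z\<in>{..<N} \<times> {..<N}. f z) - c 0 = (\<Sum>z\<in>{..<N} \<times> {..<N} - T N. f z)"
      using fT[OF that] by (simp add: sum_diff[OF _ sub])
    also have "\<bar>\<dots>\<bar> \<le> (\<Sum>z\<in>{..<N} \<times> {..<N} - T N. \<bar>f z\<bar>)" by (rule sum_abs)
    also have "\<dots> \<le> (\<Sum>z\<in>{..<N} \<times> {..<N} - T N. K * g z)"
      using c by (intro sum_mono) (auto simp: f_def g_def abs_mult intro!: divide_right_mono)
    also have "\<dots> = K * ((\<Sum>z\<in>{..<N} \<times> {..<N}. g z) - (\<Sum>z\<in>T N. g z))"
      by (simp add: sum_diff[OF _ sub] right_diff_distrib sum_distrib_left)
    finally show ?thesis .
  qed
  then have "(\<lambda>N. (\<Sum>z\<in>{..<N} \<times> {..<N}. f z) - c 0) \<longlonglongrightarrow> 0"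
    by (intro Lim_null_comparison[OF _ lim0]) (auto simp: eventually_sequentially intro!: exI[of _ 1])
  then show ?thesis
    unfolding LIM_zero_iff sq[symmetric] by (simp add: f_def)
qed

abbreviation gamma_const :: "'m::{finite,linorder} itself \<Rightarrow> real" where
  "gamma_const _ \<equiv> real (card {(j::'m, k). j < k})"

lemma exp_partial_sum_bound:
  fixes f :: "nat \<Rightarrow> 'b::banach"
  assumes f: "\<And>p. norm (f p) \<le> D ^ p / fact p * C" and D: "0 \<le> D" "0 \<le> C"
  shows "norm (\<Sum>p<N. f p) \<le> exp D * C" "summable f" "norm (suminf f) \<le> exp D * C"
proof -
  have e: "(\<lambda>p. D ^ p / fact p * C) sums (exp D * C)"
    using sums_mult2[OF exp_converges[of D], of C] by (simp add: divide_inverse mult_ac)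
  have "norm (\<Sum>p<N. f p) \<le> (\<Sum>p<N. D ^ p / fact p * C)" for N by (rule sum_norm_le) (rule f)
  also have "(\<Sum>p<N. D ^ p / fact p * C) \<le> exp D * C" for N
    unfolding sums_unique[OF e] using D by (intro sum_le_suminf sums_summable[OF e]) auto
  finally show *: "norm (\<Sum>p<N. f p) \<le> exp D * C" for N .
  show s: "summable f"
    by (rule summable_comparison_test'[OF sums_summable[OF e]]) (rule f)
  show "norm (suminf f) \<le> exp D * C"
    using * by (intro LIMSEQ_le_const2[OF tendsto_norm[OF summable_LIMSEQ[OF s]]]) auto
qed

lemma continuous_smult_complex:
  assumes "continuous_on S f" shows "continuous_on S (\<lambda>z. c *s (f z :: complex ^ 'n))"
  by (rule continuous_on_compose2[OF linear_continuous_on[OF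
        linear_smult_complex[unfolded linear_conv_bounded_linear], of UNIV] assms]) auto

context
  fixes G :: "real ^ 'm::{finite,linorder} \<Rightarrow> real ^ 'm::{finite,linorder} \<Rightarrow> complex ^ ('m set)"
    and a :: complex and n :: nat and M D :: real
  assumes G: "cl_form n M G"
  defines "D \<equiv> cmod a * (gamma_const TYPE('m) * real n)"
begin

text \<open>On forms of degree \<open>n\<close> one application of Gamma costs at most the factor
  \<open>gamma_const TYPE('m) * real n\<close>, so \<open>D\<close> acts as a norm of
  \<open>a\<close> times Gamma and the series is dominated by that of \<open>exp D\<close>.\<close>

lemma cl_exp_gamma_term_bound:
  "norm ((a ^ p / fact p) *s (cl_gamma ^^ p) (G x) y) \<le> D ^ p / fact p * (M * norm x ^ n * norm y ^ n)"
proof -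
  have "norm ((cl_gamma ^^ p) (G x) y) \<le> (gamma_const TYPE('m) * real n) ^ p * M * norm x ^ n * norm y ^ n"
    using cl_form_bound[OF cl_gamma_power_form[OF G]] .
  then have "cmod (a ^ p / fact p) * norm ((cl_gamma ^^ p) (G x) y) \<le>
      cmod (a ^ p / fact p) * ((gamma_const TYPE('m) * real n) ^ p * M * norm x ^ n * norm y ^ n)"
    by (rule mult_left_mono) simp
  also have "\<dots> = D ^ p / fact p * (M * norm x ^ n * norm y ^ n)"
    by (simp add: norm_divide norm_power power_mult_distrib D_def)
  finally show ?thesis by (simp add: norm_smult_complex)
qed

lemma cl_exp_gamma_partial_bound:
  "norm (\<Sum>p<N. (a ^ p / fact p) *s (cl_gamma ^^ p) (G x) y) \<le> exp D * (M * norm x ^ n * norm y ^ n)"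
  by (rule exp_partial_sum_bound[OF cl_exp_gamma_term_bound]) (simp_all add: D_def cl_form_nonneg[OF G])

lemma cl_exp_gamma_LIMSEQ:
  "(\<lambda>N. \<Sum>p<N. (a ^ p / fact p) *s (cl_gamma ^^ p) (G x) y) \<longlonglongrightarrow> cl_exp_gamma a (G x) y"
  unfolding cl_exp_gamma_def
  by (rule summable_LIMSEQ, rule exp_partial_sum_bound(2)[OF cl_exp_gamma_term_bound])
    (simp_all add: D_def cl_form_nonneg[OF G])

lemma cl_exp_gamma_bound:
  "norm (cl_exp_gamma a (G x) y) \<le> exp D * (M * norm x ^ n * norm y ^ n)"
  unfolding cl_exp_gamma_def
  by (rule exp_partial_sum_bound(3)[OF cl_exp_gamma_term_bound]) (simp_all add: D_def cl_form_nonneg[OF G])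

lemma polynomial_function_exp_gamma_partial:
  "polynomial_function (\<lambda>y. \<Sum>p<N. (a ^ p / fact p) *s (cl_gamma ^^ p) (G x) y)"
  by (intro polynomial_function_sum finite_lessThan polynomial_function_linear_image[OF linear_smult_complex]
      cl_form_polynomial[OF cl_gamma_power_form[OF G]])

lemma borel_measurable_exp_gamma:
  "(\<lambda>z. cl_exp_gamma a (G (fst z)) (snd z)) \<in> borel_measurable borel"
proof (rule borel_measurable_LIMSEQ_metric[OF _ cl_exp_gamma_LIMSEQ])
  show "(\<lambda>z. \<Sum>p<N. (a ^ p / fact p) *s (cl_gamma ^^ p) (G (fst z)) (snd z)) \<in> borel_measurable borel" for N
    by (intro borel_measurable_continuous_onI continuous_on_sum continuous_smult_complex
        cl_form_continuous[OF cl_gamma_power_form[OF G]])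
qed

end

lemma linear_cl_mult_right:
  "linear (\<lambda>u. (\<kappa> *s u) \<odot> (b :: complex ^ ('m::{finite,linorder} set)))"
  using bounded_linear_compose[OF bounded_bilinear.bounded_linear_left[OF bounded_bilinear_cl_mult]
      linear_smult_complex[unfolded linear_conv_bounded_linear]]
  by (simp add: linear_conv_bounded_linear)

lemma real_polynomial_function_inner_linear:
  fixes L L' :: "complex ^ ('m set) \<Rightarrow> complex ^ ('m::finite set)"
  assumes "linear L" "linear L'" "polynomial_function g" "polynomial_function h"
  shows "real_polynomial_function (\<lambda>y. L (g y) \<bullet> L' (h y))"
  by (rule real_polynomial_function_inner[OF polynomial_function_linear_image[OF assms(1,3)]
          polynomial_function_linear_image[OF assms(2,4)]])

text \<open>The exponential of a symmetric operator times an imaginary number is unitary. Expand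
  both exponentials and move every power of Gamma to the left factor; since
  \<open>cnj a = - a\<close>, the coefficients become
  \<open>(-1) ^ q * c (p + q) / (fact p * fact q)\<close>, and \<open>alternating_double_sum\<close>
  leaves only \<open>c 0\<close>. The degrees \<open>n\<close> and \<open>n'\<close> may differ, as
  they do in the kernel series.\<close>

lemma cl_exp_gamma_isometry:
  fixes G H :: "real ^ 'm::{finite,linorder} \<Rightarrow> real ^ 'm::{finite,linorder} \<Rightarrow> complex ^ ('m set)"
  assumes G: "cl_form n M G" and H: "cl_form n' M' H" and a: "cnj a = - a" and e: "e > 0"
  shows "(\<integral>y. (((\<kappa> *s cl_exp_gamma a (G x) y) \<odot> b) \<bullet> ((\<kappa>' *s cl_exp_gamma a (H x') y) \<odot> d)) * exp (- e * (norm y)\<^sup>2) \<partial>lborel)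
       = (\<integral>y. (((\<kappa> *s G x y) \<odot> b) \<bullet> ((\<kappa>' *s H x' y) \<odot> d)) * exp (- e * (norm y)\<^sup>2) \<partial>lborel)"
proof -
  let ?w = "\<lambda>y :: (real, 'm) vec. exp (- e * (norm y)\<^sup>2)"
  define L where "L u = (\<kappa> *s u) \<odot> b" for u
  define L' where "L' u = (\<kappa>' *s u) \<odot> d" for u
  have lin: "linear L" "linear L'"
    unfolding L_def[abs_def] L'_def[abs_def] by (rule linear_cl_mult_right)+
  have comm: "L (cl_gen j \<odot> u) = cl_gen j \<odot> L u" "L' (cl_gen j \<odot> u) = cl_gen j \<odot> L' u" for j u
    unfolding L_def L'_def by (simp_all only: cl_mult_smult_left cl_mult_smult_right cl_mult_assoc)
  have scal: "L (c *s u) = c *s L u" "L' (c *s u) = c *s L' u" for c u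
    unfolding L_def L'_def by (simp_all only: cl_mult_smult_left vector_smult_assoc mult.commute)
  obtain KL where KL: "KL > 0" "\<And>u. norm (L u) \<le> norm u * KL"
    using bounded_linear.pos_bounded[OF lin(1)[unfolded linear_conv_bounded_linear]] by auto
  obtain KL' where KL': "KL' > 0" "\<And>u. norm (L' u) \<le> norm u * KL'"
    using bounded_linear.pos_bounded[OF lin(2)[unfolded linear_conv_bounded_linear]] by auto
  define D where "D = cmod a * (gamma_const TYPE('m) * real n)"
  define D' where "D' = cmod a * (gamma_const TYPE('m) * real n')"
  note M0 = cl_form_nonneg[OF G] cl_form_nonneg[OF H]
  have inner_bd: "\<bar>L u \<bullet> L' v\<bar> \<le> R * R' * (KL * KL' * (M * norm x ^ n) * (M' * norm x' ^ n')) * exp (real (n + n') * norm y)"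
    if u: "norm u \<le> R * (M * norm x ^ n * norm y ^ n)" and v: "norm v \<le> R' * (M' * norm x' ^ n' * norm y ^ n')"
      and R: "0 \<le> R" "0 \<le> R'" for u v R R' and y :: "(real, 'm) vec"
  proof -
    have "norm (L u) * norm (L' v) \<le> (norm u * KL) * (norm v * KL')"
      using KL KL' by (intro mult_mono) auto
    also have "\<dots> \<le> (R * (M * norm x ^ n * norm y ^ n) * KL) * (R' * (M' * norm x' ^ n' * norm y ^ n') * KL')"
      using KL KL' u v R M0 by (intro mult_mono mult_nonneg_nonneg) auto
    also have "\<dots> = R * R' * (KL * KL' * (M * norm x ^ n) * (M' * norm x' ^ n')) * norm y ^ (n + n')"
      by (simp add: power_add)
    also have "\<dots> \<le> R * R' * (KL * KL' * (M * norm x ^ n) * (M' * norm x' ^ n')) * exp (real (n + n') * norm y)"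
      using KL KL' R M0 power_le_exp[of "norm y" "n + n'"]
      by (intro mult_left_mono mult_nonneg_nonneg) auto
    finally show ?thesis using Cauchy_Schwarz_ineq2[of "L u" "L' v"] by linarith
  qed
  define S where "S N y = (\<Sum>p<N. (a ^ p / fact p) *s (cl_gamma ^^ p) (G x) y)" for N y
  define S' where "S' N y = (\<Sum>p<N. (a ^ p / fact p) *s (cl_gamma ^^ p) (H x') y)" for N y
  \<comment> \<open>The power \<open>a ^ k\<close> stays inside, because the inner product is only
    real bilinear. This keeps \<open>c k\<close> real even though \<open>a\<close> is
    imaginary.\<close>
  define c where "c k = (\<integral>y. ((a ^ k *s L ((cl_gamma ^^ k) (G x) y)) \<bullet> L' (H x' y)) * ?w y \<partial>lborel)" for k
  have pG: "polynomial_function ((cl_gamma ^^ p) (G x))" for p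
    by (rule cl_form_polynomial[OF cl_gamma_power_form[OF G]])
  have pH: "polynomial_function ((cl_gamma ^^ p) (H x'))" for p
    by (rule cl_form_polynomial[OF cl_gamma_power_form[OF H]])
  have linc: "linear (\<lambda>u. z *s L u)" "linear (\<lambda>u. z *s L' u)" for z
    using linear_compose[OF lin(1) linear_smult_complex] linear_compose[OF lin(2) linear_smult_complex]
    by (simp_all add: o_def)
  have trm: "integrable lborel (\<lambda>y. (L ((a ^ p / fact p) *s (cl_gamma ^^ p) (G x) y) \<bullet> L' ((a ^ q / fact q) *s (cl_gamma ^^ q) (H x') y)) * ?w y)"
     "(\<integral>y. (L ((a ^ p / fact p) *s (cl_gamma ^^ p) (G x) y) \<bullet> L' ((a ^ q / fact q) *s (cl_gamma ^^ q) (H x') y)) * ?w y \<partial>lborel)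
        = (-1) ^ q * c (p + q) / (fact p * fact q)" for p q
  proof -
    show "integrable lborel (\<lambda>y. (L ((a ^ p / fact p) *s (cl_gamma ^^ p) (G x) y) \<bullet> L' ((a ^ q / fact q) *s (cl_gamma ^^ q) (H x') y)) * ?w y)"
      unfolding scal
      by (rule integrable_polynomial_gaussian[OF real_polynomial_function_inner_linear[OF linc pG pH] e])
    have i1: "(z *s u) \<bullet> (z' *s v) = ((z * cnj z') *s u) \<bullet> v" for z z' and u v :: "complex ^ ('m set)"
      using inner_smult_complex[of "cnj z'" "z *s u" v] by (simp add: vector_smult_assoc mult.commute)
    have i2: "a ^ p / fact p * cnj (a ^ q / fact q) = complex_of_real ((-1) ^ q / (fact p * fact q)) * a ^ (p + q)"
      using power_minus[of a q] by (simp add: a power_add)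
    have "L ((a ^ p / fact p) *s u) \<bullet> L' ((a ^ q / fact q) *s v) = (-1) ^ q / (fact p * fact q) * ((a ^ (p + q) *s L u) \<bullet> L' v)" for u v
    proof -
      have "L ((a ^ p / fact p) *s u) \<bullet> L' ((a ^ q / fact q) *s v) =
          (((-1) ^ q / (fact p * fact q)) *\<^sub>R (a ^ (p + q) *s L u)) \<bullet> L' v"
        unfolding scal i1 i2 scaleR_eq_smult vector_smult_assoc ..
      then show ?thesis by simp
    qed
    then have "(\<integral>y. (L ((a ^ p / fact p) *s (cl_gamma ^^ p) (G x) y) \<bullet> L' ((a ^ q / fact q) *s (cl_gamma ^^ q) (H x') y)) * ?w y \<partial>lborel)
       = (-1) ^ q / (fact p * fact q) * (\<integral>y. ((a ^ (p + q) *s L ((cl_gamma ^^ p) (G x) y)) \<bullet> L' ((cl_gamma ^^ q) (H x') y)) * ?w y \<partial>lborel)"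
      by (simp only: mult.assoc integral_mult_right_zero)
    also have "(\<integral>y. ((a ^ (p + q) *s L ((cl_gamma ^^ p) (G x) y)) \<bullet> L' ((cl_gamma ^^ q) (H x') y)) * ?w y \<partial>lborel) = c (p + q)"
      unfolding c_def
      by (rule cl_gamma_power_move[OF linc(1) lin(2) _ comm(2) G H e]) (simp add: comm cl_mult_smult_right)
    finally show "(\<integral>y. (L ((a ^ p / fact p) *s (cl_gamma ^^ p) (G x) y) \<bullet> L' ((a ^ q / fact q) *s (cl_gamma ^^ q) (H x') y)) * ?w y \<partial>lborel)
        = (-1) ^ q * c (p + q) / (fact p * fact q)" by simp
  qed
  have sums: "(\<integral>y. (L (S N y) \<bullet> L' (S' N y)) * ?w y \<partial>lborel) = (\<Sum>p<N. \<Sum>q<N. (-1) ^ q * c (p + q) / (fact p * fact q))" for N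
  proof -
    have "(L (S N y) \<bullet> L' (S' N y)) * ?w y = (\<Sum>p<N. \<Sum>q<N.
        (L ((a ^ p / fact p) *s (cl_gamma ^^ p) (G x) y) \<bullet> L' ((a ^ q / fact q) *s (cl_gamma ^^ q) (H x') y)) * ?w y)" for y
      unfolding S_def S'_def linear_sum[OF lin(1)] linear_sum[OF lin(2)] inner_sum_left inner_sum_right
        sum_distrib_right by (rule sum.swap)
    then show ?thesis
      by (simp only: Bochner_Integration.integral_sum Bochner_Integration.integrable_sum trm)
  qed
  have "\<bar>c k\<bar> \<le> (\<integral>y. KL * KL' * (M * norm x ^ n) * (M' * norm x' ^ n') * exp (real (n + n') * norm y) * ?w y \<partial>lborel) * D ^ k" for k
  proof -
    have ex: "integrable lborel (\<lambda>y :: (real, 'm) vec. R * exp (real (n + n') * norm y) * ?w y)" for R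
      unfolding mult.assoc by (intro integrable_mult_right integrable_exp_norm_gaussian e)
    have "\<bar>c k\<bar> \<le> (\<integral>y. D ^ k * (KL * KL' * (M * norm x ^ n) * (M' * norm x' ^ n')) * exp (real (n + n') * norm y) * ?w y \<partial>lborel)"
      unfolding c_def
    proof (rule integral_abs_bound_integral[OF _ ex])
      show "integrable lborel (\<lambda>y. ((a ^ k *s L ((cl_gamma ^^ k) (G x) y)) \<bullet> L' (H x' y)) * ?w y)"
        by (rule integrable_polynomial_gaussian[OF real_polynomial_function_inner_linear[OF linc(1) lin(2) pG pH[of 0, simplified]] e])
      fix y :: "(real, 'm) vec"
      have "norm (a ^ k *s (cl_gamma ^^ k) (G x) y) = fact k * norm ((a ^ k / fact k) *s (cl_gamma ^^ k) (G x) y)"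
        by (simp add: norm_smult_complex norm_divide)
      also have "\<dots> \<le> fact k * (D ^ k / fact k * (M * norm x ^ n * norm y ^ n))"
        unfolding D_def by (intro mult_left_mono cl_exp_gamma_term_bound[OF G]) simp
      finally have 1: "norm (a ^ k *s (cl_gamma ^^ k) (G x) y) \<le> D ^ k * (M * norm x ^ n * norm y ^ n)" by simp
      have 2: "norm (H x' y) \<le> 1 * (M' * norm x' ^ n' * norm y ^ n')"
        using cl_form_bound[OF H] by simp
      have "0 \<le> D ^ k" by (simp add: D_def)
      from inner_bd[OF 1 2 this]
      have "\<bar>(a ^ k *s L ((cl_gamma ^^ k) (G x) y)) \<bullet> L' (H x' y)\<bar> \<le>
        D ^ k * (KL * KL' * (M * norm x ^ n) * (M' * norm x' ^ n')) * exp (real (n + n') * norm y)"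
        by (simp add: scal)
      then show "\<bar>((a ^ k *s L ((cl_gamma ^^ k) (G x) y)) \<bullet> L' (H x' y)) * ?w y\<bar> \<le>
        D ^ k * (KL * KL' * (M * norm x ^ n) * (M' * norm x' ^ n')) * exp (real (n + n') * norm y) * ?w y"
        by (simp add: abs_mult mult_right_mono)
    qed
    also have "\<dots> = (\<integral>y. KL * KL' * (M * norm x ^ n) * (M' * norm x' ^ n') * exp (real (n + n') * norm y) * ?w y \<partial>lborel) * D ^ k"
      unfolding mult.assoc integral_mult_right_zero by (simp only: mult_ac)
    finally show ?thesis .
  qed
  then have lim1: "(\<lambda>N. \<integral>y. (L (S N y) \<bullet> L' (S' N y)) * ?w y \<partial>lborel) \<longlonglongrightarrow> c 0"
    unfolding sums by (rule alternating_double_sum) (simp add: D_def)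
  have lim2: "(\<lambda>N. \<integral>y. (L (S N y) \<bullet> L' (S' N y)) * ?w y \<partial>lborel) \<longlonglongrightarrow>
      (\<integral>y. (L (cl_exp_gamma a (G x) y) \<bullet> L' (cl_exp_gamma a (H x') y)) * ?w y \<partial>lborel)"
  proof (rule gaussian_dominated_convergence(1)[OF e])
    show "(\<lambda>y. L (S N y) \<bullet> L' (S' N y)) \<in> borel_measurable borel" for N
      unfolding S_def S'_def
      by (intro borel_measurable_continuous_onI real_polynomial_function_continuous
          real_polynomial_function_inner_linear[OF lin] polynomial_function_exp_gamma_partial[OF G]
          polynomial_function_exp_gamma_partial[OF H])
    show "\<bar>L (S N y) \<bullet> L' (S' N y)\<bar> \<le> exp D * exp D' * (KL * KL' * (M * norm x ^ n) * (M' * norm x' ^ n')) * exp (real (n + n') * norm y)" for N y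
      unfolding S_def S'_def D_def D'_def
      by (rule inner_bd) (intro cl_exp_gamma_partial_bound[OF G] cl_exp_gamma_partial_bound[OF H] exp_ge_zero)+
    show "(\<lambda>N. L (S N y) \<bullet> L' (S' N y)) \<longlonglongrightarrow> L (cl_exp_gamma a (G x) y) \<bullet> L' (cl_exp_gamma a (H x') y)" for y
      unfolding S_def S'_def
      using lin[unfolded linear_conv_bounded_linear]
      by (intro tendsto_inner bounded_linear.tendsto[of L] bounded_linear.tendsto[of L']
          cl_exp_gamma_LIMSEQ[OF G] cl_exp_gamma_LIMSEQ[OF H])
  qed
  have "c 0 = (\<integral>y. (L (G x y) \<bullet> L' (H x' y)) * ?w y \<partial>lborel)"
    by (simp add: c_def)
  with LIMSEQ_unique[OF lim2 lim1] show ?thesis unfolding L_def L'_def by simp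
qed

section \<open>The Clifford--Fourier kernel\<close>

definition power_form :: "nat \<Rightarrow> real ^ 'm::{finite,linorder} \<Rightarrow> real ^ 'm::{finite,linorder} \<Rightarrow> complex ^ ('m set)" where
  "power_form n x y = cl_scalar (complex_of_real ((x \<bullet> y) ^ n))"

lemma power_form_scaleR: "power_form n x y = (x \<bullet> y) ^ n *\<^sub>R cl_basis {}"
  unfolding power_form_def cl_scalar_def scaleR_eq_smult ..

lemma cl_form_power: "cl_form n 1 (power_form n :: real ^ 'm::{finite,linorder} \<Rightarrow> _)"
proof (induction n)
  case 0
  have "power_form 0 = (\<lambda>(x :: (real, 'm) vec) y. cl_basis {})" by (intro ext) (simp add: power_form_scaleR)
  then show ?case using cl_form.const[of "cl_basis {}"] by simp
next
  case (Suc n)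
  have "power_form (Suc n) = (\<lambda>(x :: (real, 'm) vec) y. (x \<bullet> y) *\<^sub>R power_form n x y)"
    by (intro ext) (simp add: power_form_scaleR)
  then show ?case using cl_form.mult[OF linear_ident _ Suc] by simp
qed

definition cft_exponent :: "real \<Rightarrow> complex" where
  "cft_exponent \<sigma> = - complex_of_real \<sigma> * \<i> * (complex_of_real pi / 2)"

lemma cft_kernel_eq:
  "cft_kernel \<sigma> x y = (\<Sum>n. ((- \<i>) ^ n / fact n) *s cl_exp_gamma (cft_exponent \<sigma>) (power_form n x) y)"
  unfolding cft_kernel_def cft_exponent_def power_form_def[abs_def] ..

lemma cnj_cft_exponent: "cnj (cft_exponent \<sigma>) = - cft_exponent \<sigma>"
  by (simp add: cft_exponent_def)

definition kernel_sum :: "real \<Rightarrow> nat \<Rightarrow> real ^ 'm::{finite,linorder} \<Rightarrow> real ^ 'm::{finite,linorder} \<Rightarrow> complex ^ ('m set)" where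
  "kernel_sum \<sigma> N x y = (\<Sum>n<N. ((- \<i>) ^ n / fact n) *s cl_exp_gamma (cft_exponent \<sigma>) (power_form n x) y)"

text \<open>The exponential of Gamma costs at most \<open>kernel_const \<sigma> T ^ n\<close> in
  degree \<open>n\<close>, so the kernel series is dominated by the one for the exponential of
  \<open>kernel_const\<close> times the product of the norms.\<close>

definition kernel_const :: "real \<Rightarrow> 'm::{finite,linorder} itself \<Rightarrow> real" where
  "kernel_const \<sigma> T = exp (cmod (cft_exponent \<sigma>) * gamma_const T)"

lemma kernel_term_bound:
  fixes x y :: "real ^ 'm::{finite,linorder}"
  shows "norm (((- \<i>) ^ n / fact n) *s cl_exp_gamma (cft_exponent \<sigma>) (power_form n x) y)
    \<le> (kernel_const \<sigma> TYPE('m) * norm x * norm y) ^ n / fact n * 1"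
proof -
  have "norm (cl_exp_gamma (cft_exponent \<sigma>) (power_form n x) y) \<le>
      exp (cmod (cft_exponent \<sigma>) * (gamma_const TYPE('m) * real n)) * (1 * norm x ^ n * norm y ^ n)"
    by (rule cl_exp_gamma_bound[OF cl_form_power])
  also have "\<dots> = (kernel_const \<sigma> TYPE('m) * norm x * norm y) ^ n"
    by (simp add: kernel_const_def power_mult_distrib exp_of_nat_mult[symmetric] mult_ac)
  finally show ?thesis
    by (simp add: norm_smult_complex norm_divide norm_power divide_right_mono)
qed

lemma kernel_const_nonneg: "0 \<le> kernel_const \<sigma> T"
  by (simp add: kernel_const_def)

lemma kernel_sum_bound:
  fixes x y :: "real ^ 'm::{finite,linorder}"
  shows "norm (kernel_sum \<sigma> N x y) \<le> exp (kernel_const \<sigma> TYPE('m) * norm x * norm y)"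
  unfolding kernel_sum_def
  by (rule order_trans[OF exp_partial_sum_bound(1)[OF kernel_term_bound]]) (simp_all add: kernel_const_nonneg)

lemma kernel_sum_LIMSEQ: "(\<lambda>N. kernel_sum \<sigma> N x y) \<longlonglongrightarrow> cft_kernel \<sigma> x y"
  unfolding kernel_sum_def cft_kernel_eq
  by (rule summable_LIMSEQ, rule exp_partial_sum_bound(2)[OF kernel_term_bound])
    (simp_all add: kernel_const_nonneg)

lemma borel_measurable_smult_complex:
  assumes "f \<in> borel_measurable M" shows "(\<lambda>z. c *s (f z :: complex ^ 'n)) \<in> borel_measurable M"
  by (rule measurable_compose[OF assms borel_measurable_continuous_onI])
    (intro continuous_smult_complex continuous_on_id)

lemma borel_measurable_kernel_sum:
  "(\<lambda>z. kernel_sum \<sigma> N (fst z) (snd z)) \<in> borel_measurable borel"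
  unfolding kernel_sum_def
  by (intro borel_measurable_sum borel_measurable_smult_complex borel_measurable_exp_gamma[OF cl_form_power])

lemma borel_measurable_cft_kernel [measurable]:
  "(\<lambda>z. cft_kernel \<sigma> (fst z) (snd z)) \<in> borel_measurable borel"
  by (rule borel_measurable_LIMSEQ_metric[OF borel_measurable_kernel_sum kernel_sum_LIMSEQ])

lemma borel_measurable_pair_section:
  fixes f :: "'a::second_countable_topology \<times> 'b::second_countable_topology \<Rightarrow> 'c::topological_space"
  assumes "f \<in> borel_measurable borel"
  shows "(\<lambda>y. f (x, y)) \<in> borel_measurable borel" "(\<lambda>x. f (x, y)) \<in> borel_measurable borel"
  using assms by (auto intro!: measurable_compose[OF _ assms] borel_measurable_continuous_onI continuous_intros)

text \<open>The partial sums of \<open>kernel_sum\<close> with the exponential of \<open>\<Gamma>\<close> removed.\<close>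

definition plane_sum :: "nat \<Rightarrow> real ^ 'm::{finite,linorder} \<Rightarrow> real ^ 'm::{finite,linorder} \<Rightarrow> complex ^ ('m set)" where
  "plane_sum N x y = (\<Sum>n<N. ((- \<i>) ^ n / fact n) *s power_form n x y)"

lemma plane_sum_eq: "plane_sum N x y = (\<Sum>n<N. (- \<i> * complex_of_real (x \<bullet> y)) ^ n / fact n) *s cl_basis {}"
proof -
  have "((- \<i>) ^ n / fact n) *s power_form n x y = ((- \<i> * complex_of_real (x \<bullet> y)) ^ n / fact n) *s cl_basis {}" for n
    unfolding power_form_def cl_scalar_def vector_smult_assoc of_real_power power_mult_distrib
    by (simp only: times_divide_eq_left)
  then show ?thesis by (simp add: plane_sum_def vec_eq_iff sum_distrib_right)
qed

lemma norm_cl_one: "norm (cl_basis {} :: complex ^ ('m::{finite,linorder} set)) = 1"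
  by (simp add: norm_axis_1)

lemma plane_sum_bound:
  "norm (plane_sum N x y) \<le> exp (norm x * norm y)"
proof -
  have "\<bar>x \<bullet> y\<bar> ^ n \<le> (norm x * norm y) ^ n" for n
    by (intro power_mono Cauchy_Schwarz_ineq2) simp
  then have "norm ((- \<i> * complex_of_real (x \<bullet> y)) ^ n / fact n) \<le> (norm x * norm y) ^ n / fact n * 1" for n
    by (simp add: norm_divide norm_power norm_mult divide_right_mono)
  from exp_partial_sum_bound(1)[OF this, of N] show ?thesis
    by (simp add: plane_sum_eq norm_smult_complex norm_cl_one)
qed

lemma plane_sum_LIMSEQ: "(\<lambda>N. plane_sum N x y) \<longlonglongrightarrow> exp (- \<i> * complex_of_real (x \<bullet> y)) *s cl_basis {}"
proof -
  have "(\<lambda>N. \<Sum>n<N. z ^ n / fact n) \<longlonglongrightarrow> exp z" for z :: complex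
    using exp_converges[of z] by (simp add: sums_def scaleR_conv_of_real divide_inverse mult.commute)
  moreover have "bounded_linear (\<lambda>c. c *s v)" for v :: "complex ^ 'n"
    by (intro linear_conv_bounded_linear[THEN iffD1] linearI) (auto simp: vec_eq_iff algebra_simps)
  ultimately show ?thesis
    unfolding plane_sum_eq by (rule bounded_linear.tendsto[rotated])
qed

text \<open>Both sides expand into finitely many pairs of homogeneous terms, and
  \<open>cl_exp_gamma_isometry\<close> removes the exponential from each pair, whether or not the
  degrees agree.\<close>

lemma kernel_sum_isometry:
  fixes x x' :: "real ^ 'm::{finite,linorder}"
  assumes e: "e > 0"
  shows "(\<integral>y. ((kernel_sum \<sigma> N x y \<odot> b) \<bullet> (kernel_sum \<sigma> N x' y \<odot> d)) * exp (- e * (norm y)\<^sup>2) \<partial>lborel)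
    = (\<integral>y. ((plane_sum N x y \<odot> b) \<bullet> (plane_sum N x' y \<odot> d)) * exp (- e * (norm y)\<^sup>2) \<partial>lborel)"
proof -
  let ?w = "\<lambda>y :: (real, 'm) vec. exp (- e * (norm y)\<^sup>2)"
  let ?c = "\<lambda>n. (- \<i>) ^ n / fact n :: complex"
  let ?W = "\<lambda>n x y. cl_exp_gamma (cft_exponent \<sigma>) (power_form n x) y"
  obtain B :: real where B: "B > 0" "\<And>u v :: complex ^ ('m set). norm (u \<odot> v) \<le> norm u * norm v * B"
    using bounded_bilinear.pos_bounded[OF bounded_bilinear_cl_mult] by blast
  have int: "integrable lborel (\<lambda>y. ((f y \<odot> b) \<bullet> (g y \<odot> d)) * ?w y)"
    if fm: "f \<in> borel_measurable borel" and gm: "g \<in> borel_measurable borel"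
      and fb: "\<And>y. norm (f y) \<le> exp (Cf * norm y)" and gb: "\<And>y. norm (g y) \<le> exp (Cg * norm y)"
    for f g :: "(real, 'm) vec \<Rightarrow> complex ^ ('m set)" and Cf Cg
  proof (rule gaussian_dominated_convergence(2)[OF e, where f = "\<lambda>N y. (f y \<odot> b) \<bullet> (g y \<odot> d)" and D = "Cf + Cg" and C = "norm b * B * (norm d * B)"])
    have "(\<lambda>y. u y \<odot> v) \<in> borel_measurable borel" if "u \<in> borel_measurable borel" for u :: "(real, 'm) vec \<Rightarrow> complex ^ ('m set)" and v
      using that by (rule measurable_compose[OF _ borel_measurable_continuous_onI])
        (intro linear_continuous_on bounded_bilinear.bounded_linear_left[OF bounded_bilinear_cl_mult])
    note m = this[OF fm] this[OF gm]
    show "(\<lambda>y. (f y \<odot> b) \<bullet> (g y \<odot> d)) \<in> borel_measurable borel"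
      by (intro borel_measurable_inner m)
    fix y
    have "\<bar>(f y \<odot> b) \<bullet> (g y \<odot> d)\<bar> \<le> norm (f y \<odot> b) * norm (g y \<odot> d)" by (rule Cauchy_Schwarz_ineq2)
    also have "\<dots> \<le> (norm (f y) * norm b * B) * (norm (g y) * norm d * B)"
      using B by (intro mult_mono) auto
    also have "\<dots> \<le> (exp (Cf * norm y) * norm b * B) * (exp (Cg * norm y) * norm d * B)"
      using B by (intro mult_mono fb gb mult_right_mono mult_nonneg_nonneg) auto
    finally show "\<bar>(f y \<odot> b) \<bullet> (g y \<odot> d)\<bar> \<le> norm b * B * (norm d * B) * exp ((Cf + Cg) * norm y)"
      by (simp add: exp_add algebra_simps)
  qed simp
  have expand: "((\<Sum>n<N. ?c n *s F n) \<odot> b) \<bullet> ((\<Sum>n<N. ?c n *s F' n) \<odot> d) * r =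
      (\<Sum>n<N. \<Sum>n'<N. ((?c n *s F n) \<odot> b) \<bullet> ((?c n' *s F' n') \<odot> d) * r)" for F F' and r :: real
    unfolding cl_sum_left inner_sum_left inner_sum_right sum_distrib_right by (rule sum.swap)
  \<comment> \<open>A single term is bounded by the whole exponential series. The rate adds up the
    cases \<open>k = 1\<close> and \<open>k = kernel_const\<close>, so terms with and without the
    exponential of Gamma share one majorant.\<close>
  have bnd: "norm (?c n *s u) \<le> exp ((kernel_const \<sigma> TYPE('m) * norm z + norm z) * norm y)" 
    if "norm (?c n *s u) \<le> (k * norm z * norm y) ^ n / fact n" "k = 1 \<or> k = kernel_const \<sigma> TYPE('m)"
    for n u k and z y :: "(real, 'm) vec"
  proof -
    have k: "0 \<le> k" "k \<le> kernel_const \<sigma> TYPE('m) + 1" using that(2) kernel_const_nonneg by auto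
    have "(k * norm z * norm y) ^ n / fact n \<le> (\<Sum>i<Suc n. (k * norm z * norm y) ^ i / fact i)"
      using k by (intro member_le_sum) auto
    also have "\<dots> \<le> exp (k * norm z * norm y)"
      using exp_partial_sum_bound(1)[of "\<lambda>i. (k * norm z * norm y) ^ i / fact i" "k * norm z * norm y" 1 "Suc n"] k
      by (simp add: abs_mult norm_divide norm_power)
    also have "\<dots> \<le> exp ((kernel_const \<sigma> TYPE('m) * norm z + norm z) * norm y)"
      using mult_right_mono[OF k(2), of "norm z * norm y"] by (simp add: algebra_simps)
    finally show ?thesis using that(1) by linarith
  qed
  have W1: "norm (?c n *s ?W n z y) \<le> exp ((kernel_const \<sigma> TYPE('m) * norm z + norm z) * norm y)" for n and z y :: "(real, 'm) vec"
    using kernel_term_bound[of n \<sigma> z y] by (intro bnd[of _ _ "kernel_const \<sigma> TYPE('m)"]) simp_all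
  have P1: "norm (?c n *s power_form n z y) \<le> exp ((kernel_const \<sigma> TYPE('m) * norm z + norm z) * norm y)" for n and z y :: "(real, 'm) vec"
    using cl_form_bound[OF cl_form_power, of n z y]
    by (intro bnd[of _ _ 1]) (simp_all add: norm_smult_complex norm_divide norm_power divide_right_mono power_mult_distrib)
  have Wm: "(\<lambda>y. ?c n *s ?W n z y) \<in> borel_measurable borel" for n and z :: "(real, 'm) vec"
  proof (rule borel_measurable_smult_complex)
    show "(\<lambda>y. ?W n z y) \<in> borel_measurable borel"
      using borel_measurable_pair_section(1)[OF borel_measurable_exp_gamma[OF cl_form_power[of n]], where x = z]
      by (simp only: fst_conv snd_conv)
  qed
  have Pm: "(\<lambda>y. ?c n *s power_form n z y) \<in> borel_measurable borel" for n and z :: "(real, 'm) vec"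
    by (rule borel_measurable_smult_complex, rule borel_measurable_continuous_onI,
        rule continuous_on_polymonial_function, rule cl_form_polynomial[OF cl_form_power])
  have swap: "(\<integral>y. (\<Sum>n<N. \<Sum>n'<N. F n n' y) \<partial>lborel) = (\<Sum>n<N. \<Sum>n'<N. \<integral>y. F n n' y \<partial>lborel)"
    if "\<And>n n'. integrable lborel (F n n')" for F :: "nat \<Rightarrow> nat \<Rightarrow> (real, 'm) vec \<Rightarrow> real"
    using that by (simp add: Bochner_Integration.integral_sum Bochner_Integration.integrable_sum)
  show ?thesis
    unfolding kernel_sum_def plane_sum_def expand swap[OF int[OF Wm Wm W1 W1]] swap[OF int[OF Pm Pm P1 P1]]
    by (intro sum.cong refl cl_exp_gamma_isometry[OF cl_form_power cl_form_power cnj_cft_exponent e])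
qed

text \<open>The limit of \<open>kernel_sum_isometry\<close>: on the right the partial sums become
  plane waves, so under a Gaussian weight the kernel has the inner products of the ordinary Fourier
  kernel.\<close>

lemma cft_kernel_isometry:
  fixes x x' :: "real ^ 'm::{finite,linorder}"
  assumes e: "e > 0"
  shows "(\<integral>y. ((cft_kernel \<sigma> x y \<odot> b) \<bullet> (cft_kernel \<sigma> x' y \<odot> d)) * exp (- e * (norm y)\<^sup>2) \<partial>lborel)
    = (\<integral>y. ((exp (- \<i> * complex_of_real (x \<bullet> y)) *s b) \<bullet> (exp (- \<i> * complex_of_real (x' \<bullet> y)) *s d)) * exp (- e * (norm y)\<^sup>2) \<partial>lborel)" (is ?eq)
    and "integrable lborel (\<lambda>y. ((cft_kernel \<sigma> x y \<odot> b) \<bullet> (cft_kernel \<sigma> x' y \<odot> d)) * exp (- e * (norm y)\<^sup>2))" (is ?int)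
proof -
  obtain B :: real where B: "B > 0" "\<And>u v :: complex ^ ('m set). norm (u \<odot> v) \<le> norm u * norm v * B"
    using bounded_bilinear.pos_bounded[OF bounded_bilinear_cl_mult] by blast
  have bl: "bounded_linear (\<lambda>u. u \<odot> v)" for v :: "complex ^ ('m set)"
    by (rule bounded_bilinear.bounded_linear_left[OF bounded_bilinear_cl_mult])
  have meas: "(\<lambda>y. u y \<odot> v) \<in> borel_measurable borel" if "u \<in> borel_measurable borel" for u :: "(real, 'm) vec \<Rightarrow> complex ^ ('m set)" and v
    using that by (rule measurable_compose[OF _ borel_measurable_continuous_onI]) (intro linear_continuous_on bl)
  have bound: "\<bar>(u \<odot> b) \<bullet> (v \<odot> d)\<bar> \<le> norm b * B * (norm d * B) * exp ((C * norm x + C * norm x') * norm y)"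
    if "norm u \<le> exp (C * norm x * norm y)" "norm v \<le> exp (C * norm x' * norm y)" for u v C and y :: "(real, 'm) vec"
  proof -
    have "\<bar>(u \<odot> b) \<bullet> (v \<odot> d)\<bar> \<le> norm (u \<odot> b) * norm (v \<odot> d)" by (rule Cauchy_Schwarz_ineq2)
    also have "\<dots> \<le> (norm u * norm b * B) * (norm v * norm d * B)"
      using B by (intro mult_mono) auto
    also have "\<dots> \<le> (exp (C * norm x * norm y) * norm b * B) * (exp (C * norm x' * norm y) * norm d * B)"
      using B by (intro mult_mono that mult_right_mono mult_nonneg_nonneg) auto
    finally show ?thesis by (simp add: exp_add algebra_simps)
  qed
  have K: "(\<lambda>N. \<integral>y. ((kernel_sum \<sigma> N x y \<odot> b) \<bullet> (kernel_sum \<sigma> N x' y \<odot> d)) * exp (- e * (norm y)\<^sup>2) \<partial>lborel)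
      \<longlonglongrightarrow> (\<integral>y. ((cft_kernel \<sigma> x y \<odot> b) \<bullet> (cft_kernel \<sigma> x' y \<odot> d)) * exp (- e * (norm y)\<^sup>2) \<partial>lborel)"
    and ?int
  proof -
    have 1: "(\<lambda>y. (kernel_sum \<sigma> N x y \<odot> b) \<bullet> (kernel_sum \<sigma> N x' y \<odot> d)) \<in> borel_measurable borel" for N
      using borel_measurable_pair_section(1)[OF borel_measurable_kernel_sum[of \<sigma> N]]
      by (intro borel_measurable_inner meas) simp_all
    note 2 = bound[OF kernel_sum_bound kernel_sum_bound]
    have 3: "(\<lambda>N. (kernel_sum \<sigma> N x y \<odot> b) \<bullet> (kernel_sum \<sigma> N x' y \<odot> d)) \<longlonglongrightarrow> (cft_kernel \<sigma> x y \<odot> b) \<bullet> (cft_kernel \<sigma> x' y \<odot> d)" for y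
      by (intro tendsto_inner bounded_linear.tendsto[OF bl] kernel_sum_LIMSEQ)
    show "(\<lambda>N. \<integral>y. ((kernel_sum \<sigma> N x y \<odot> b) \<bullet> (kernel_sum \<sigma> N x' y \<odot> d)) * exp (- e * (norm y)\<^sup>2) \<partial>lborel)
      \<longlonglongrightarrow> (\<integral>y. ((cft_kernel \<sigma> x y \<odot> b) \<bullet> (cft_kernel \<sigma> x' y \<odot> d)) * exp (- e * (norm y)\<^sup>2) \<partial>lborel)" "?int"
      using gaussian_dominated_convergence[OF e 1 2 3] by blast+
  qed
  have one: "(c *s cl_basis {}) \<odot> v = c *s v" for c and v :: "complex ^ ('m set)"
    by (simp add: cl_mult_smult_left cl_mult_one_left)
  have P: "(\<lambda>N. \<integral>y. ((plane_sum N x y \<odot> b) \<bullet> (plane_sum N x' y \<odot> d)) * exp (- e * (norm y)\<^sup>2) \<partial>lborel)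
      \<longlonglongrightarrow> (\<integral>y. ((exp (- \<i> * complex_of_real (x \<bullet> y)) *s b) \<bullet> (exp (- \<i> * complex_of_real (x' \<bullet> y)) *s d)) * exp (- e * (norm y)\<^sup>2) \<partial>lborel)"
  proof -
    have pm: "(\<lambda>y. plane_sum N z y) \<in> borel_measurable borel" for N and z :: "(real, 'm) vec"
      unfolding plane_sum_def
      by (intro borel_measurable_continuous_onI continuous_on_sum continuous_smult_complex
          continuous_on_polymonial_function cl_form_polynomial[OF cl_form_power])
    have 1: "(\<lambda>y. (plane_sum N x y \<odot> b) \<bullet> (plane_sum N x' y \<odot> d)) \<in> borel_measurable borel" for N
      by (intro borel_measurable_inner meas pm)
    have "norm (plane_sum N z y) \<le> exp (1 * norm z * norm y)" for N z and y :: "(real, 'm) vec"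
      using plane_sum_bound[of N z y] by simp
    note 2 = bound[OF this this]
    have 3: "(\<lambda>N. (plane_sum N x y \<odot> b) \<bullet> (plane_sum N x' y \<odot> d)) \<longlonglongrightarrow>
       (exp (- \<i> * complex_of_real (x \<bullet> y)) *s b) \<bullet> (exp (- \<i> * complex_of_real (x' \<bullet> y)) *s d)" for y
      using tendsto_inner[OF bounded_linear.tendsto[OF bl[of b] plane_sum_LIMSEQ[of x y]]
          bounded_linear.tendsto[OF bl[of d] plane_sum_LIMSEQ[of x' y]]] by (simp only: one)
    show ?thesis by (rule gaussian_dominated_convergence(1)[OF e 1 2 3])
  qed
  show ?eq using LIMSEQ_unique[OF K[unfolded kernel_sum_isometry[OF e]] P] .
  show ?int by fact
qed

text \<open>As \<open>b\<close> and \<open>d\<close> are real, only the cosine of the phase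
  difference survives in the real inner product, and its Gaussian integral is a multiple of
  \<open>heat a\<close>. The factor \<open>(2 * pi) powr CARD('m)\<close> will cancel against the
  normalisation of \<open>cft\<close>.\<close>

lemma cft_kernel_gaussian:
  fixes x x' :: "real ^ 'm::{finite,linorder}"
  assumes a: "a > 0"
  shows "(\<integral>y. ((cft_kernel \<sigma> x y \<odot> cl_complexify b) \<bullet> (cft_kernel \<sigma> x' y \<odot> cl_complexify d)) * exp (- (1 / (4 * a)) * (norm y)\<^sup>2) \<partial>lborel)
    = (2 * pi) powr CARD('m) * (heat a (x' - x) * (b \<bullet> d))"
proof -
  have "(exp (- \<i> * complex_of_real (x \<bullet> y)) *s cl_complexify b) \<bullet> (exp (- \<i> * complex_of_real (x' \<bullet> y)) *s cl_complexify d) =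
     cos ((x' - x) \<bullet> y) * (b \<bullet> d)" for y
  proof -
    have "exp (- (\<i> * complex_of_real t)) = cis (- t)" for t by (simp add: cis_conv_exp)
    then have "(exp (- \<i> * complex_of_real (x \<bullet> y)) * complex_of_real s) \<bullet> (exp (- \<i> * complex_of_real (x' \<bullet> y)) * complex_of_real t) =
       cos ((x' - x) \<bullet> y) * (s * t)" for s t
      by (simp add: inner_complex_def inner_diff_left cos_diff algebra_simps)
    then show ?thesis by (simp add: inner_vec_def cl_complexify_def sum_distrib_left)
  qed
  then have "(\<integral>y. ((cft_kernel \<sigma> x y \<odot> cl_complexify b) \<bullet> (cft_kernel \<sigma> x' y \<odot> cl_complexify d)) * exp (- (1 / (4 * a)) * (norm y)\<^sup>2) \<partial>lborel)
     = (b \<bullet> d) * (\<integral>y. exp (- (1 / (4 * a)) * (norm y)\<^sup>2) * cos ((x' - x) \<bullet> y) \<partial>lborel)"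
    using a by (subst cft_kernel_isometry(1)) (simp_all add: mult_ac flip: integral_mult_right_zero)
  also have "\<dots> = (b \<bullet> d) * ((pi / (1 / (4 * a))) powr (CARD('m) / 2) * exp (- (norm (x' - x))\<^sup>2 / (4 * (1 / (4 * a)))))"
    using a by (subst gaussian_fourier(2)) simp_all
  also have "(pi / (1 / (4 * a))) powr (CARD('m) / 2) = (2 * pi) powr CARD('m) * (a / pi) powr (CARD('m) / 2)"
  proof -
    have "4 * pi\<^sup>2 = (2 * pi) powr 2" by (simp add: power_mult_distrib)
    then have "(4 * pi\<^sup>2) powr (CARD('m) / 2) = (2 * pi) powr CARD('m)"
      by (simp only: powr_powr) simp
    moreover have "pi / (1 / (4 * a)) = 4 * pi\<^sup>2 * (a / pi)"
      using a by (simp add: power2_eq_square)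
    moreover have "(4 * pi\<^sup>2 * (a / pi)) powr (CARD('m) / 2) = (4 * pi\<^sup>2) powr (CARD('m) / 2) * (a / pi) powr (CARD('m) / 2)"
      by (rule powr_mult)
    ultimately show ?thesis by (simp only:)
  qed
  finally show ?thesis using a by (simp add: heat_def mult_ac)
qed

section \<open>The transform of integrable and of Schwartz functions\<close>

lemma borel_measurable_cl_mult [measurable (raw)]:
  fixes f g :: "'a \<Rightarrow> complex ^ ('m::{finite,linorder} set)"
  assumes f: "f \<in> borel_measurable M" and g: "g \<in> borel_measurable M"
  shows "(\<lambda>z. f z \<odot> g z) \<in> borel_measurable M"
  by (rule borel_measurable_continuous_Pair[OF f g])
    (intro bounded_bilinear.continuous_on[OF bounded_bilinear_cl_mult] continuous_intros)

lemma bounded_linear_cl_complexify: "bounded_linear (cl_complexify :: real ^ ('m::{finite,linorder} set) \<Rightarrow> _)"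
proof (rule linear_conv_bounded_linear[THEN iffD1], rule linearI)
  show "cl_complexify (x + y) = cl_complexify x + cl_complexify y" for x y :: "real ^ ('m set)"
    by (simp add: cl_complexify_def vec_eq_iff)
  show "cl_complexify (r *\<^sub>R x) = r *\<^sub>R cl_complexify x" for r and x :: "real ^ ('m set)"
    unfolding scaleR_eq_smult by (simp add: cl_complexify_def vec_eq_iff)
qed

lemma borel_measurable_cl_complexify [measurable (raw)]:
  assumes "f \<in> borel_measurable M"
  shows "(\<lambda>z. cl_complexify (f z)) \<in> borel_measurable M"
  by (rule measurable_compose[OF assms borel_measurable_continuous_onI])
    (rule linear_continuous_on[OF bounded_linear_cl_complexify])

lemma borel_measurable_cft_kernel_compose [measurable (raw)]:
  fixes g h :: "'a \<Rightarrow> real ^ 'm::{finite,linorder}"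
  assumes g: "g \<in> borel_measurable M" and h: "h \<in> borel_measurable M"
  shows "(\<lambda>z. cft_kernel \<sigma> (g z) (h z)) \<in> borel_measurable M"
  using measurable_compose[OF borel_measurable_Pair[OF g h] borel_measurable_cft_kernel[of \<sigma>]] by simp

lemma integrable_product:
  fixes f :: "'a::euclidean_space \<Rightarrow> real" and g :: "'b::euclidean_space \<Rightarrow> real"
  assumes f: "integrable lborel f" and g: "integrable lborel g"
  shows "integrable (lborel \<Otimes>\<^sub>M lborel) (\<lambda>z. f (fst z) * g (snd z))"
proof (rule lborel_pair.Fubini_integrable)
  note [measurable] = borel_measurable_integrable[OF f] borel_measurable_integrable[OF g]
  show "(\<lambda>z. f (fst z) * g (snd z)) \<in> borel_measurable (lborel \<Otimes>\<^sub>M lborel)"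
    by measurable
  show "integrable lborel (\<lambda>x. \<integral>y. norm (f (fst (x, y)) * g (snd (x, y))) \<partial>lborel)"
    using f by (simp add: abs_mult)
  show "AE x in lborel. integrable lborel (\<lambda>y. f (fst (x, y)) * g (snd (x, y)))"
    using g by simp
qed

section \<open>The transform of an integrable function under a Gaussian weight\<close>

context
  fixes f :: "real ^ 'm::{finite,linorder} \<Rightarrow> real ^ ('m set)" and a \<sigma> :: real
  assumes f: "integrable lborel f" and a: "a > 0"
begin

private abbreviation w :: "real ^ 'm::{finite,linorder} \<Rightarrow> real" where
  "w y \<equiv> exp (- (1 / (4 * a)) * (norm y)\<^sup>2)"

private definition F :: "real ^ 'm::{finite,linorder} \<Rightarrow> real ^ 'm::{finite,linorder} \<Rightarrow> complex ^ ('m set)" where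
  "F x y = cft_kernel \<sigma> x y \<odot> cl_complexify (f x)"

private definition C :: real where "C = (2 * pi) powr CARD('m) * heat a (0 :: (real, 'm) vec)"

private lemma e: "1 / (4 * a) > 0" using a by simp

private lemma f_borel [measurable]: "f \<in> borel_measurable borel"
  using borel_measurable_integrable[OF f] by simp

private lemma F_measurable: "(\<lambda>z. F (fst z) (snd z)) \<in> borel_measurable (lborel \<Otimes>\<^sub>M lborel)"
  unfolding F_def by measurable

private lemma F_section [measurable]: "F x \<in> borel_measurable borel" "(\<lambda>x. F x y) \<in> borel_measurable borel"
  unfolding F_def[abs_def] by measurable

private lemma F_inner:
  "integrable lborel (\<lambda>y. (F x y \<bullet> F x' y) * w y)"
  "(\<integral>y. (F x y \<bullet> F x' y) * w y \<partial>lborel) = (2 * pi) powr CARD('m) * (heat a (x' - x) * (f x \<bullet> f x'))"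
  unfolding F_def by (rule cft_kernel_isometry(2)[OF e] cft_kernel_gaussian[OF a])+

text \<open>The diagonal case of the isometry. It controls the integrand by
  \<open>norm (f x)\<close> with a constant independent of \<open>x\<close>, whereas the pointwise
  kernel bound grows exponentially with \<open>norm x\<close>.\<close>

private lemma F_sq:
  "integrable lborel (\<lambda>y. (norm (F x y))\<^sup>2 * w y)"
  "(\<integral>y. (norm (F x y))\<^sup>2 * w y \<partial>lborel) = C * (norm (f x))\<^sup>2"
  unfolding power2_norm_eq_inner[of "F x _"] power2_norm_eq_inner[of "f x"] C_def
  using F_inner[of x x] by simp_all

private lemma F_zero: "f x = 0 \<Longrightarrow> F x y = 0"
  by (simp add: F_def linear_0[OF bounded_linear.linear[OF bounded_linear_cl_complexify]]
      bounded_bilinear.zero_right[OF bounded_bilinear_cl_mult])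

text \<open>Cauchy--Schwarz in the form of Young's inequality, with the weights \<open>t / s\<close>
  and \<open>s / t\<close> for which both halves become multiples of \<open>s * t\<close>.\<close>

private lemma weighted_bound:
  fixes u v :: "real ^ 'm::{finite,linorder} \<Rightarrow> real"
  assumes u: "integrable lborel (\<lambda>y. (u y)\<^sup>2 * w y)" "(\<integral>y. (u y)\<^sup>2 * w y \<partial>lborel) = A * s\<^sup>2"
    and v: "integrable lborel (\<lambda>y. (v y)\<^sup>2 * w y)" "(\<integral>y. (v y)\<^sup>2 * w y \<partial>lborel) = B * t\<^sup>2"
    and st: "s > 0" "t > 0" and [measurable]: "u \<in> borel_measurable borel" "v \<in> borel_measurable borel"
  shows "integrable lborel (\<lambda>y. \<bar>u y * v y\<bar> * w y)"
    and "(\<integral>y. \<bar>u y * v y\<bar> * w y \<partial>lborel) \<le> (A + B) / 2 * (s * t)"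
proof -
  have le: "\<bar>u y * v y\<bar> * w y \<le> t / (2 * s) * ((u y)\<^sup>2 * w y) + s / (2 * t) * ((v y)\<^sup>2 * w y)" for y
  proof -
    have "0 \<le> (t * \<bar>u y\<bar> - s * \<bar>v y\<bar>)\<^sup>2 / (2 * s * t)" using st by simp
    also have "\<dots> = t / (2 * s) * (u y)\<^sup>2 + s / (2 * t) * (v y)\<^sup>2 - \<bar>u y * v y\<bar>"
      using st by (simp add: power2_diff power_mult_distrib abs_mult field_simps power2_eq_square)
    finally have "\<bar>u y * v y\<bar> * w y \<le> (t / (2 * s) * (u y)\<^sup>2 + s / (2 * t) * (v y)\<^sup>2) * w y"
      by (intro mult_right_mono) auto
    then show ?thesis by (simp add: algebra_simps)
  qed
  have int: "integrable lborel (\<lambda>y. t / (2 * s) * ((u y)\<^sup>2 * w y) + s / (2 * t) * ((v y)\<^sup>2 * w y))"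
    by (intro Bochner_Integration.integrable_add integrable_mult_right u v)
  show 1: "integrable lborel (\<lambda>y. \<bar>u y * v y\<bar> * w y)"
    by (rule Bochner_Integration.integrable_bound[OF int]) (use le in \<open>auto intro: order_trans[OF _ abs_ge_self]\<close>)
  have "(\<integral>y. \<bar>u y * v y\<bar> * w y \<partial>lborel) \<le> (\<integral>y. t / (2 * s) * ((u y)\<^sup>2 * w y) + s / (2 * t) * ((v y)\<^sup>2 * w y) \<partial>lborel)"
    by (rule integral_mono[OF 1 int le])
  also have "\<dots> = t / (2 * s) * (A * s\<^sup>2) + s / (2 * t) * (B * t\<^sup>2)"
    unfolding Bochner_Integration.integral_add[OF integrable_mult_right[OF u(1)] integrable_mult_right[OF v(1)]]
      integral_mult_right_zero u(2) v(2) ..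
  also have "\<dots> = (A + B) / 2 * (s * t)"
    using st by (simp add: field_simps power2_eq_square)
  finally show "(\<integral>y. \<bar>u y * v y\<bar> * w y \<partial>lborel) \<le> (A + B) / 2 * (s * t)" .
qed

private lemma F_norm:
  "integrable lborel (\<lambda>y. norm (F x y) * w y)"
  "(\<integral>y. norm (F x y) * w y \<partial>lborel) \<le> (C + (\<integral>y. w y \<partial>lborel)) / 2 * norm (f x)"
proof (atomize (full), cases "f x = 0")
  case False
  have "integrable lborel (\<lambda>y. 1\<^sup>2 * w y)" using gaussian_fourier(1)[OF e, where 'a = "(real, 'm) vec"] by simp
  from weighted_bound[OF F_sq[of x] this, of "\<integral>y. w y \<partial>lborel" 1] False
  show "integrable lborel (\<lambda>y. norm (F x y) * w y) \<and>
     (\<integral>y. norm (F x y) * w y \<partial>lborel) \<le> (C + (\<integral>y. w y \<partial>lborel)) / 2 * norm (f x)" by simp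
qed (simp add: F_zero)

private lemma F_prod:
  "integrable lborel (\<lambda>y. norm (F x y) * norm (F x' y) * w y)"
  "(\<integral>y. norm (F x y) * norm (F x' y) * w y \<partial>lborel) \<le> C * (norm (f x) * norm (f x'))"
proof (atomize (full), cases "f x = 0 \<or> f x' = 0")
  case False
  with weighted_bound[OF F_sq[of x] F_sq[of x']]
  show "integrable lborel (\<lambda>y. norm (F x y) * norm (F x' y) * w y) \<and>
     (\<integral>y. norm (F x y) * norm (F x' y) * w y \<partial>lborel) \<le> C * (norm (f x) * norm (f x'))" by simp
qed (auto simp: F_zero)

text \<open>With the weight, the integrand is integrable in both variables jointly by
  \<open>F_norm\<close>. Fubini gives integrability in \<open>x\<close> for almost every
  \<open>y\<close>, and there the positive weight can be divided out.\<close>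

lemma cft_integrable: "AE y in lborel. integrable lborel (\<lambda>x. cft_kernel \<sigma> x y \<odot> cl_complexify (f x))"
proof -
  have "integrable (lborel \<Otimes>\<^sub>M lborel) (\<lambda>z. w (snd z) *\<^sub>R F (fst z) (snd z))"
  proof (rule lborel_pair.Fubini_integrable)
    note [measurable] = F_measurable
    show m: "(\<lambda>z. w (snd z) *\<^sub>R F (fst z) (snd z)) \<in> borel_measurable (lborel \<Otimes>\<^sub>M lborel)" by measurable
    show "AE x in lborel. integrable lborel (\<lambda>y. w (snd (x, y)) *\<^sub>R F (fst (x, y)) (snd (x, y)))"
    proof (rule AE_I2)
      fix x
      show "integrable lborel (\<lambda>y. w (snd (x, y)) *\<^sub>R F (fst (x, y)) (snd (x, y)))"
        by (rule Bochner_Integration.integrable_bound[OF F_norm(1)[of x]]) (auto simp: mult.commute)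
    qed
    have m2: "(\<lambda>x. \<integral>y. norm (w (snd (x, y)) *\<^sub>R F (fst (x, y)) (snd (x, y))) \<partial>lborel) \<in> borel_measurable lborel"
      using m by measurable
    show "integrable lborel (\<lambda>x. \<integral>y. norm (w (snd (x, y)) *\<^sub>R F (fst (x, y)) (snd (x, y))) \<partial>lborel)"
    proof (rule Bochner_Integration.integrable_bound[OF _ m2])
      show "integrable lborel (\<lambda>x. (C + (\<integral>y. w y \<partial>lborel)) / 2 * norm (f x))"
        using f by (intro integrable_mult_right integrable_norm)
      show "AE x in lborel. norm (\<integral>y. norm (w (snd (x, y)) *\<^sub>R F (fst (x, y)) (snd (x, y))) \<partial>lborel)
          \<le> norm ((C + (\<integral>y. w y \<partial>lborel)) / 2 * norm (f x))"
      proof (rule AE_I2)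
        fix x
        have "0 \<le> (\<integral>y. norm (F x y) * w y \<partial>lborel)" by (rule Bochner_Integration.integral_nonneg) simp
        with F_norm(2)[of x] show "norm (\<integral>y. norm (w (snd (x, y)) *\<^sub>R F (fst (x, y)) (snd (x, y))) \<partial>lborel)
          \<le> norm ((C + (\<integral>y. w y \<partial>lborel)) / 2 * norm (f x))"
          by (simp add: mult.commute)
      qed
    qed
  qed
  from lborel_pair.AE_integrable_snd[of "\<lambda>x y. w y *\<^sub>R F x y"] this
  have "AE y in lborel. integrable lborel (\<lambda>x. w y *\<^sub>R F x y)"
    by (simp add: case_prod_unfold)
  then show ?thesis
  proof eventually_elim
    case (elim y)
    then have "integrable lborel (\<lambda>x. (1 / w y) *\<^sub>R (w y *\<^sub>R F x y))" by (rule integrable_scaleR_right)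
    then show ?case by (simp add: F_def)
  qed
qed

lemma cft_eq_lborel:
  "cft \<sigma> f y = ((2 * pi) powr (- real CARD('m) / 2)) *\<^sub>R (\<integral>x. cft_kernel \<sigma> x y \<odot> cl_complexify (f x) \<partial>lborel)"
proof -
  have "(\<lambda>x. cft_kernel \<sigma> x y \<odot> cl_complexify (f x)) \<in> borel_measurable lborel" by measurable
  then show ?thesis unfolding cft_def by (simp add: integral_completion)
qed

lemma borel_measurable_cft: "cft \<sigma> f \<in> borel_measurable borel"
proof -
  have "(\<lambda>y. \<integral>x. F x y \<partial>lborel) \<in> borel_measurable lborel"
    by (rule lborel.borel_measurable_lebesgue_integral) (simp add: F_def case_prod_unfold)
  then show ?thesis unfolding cft_eq_lborel F_def by simp
qed

text \<open>The squared norm of the integral over \<open>x\<close> is a double integral over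
  \<open>x\<close> and \<open>x'\<close>. Integrating over \<open>y\<close> first makes the isometry
  applicable; \<open>F_prod\<close> supplies the majorant that justifies the exchange.\<close>

lemma cft_gaussian_norm:
  "integrable lborel (\<lambda>y. (norm (cft \<sigma> f y))\<^sup>2 * exp (- (1 / (4 * a)) * (norm y)\<^sup>2))"
  "(\<integral>y. (norm (cft \<sigma> f y))\<^sup>2 * exp (- (1 / (4 * a)) * (norm y)\<^sup>2) \<partial>lborel) =
   (\<integral>z. heat a (snd z - fst z) * (f (fst z) \<bullet> f (snd z)) \<partial>(lborel \<Otimes>\<^sub>M lborel))"
proof -
  define G where "G z y = (F (fst z) y \<bullet> F (snd z) y) * w y" for z y
  have mG: "case_prod G \<in> borel_measurable (lborel \<Otimes>\<^sub>M lborel)"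
  proof -
    have m: "(\<lambda>p :: ((real, 'm) vec \<times> (real, 'm) vec) \<times> (real, 'm) vec. fst (fst p)) \<in> borel_measurable borel"
      "(\<lambda>p :: ((real, 'm) vec \<times> (real, 'm) vec) \<times> (real, 'm) vec. snd (fst p)) \<in> borel_measurable borel"
      "(\<lambda>p :: ((real, 'm) vec \<times> (real, 'm) vec) \<times> (real, 'm) vec. snd p) \<in> borel_measurable borel"
      by (intro borel_measurable_continuous_onI continuous_intros)+
    have wm: "w \<in> borel_measurable borel" by measurable
    show ?thesis
      unfolding G_def[abs_def] F_def case_prod_unfold lborel_prod measurable_lborel2
      by (intro borel_measurable_times borel_measurable_inner borel_measurable_cl_mult
          borel_measurable_cft_kernel_compose borel_measurable_cl_complexify m
          measurable_compose[OF _ f_borel] measurable_compose[OF _ wm])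
  qed
  have normG: "\<bar>G z y\<bar> \<le> norm (F (fst z) y) * norm (F (snd z) y) * w y" for z y
    unfolding G_def by (simp add: abs_mult Cauchy_Schwarz_ineq2 mult_right_mono)
  have intGy: "integrable lborel (G z)" for z
    unfolding G_def by (rule F_inner)
  have intG: "integrable (lborel \<Otimes>\<^sub>M lborel) (case_prod G)"
  proof (rule lborel_pair.Fubini_integrable[OF mG])
    show "AE z in lborel. integrable lborel (\<lambda>y. case_prod G (z, y))"
      using intGy by simp
    have m2: "(\<lambda>z. \<integral>y. norm (case_prod G (z, y)) \<partial>lborel) \<in> borel_measurable lborel"
      using mG by measurable
    show "integrable lborel (\<lambda>z. \<integral>y. norm (case_prod G (z, y)) \<partial>lborel)"
    proof (rule Bochner_Integration.integrable_bound[OF _ m2])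
      show "integrable lborel (\<lambda>z::((real, 'm) vec \<times> (real, 'm) vec). C * (norm (f (fst z)) * norm (f (snd z))))"
        unfolding lborel_prod[symmetric]
        using f by (intro integrable_mult_right integrable_product[of "\<lambda>x. norm (f x)" "\<lambda>x. norm (f x)"] integrable_norm)
      show "AE z in lborel. norm (\<integral>y. norm (case_prod G (z, y)) \<partial>lborel) \<le> norm (C * (norm (f (fst z)) * norm (f (snd z))))"
      proof (rule AE_I2)
        fix z :: "(real, 'm) vec \<times> (real, 'm) vec"
        have "(\<integral>y. \<bar>G z y\<bar> \<partial>lborel) \<le> (\<integral>y. norm (F (fst z) y) * norm (F (snd z) y) * w y \<partial>lborel)"
          by (intro integral_mono integrable_abs intGy F_prod(1) normG)
        also note F_prod(2)
        finally show "norm (\<integral>y. norm (case_prod G (z, y)) \<partial>lborel) \<le> norm (C * (norm (f (fst z)) * norm (f (snd z))))"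
          by simp
      qed
    qed
  qed
  have "AE y in lborel. (\<integral>z. G z y \<partial>lborel) = w y * (norm (\<integral>x. F x y \<partial>lborel))\<^sup>2"
    using lborel_pair.AE_integrable_snd[OF intG] cft_integrable
  proof eventually_elim
    case (elim y)
    have i: "integrable lborel (\<lambda>x. F x y)" using elim(2) by (simp add: F_def)
    have g: "integrable (lborel \<Otimes>\<^sub>M lborel) (\<lambda>(x, x'). G (x, x') y)"
      using elim(1) by (simp add: lborel_prod case_prod_unfold)
    have "(\<integral>z. G z y \<partial>lborel) = (\<integral>x. (\<integral>x'. G (x, x') y \<partial>lborel) \<partial>lborel)"
      by (subst lborel_pair.integral_fst[OF g]) (simp add: lborel_prod case_prod_unfold)
    also have "\<dots> = (\<integral>x. (F x y \<bullet> (\<integral>x. F x y \<partial>lborel)) * w y \<partial>lborel)"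
      using i by (simp add: G_def)
    also have "\<dots> = w y * (norm (\<integral>x. F x y \<partial>lborel))\<^sup>2"
      using i by (simp add: power2_norm_eq_inner)
    finally show ?case .
  qed
  note AE = this
  \<comment> \<open>The square of the normalising constant of \<open>cft\<close>; it cancels the
    power of \<open>2 * pi\<close> in \<open>F_inner\<close>.\<close>
  define c0 where "c0 = (2 * pi) powr (- real CARD('m))"
  have nc: "(norm (cft \<sigma> f y))\<^sup>2 * w y = c0 * (w y * (norm (\<integral>x. F x y \<partial>lborel))\<^sup>2)" for y
  proof -
    have "((2 * pi) powr (- real CARD('m) / 2))\<^sup>2 = c0"
      unfolding c0_def power2_eq_square by (simp add: powr_add[symmetric])
    then show ?thesis by (simp add: cft_eq_lborel F_def power_mult_distrib)
  qed
  have AE': "AE y in lborel. (norm (cft \<sigma> f y))\<^sup>2 * w y = c0 * (\<integral>z. G z y \<partial>lborel)"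
    unfolding nc using AE by eventually_elim (simp only:)
  have m3: "(\<lambda>y. (norm (cft \<sigma> f y))\<^sup>2 * w y) \<in> borel_measurable lborel"
    using borel_measurable_cft by measurable
  have i3: "integrable lborel (\<lambda>y. c0 * (\<integral>z. G z y \<partial>lborel))"
    by (intro integrable_mult_right lborel_pair.integrable_snd[OF intG])
  show "integrable lborel (\<lambda>y. (norm (cft \<sigma> f y))\<^sup>2 * w y)"
    using i3 by (rule integrable_cong_AE_imp[OF _ m3]) (use AE' in eventually_elim, simp)
  have "(\<integral>y. (norm (cft \<sigma> f y))\<^sup>2 * w y \<partial>lborel) = (\<integral>y. c0 * (\<integral>z. G z y \<partial>lborel) \<partial>lborel)"
    by (rule integral_cong_AE[OF m3 borel_measurable_integrable[OF i3] AE'])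
  also have "\<dots> = c0 * (\<integral>z. (\<integral>y. G z y \<partial>lborel) \<partial>lborel)"
    by (simp add: lborel_pair.Fubini_integral[OF intG])
  also have "\<dots> = (c0 * (2 * pi) powr CARD('m)) * (\<integral>z. heat a (snd z - fst z) * (f (fst z) \<bullet> f (snd z)) \<partial>lborel)"
    unfolding G_def F_inner by simp
  also have "c0 * (2 * pi) powr CARD('m) = 1"
    unfolding c0_def by (simp add: powr_add[symmetric])
  finally show "(\<integral>y. (norm (cft \<sigma> f y))\<^sup>2 * w y \<partial>lborel) =
   (\<integral>z. heat a (snd z - fst z) * (f (fst z) \<bullet> f (snd z)) \<partial>(lborel \<Otimes>\<^sub>M lborel))"
    by (simp add: lborel_prod)
qed

end

section \<open>Schwartz functions: closure under differences, integrability, Lipschitz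
  bounds\<close>

lemma integrable_inverse_square_prod:
  "integrable lborel (\<lambda>x::'a::euclidean_space. \<Prod>b\<in>Basis. inverse (1 + (x \<bullet> b)\<^sup>2))"
proof -
  have "integrable lborel (\<lambda>t::real. inverse (1 + t\<^sup>2))"
    using integrable_inverse_1_plus_square unfolding set_integrable_def by simp
  then show ?thesis by (rule integral_lborel_prod(1))
qed

lemma schwartz_fold:
  assumes "schwartz f"
  shows "fold partial_derivative ks f differentiable at x"
    and "\<exists>B. \<forall>x. norm x ^ N * norm (fold partial_derivative ks f x) \<le> B"
  using assms unfolding schwartz_def bounded_iff by (auto simp: abs_mult)

lemma schwartz_differentiable: "schwartz f \<Longrightarrow> f differentiable at x"
  using schwartz_fold(1)[of f "[]"] by simp

lemma schwartz_partial: "schwartz f \<Longrightarrow> schwartz (partial_derivative k f)"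
  unfolding schwartz_def by (metis fold_simps(2))

lemma partial_derivative_diff:
  assumes "g differentiable (at y)" "h differentiable (at y)"
  shows "partial_derivative k (\<lambda>z. g z - h z) y = partial_derivative k g y - partial_derivative k h y"
  unfolding partial_derivative_def[of k g] partial_derivative_def[of k h]
  by (subst partial_derivative_eq[OF has_derivative_diff[OF assms[THEN has_derivative_partial]]]) simp

lemma schwartz_diff:
  fixes f g :: "real ^ 'm \<Rightarrow> 'b::real_normed_vector"
  assumes f: "schwartz f" and g: "schwartz g"
  shows "schwartz (\<lambda>x. f x - g x)"
proof -
  have eq: "fold partial_derivative ks (\<lambda>x. f x - g x) = (\<lambda>x. fold partial_derivative ks f x - fold partial_derivative ks g x)"
    if "schwartz f" "schwartz g" for ks and f g :: "(real, 'm) vec \<Rightarrow> 'b"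
    using that
  proof (induction ks arbitrary: f g)
    case (Cons k ks)
    have "partial_derivative k (\<lambda>x. f x - g x) = (\<lambda>x. partial_derivative k f x - partial_derivative k g x)"
      using Cons.prems by (intro ext partial_derivative_diff schwartz_differentiable)
    then show ?case using Cons.IH[OF Cons.prems[THEN schwartz_partial]] by simp
  qed simp
  show ?thesis
    unfolding schwartz_def eq[OF f g] bounded_iff
  proof (intro allI conjI)
    fix ks :: "'m list" and x and N :: nat
    show "(\<lambda>x. fold partial_derivative ks f x - fold partial_derivative ks g x) differentiable at x"
      by (intro differentiable_diff schwartz_fold f g)
    obtain A B where "\<forall>x. norm x ^ N * norm (fold partial_derivative ks f x) \<le> A"
      "\<forall>x. norm x ^ N * norm (fold partial_derivative ks g x) \<le> B"
      using schwartz_fold(2)[OF f] schwartz_fold(2)[OF g] by meson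
    then have "norm x ^ N * norm (fold partial_derivative ks f x - fold partial_derivative ks g x) \<le> A + B" for x
      using mult_left_mono[OF norm_triangle_ineq4[of "fold partial_derivative ks f x" "fold partial_derivative ks g x"], of "norm x ^ N"]
      by (smt (verit) distrib_left norm_ge_zero zero_le_power)
    then show "\<exists>a. \<forall>x\<in>range (\<lambda>x. norm x ^ N *\<^sub>R (fold partial_derivative ks f x - fold partial_derivative ks g x)). norm x \<le> a"
      by (intro exI[of _ "A + B"]) auto
  qed
qed

lemma schwartz_continuous: "schwartz f \<Longrightarrow> continuous_on UNIV f"
  by (intro differentiable_imp_continuous_on) (simp add: differentiable_on_def schwartz_differentiable)

lemma schwartz_borel_measurable: "schwartz f \<Longrightarrow> f \<in> borel_measurable borel"
  by (intro borel_measurable_continuous_onI schwartz_continuous)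

lemma schwartz_bounded:
  assumes "schwartz f" shows "\<exists>B. \<forall>x. norm (f x) \<le> B"
  using schwartz_fold(2)[OF assms, of 0 "[]"] by simp

text \<open>Comparison with a product of the functions \<open>inverse (1 + t\<^sup>2)\<close> of the
  single coordinates. Since \<open>(1 + (norm x)\<^sup>2) ^ n \<le> 2 ^ n * (1 + norm x ^ (2 *
  n))\<close>, the decay bounds with exponents \<open>0\<close> and \<open>2 * CARD('m)\<close>
  suffice.\<close>

lemma schwartz_integrable:
  fixes f :: "real ^ 'm \<Rightarrow> 'b::euclidean_space"
  assumes f: "schwartz f" shows "integrable lborel f"
proof -
  let ?n = "CARD('m)"
  obtain B0 B1 where B0: "\<And>x. norm (f x) \<le> B0" and B1: "\<And>x. norm x ^ (2 * ?n) * norm (f x) \<le> B1"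
    using schwartz_fold(2)[OF f, of 0 "[]"] schwartz_fold(2)[OF f, of "2 * ?n" "[]"] by auto
  have le: "norm (f x) \<le> 2 ^ ?n * (B0 + B1) * (\<Prod>b\<in>Basis. inverse (1 + (x \<bullet> b)\<^sup>2))" for x
  proof -
    have pos: "0 < (\<Prod>b\<in>Basis. 1 + (x \<bullet> b)\<^sup>2)" by (intro prod_pos) (auto intro: add_pos_nonneg)
    have "(x \<bullet> b)\<^sup>2 \<le> (norm x)\<^sup>2" if "b \<in> Basis" for b
      using Basis_le_norm[OF that, of x] by (intro abs_le_square_iff[THEN iffD1]) simp
    then have "(\<Prod>b\<in>Basis. 1 + (x \<bullet> b)\<^sup>2) \<le> (\<Prod>b\<in>(Basis :: (real, 'm) vec set). 1 + (norm x)\<^sup>2)"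
      by (intro prod_mono) auto
    also have "\<dots> = (1 + (norm x)\<^sup>2) ^ ?n" by simp
    also have "\<dots> \<le> 2 ^ ?n * (1 + norm x ^ (2 * ?n))"
    proof (cases "norm x \<le> 1")
      case True
      then have "(1 + (norm x)\<^sup>2) ^ ?n \<le> 2 ^ ?n"
        by (intro power_mono) (auto simp: power_le_one)
      also have "\<dots> \<le> 2 ^ ?n * (1 + norm x ^ (2 * ?n))" by simp
      finally show ?thesis .
    next
      case False
      then have "1 \<le> (norm x)\<^sup>2" by (simp add: one_le_power)
      then have "(1 + (norm x)\<^sup>2) ^ ?n \<le> (2 * (norm x)\<^sup>2) ^ ?n"
        by (intro power_mono) auto
      also have "\<dots> \<le> 2 ^ ?n * (1 + norm x ^ (2 * ?n))" by (simp add: power_mult_distrib power_mult)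
      finally show ?thesis .
    qed
    finally have "(\<Prod>b\<in>Basis. 1 + (x \<bullet> b)\<^sup>2) * norm (f x) \<le> 2 ^ ?n * (1 + norm x ^ (2 * ?n)) * norm (f x)"
      by (rule mult_right_mono) simp
    also have "\<dots> \<le> 2 ^ ?n * (B0 + B1)"
      using mult_left_mono[OF add_mono[OF B0[of x] B1[of x]], of "2 ^ ?n"] by (simp add: algebra_simps)
    finally have "norm (f x) \<le> 2 ^ ?n * (B0 + B1) / (\<Prod>b\<in>Basis. 1 + (x \<bullet> b)\<^sup>2)"
      using pos by (simp add: pos_le_divide_eq mult.commute)
    then show ?thesis by (simp add: prod_inversef[symmetric] divide_inverse o_def)
  qed
  show ?thesis
  proof (rule Bochner_Integration.integrable_bound)
    show "integrable lborel (\<lambda>x :: (real, 'm) vec. 2 ^ ?n * (B0 + B1) * (\<Prod>b\<in>Basis. inverse (1 + (x \<bullet> b)\<^sup>2)))"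
      by (intro integrable_mult_right integrable_inverse_square_prod)
    show "AE x in lborel. norm (f x) \<le> norm (2 ^ ?n * (B0 + B1) * (\<Prod>b\<in>Basis. inverse (1 + (x \<bullet> b)\<^sup>2)))"
      using le by (auto intro: order_trans[OF _ abs_ge_self])
  qed (simp add: schwartz_borel_measurable[OF f])
qed

lemma schwartz_integrable_sq:
  fixes f :: "real ^ 'm \<Rightarrow> 'b::euclidean_space"
  assumes f: "schwartz f" shows "integrable lborel (\<lambda>x. (norm (f x))\<^sup>2)"
proof -
  obtain B where B: "\<And>x. norm (f x) \<le> B" using schwartz_bounded[OF f] by auto
  note [measurable] = schwartz_borel_measurable[OF f]
  show ?thesis
  proof (rule Bochner_Integration.integrable_bound)
    show "integrable lborel (\<lambda>x. B * norm (f x))"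
      by (intro integrable_mult_right integrable_norm schwartz_integrable f)
    show "AE x in lborel. norm ((norm (f x))\<^sup>2) \<le> norm (B * norm (f x))"
      using B by (auto simp: power2_eq_square intro!: mult_right_mono order_trans[OF _ abs_ge_self])
  qed measurable
qed

lemma schwartz_lipschitz:
  fixes f :: "real ^ 'm \<Rightarrow> 'b::euclidean_space"
  assumes f: "schwartz f" shows "\<exists>L. \<forall>x y. norm (f x - f y) \<le> L * norm (x - y)"
proof -
  have "\<forall>k. \<exists>B. \<forall>x. norm (partial_derivative k f x) \<le> B"
    using schwartz_bounded[OF schwartz_partial[OF f]] by blast
  then obtain B where B: "\<And>k x. norm (partial_derivative k f x) \<le> B k" by metis
  have "norm (f x - f y) \<le> (\<Sum>k\<in>UNIV. B k) * norm (x - y)" for x y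
  proof (rule differentiable_bound[OF convex_UNIV])
    fix x
    have d: "(f has_derivative frechet_derivative f (at x)) (at x)"
      using schwartz_differentiable[OF f] by (simp add: frechet_derivative_works)
    then show "(f has_derivative frechet_derivative f (at x)) (at x within UNIV)" by simp
    have lin: "linear (frechet_derivative f (at x))" using d by (rule has_derivative_linear)
    have "norm (frechet_derivative f (at x) h) \<le> (\<Sum>k\<in>UNIV. B k) * norm h" for h
    proof -
      have h: "(\<Sum>k\<in>UNIV. h $ k *\<^sub>R axis k 1) = h"
        using basis_expansion[of h] by (simp add: scalar_mult_eq_scaleR)
      have "frechet_derivative f (at x) h = frechet_derivative f (at x) (\<Sum>k\<in>UNIV. h $ k *\<^sub>R axis k 1)"
        by (simp only: h)
      also have "\<dots> = (\<Sum>k\<in>UNIV. h $ k *\<^sub>R partial_derivative k f x)"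
        by (simp only: linear_sum[OF lin] linear_cmul[OF lin] partial_derivative_def)
      also have "norm \<dots> \<le> (\<Sum>k\<in>UNIV. norm h * B k)"
      proof (rule sum_norm_le)
        fix k
        show "norm (h $ k *\<^sub>R partial_derivative k f x) \<le> norm h * B k"
          using mult_mono[OF component_le_norm_cart[of h k] B[of k x]] by simp
      qed
      finally show ?thesis by (simp add: sum_distrib_left mult.commute)
    qed
    then show "onorm (frechet_derivative f (at x)) \<le> (\<Sum>k\<in>UNIV. B k)" by (rule onorm_le)
  qed auto
  then show ?thesis by blast
qed

section \<open>Averages over pairs of points with the heat kernel\<close>

lemma pair_translate_integral:
  fixes k :: "'a::euclidean_space \<Rightarrow> 'a \<Rightarrow> real"
  assumes m: "(\<lambda>z. k (fst z) (snd z)) \<in> borel_measurable borel"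
    and k: "\<And>x. integrable lborel (k x)" "\<And>x. (\<integral>u. \<bar>k x u\<bar> \<partial>lborel) \<le> K x" and K: "integrable lborel K"
  shows "integrable (lborel \<Otimes>\<^sub>M lborel) (\<lambda>z. k (fst z) (snd z - fst z))"
    and "(\<integral>z. k (fst z) (snd z - fst z) \<partial>(lborel \<Otimes>\<^sub>M lborel)) = (\<integral>x. (\<integral>u. k x u \<partial>lborel) \<partial>lborel)"
proof -
  have m1: "(\<lambda>z. k (fst z) (snd z - fst z)) \<in> borel_measurable borel"
    using measurable_compose[OF _ m, of "\<lambda>z. (fst z, snd z - fst z)" borel]
    by (simp add: borel_measurable_continuous_onI continuous_intros)
  have tr: "integrable lborel (\<lambda>x'. k x (x' - x))" "(\<integral>x'. k x (x' - x) \<partial>lborel) = (\<integral>u. k x u \<partial>lborel)"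
    "(\<integral>x'. \<bar>k x (x' - x)\<bar> \<partial>lborel) = (\<integral>u. \<bar>k x u\<bar> \<partial>lborel)" for x
    using integrable_lborel_translate[OF k(1)[of x], of "- x"]
      integral_lborel_translate[of "k x" "- x"] integral_lborel_translate[of "\<lambda>u. \<bar>k x u\<bar>" "- x"]
      borel_measurable_integrable[OF k(1)[of x]]
    by (simp_all add: add.commute[of "- x"])
  show int: "integrable (lborel \<Otimes>\<^sub>M lborel) (\<lambda>z. k (fst z) (snd z - fst z))"
  proof (rule lborel_pair.Fubini_integrable)
    show m2: "(\<lambda>z. k (fst z) (snd z - fst z)) \<in> borel_measurable (lborel \<Otimes>\<^sub>M lborel)"
      using m1 by (simp add: lborel_prod)
    show "AE x in lborel. integrable lborel (\<lambda>y. k (fst (x, y)) (snd (x, y) - fst (x, y)))"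
      using tr(1) by simp
    have m3: "(\<lambda>x. \<integral>y. norm (k (fst (x, y)) (snd (x, y) - fst (x, y))) \<partial>lborel) \<in> borel_measurable lborel"
      using m2 by measurable
    show "integrable lborel (\<lambda>x. \<integral>y. norm (k (fst (x, y)) (snd (x, y) - fst (x, y))) \<partial>lborel)"
      by (rule Bochner_Integration.integrable_bound[OF K m3])
        (use k(2) in \<open>auto simp: tr intro: order_trans[OF _ abs_ge_self]\<close>)
  qed
  show "(\<integral>z. k (fst z) (snd z - fst z) \<partial>(lborel \<Otimes>\<^sub>M lborel)) = (\<integral>x. (\<integral>u. k x u \<partial>lborel) \<partial>lborel)"
    using lborel_pair.integral_fst[of "\<lambda>x x'. k x (x' - x)"] int by (simp add: case_prod_unfold tr)
qed

lemma pair_swap_integral: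
  fixes h :: "'a::euclidean_space \<Rightarrow> 'a \<Rightarrow> real"
  assumes "integrable (lborel \<Otimes>\<^sub>M lborel) (\<lambda>z. h (fst z) (snd z))"
  shows "integrable (lborel \<Otimes>\<^sub>M lborel) (\<lambda>z. h (snd z) (fst z))"
    and "(\<integral>z. h (snd z) (fst z) \<partial>(lborel \<Otimes>\<^sub>M lborel)) = (\<integral>z. h (fst z) (snd z) \<partial>(lborel \<Otimes>\<^sub>M lborel))"
  using lborel_pair.integrable_product_swap[OF assms]
    lborel_pair.integral_product_swap[OF borel_measurable_integrable[OF assms]]
  by (simp_all add: case_prod_unfold)

text \<open>A nonlocal Dirichlet integral: for a Schwartz function, \<open>2 * a\<close> times it
  tends to the integral of the squared gradient as \<open>a\<close> grows. It asks for no
  derivatives and is finite for square integrable Borel functions.\<close>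

definition heat_energy :: "real \<Rightarrow> ('a::euclidean_space \<Rightarrow> 'b::euclidean_space) \<Rightarrow> real" where
  "heat_energy a f = (\<integral>z. heat a (snd z - fst z) * (norm (f (snd z) - f (fst z)))\<^sup>2 \<partial>(lborel \<Otimes>\<^sub>M lborel))"

context
  fixes f :: "'a::euclidean_space \<Rightarrow> 'b::euclidean_space" and a :: real
  assumes f: "f \<in> borel_measurable borel" "integrable lborel (\<lambda>x. (norm (f x))\<^sup>2)" and a: "a > 0"
begin

text \<open>The weight \<open>q\<close> is left free because several occur: \<open>1\<close> for the
  norms, the squared length in the uncertainty inequality, and a mixture of both for Schwartz
  functions.\<close>

lemma heat_pair_fst:
  assumes q: "q \<in> borel_measurable borel" "\<And>u. 0 \<le> q u" "integrable lborel (\<lambda>u. heat a u * q u)"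
  shows "integrable (lborel \<Otimes>\<^sub>M lborel) (\<lambda>z. heat a (snd z - fst z) * q (snd z - fst z) * (norm (f (fst z)))\<^sup>2)"
    and "(\<integral>z. heat a (snd z - fst z) * q (snd z - fst z) * (norm (f (fst z)))\<^sup>2 \<partial>(lborel \<Otimes>\<^sub>M lborel)) =
      (\<integral>u. heat a u * q u \<partial>lborel) * (\<integral>x. (norm (f x))\<^sup>2 \<partial>lborel)"
proof -
  let ?k = "\<lambda>x u. heat a u * q u * (norm (f x))\<^sup>2"
  have m: "(\<lambda>z. ?k (fst z) (snd z)) \<in> borel_measurable borel"
    unfolding borel_prod[symmetric] using f(1) q(1) by measurable
  note * = pair_translate_integral[of ?k "\<lambda>x. (\<integral>u. heat a u * q u \<partial>lborel) * (norm (f x))\<^sup>2", OF m]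
  show "integrable (lborel \<Otimes>\<^sub>M lborel) (\<lambda>z. heat a (snd z - fst z) * q (snd z - fst z) * (norm (f (fst z)))\<^sup>2)"
    using q f(2) by (intro *) (auto simp: abs_mult)
  show "(\<integral>z. heat a (snd z - fst z) * q (snd z - fst z) * (norm (f (fst z)))\<^sup>2 \<partial>(lborel \<Otimes>\<^sub>M lborel)) =
      (\<integral>u. heat a u * q u \<partial>lborel) * (\<integral>x. (norm (f x))\<^sup>2 \<partial>lborel)"
    using q f(2) by (subst *) (auto simp: abs_mult)
qed

lemma heat_pair_snd:
  assumes q: "q \<in> borel_measurable borel" "\<And>u. 0 \<le> q u" "integrable lborel (\<lambda>u. heat a u * q u)" "\<And>u. q (- u) = q u"
  shows "integrable (lborel \<Otimes>\<^sub>M lborel) (\<lambda>z. heat a (snd z - fst z) * q (snd z - fst z) * (norm (f (snd z)))\<^sup>2)"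
    and "(\<integral>z. heat a (snd z - fst z) * q (snd z - fst z) * (norm (f (snd z)))\<^sup>2 \<partial>(lborel \<Otimes>\<^sub>M lborel)) =
      (\<integral>u. heat a u * q u \<partial>lborel) * (\<integral>x. (norm (f x))\<^sup>2 \<partial>lborel)"
proof -
  have "heat a (x - y) * q (x - y) = heat a (y - x) * q (y - x)" for x y
    using heat_minus[of a "x - y"] q(4)[of "x - y"] by simp
  with pair_swap_integral[of "\<lambda>x y. heat a (y - x) * q (y - x) * (norm (f x))\<^sup>2", OF heat_pair_fst(1)[OF q(1-3)]]
    heat_pair_fst(2)[OF q(1-3)]
  show "integrable (lborel \<Otimes>\<^sub>M lborel) (\<lambda>z. heat a (snd z - fst z) * q (snd z - fst z) * (norm (f (snd z)))\<^sup>2)"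
    "(\<integral>z. heat a (snd z - fst z) * q (snd z - fst z) * (norm (f (snd z)))\<^sup>2 \<partial>(lborel \<Otimes>\<^sub>M lborel)) =
      (\<integral>u. heat a u * q u \<partial>lborel) * (\<integral>x. (norm (f x))\<^sup>2 \<partial>lborel)"
    by simp_all
qed

lemma borel_measurable_heat_pair:
  "(\<lambda>z. heat a (snd z - fst z)) \<in> borel_measurable (lborel \<Otimes>\<^sub>M lborel)"
  "(\<lambda>z. f (fst z)) \<in> borel_measurable (lborel \<Otimes>\<^sub>M lborel)"
  "(\<lambda>z. f (snd z)) \<in> borel_measurable (lborel \<Otimes>\<^sub>M lborel)"
  using f(1) by measurable

text \<open>Polarisation of the inner product. The heat kernel and \<open>q\<close> are even, so
  both points of a pair contribute the same integral.\<close>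

lemma heat_pair_diff_integrable:
  assumes q: "q \<in> borel_measurable borel" "\<And>u. 0 \<le> q u" "integrable lborel (\<lambda>u. heat a u * q u)" "\<And>u. q (- u) = q u"
  shows "integrable (lborel \<Otimes>\<^sub>M lborel) (\<lambda>z. heat a (snd z - fst z) * q (snd z - fst z) * (norm (f (snd z) - f (fst z)))\<^sup>2)"
    and "integrable (lborel \<Otimes>\<^sub>M lborel) (\<lambda>z. heat a (snd z - fst z) * q (snd z - fst z) * (f (fst z) \<bullet> f (snd z)))"
    and "(\<integral>z. heat a (snd z - fst z) * q (snd z - fst z) * (f (fst z) \<bullet> f (snd z)) \<partial>(lborel \<Otimes>\<^sub>M lborel)) =
      (\<integral>u. heat a u * q u \<partial>lborel) * (\<integral>x. (norm (f x))\<^sup>2 \<partial>lborel) -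
      (\<integral>z. heat a (snd z - fst z) * q (snd z - fst z) * (norm (f (snd z) - f (fst z)))\<^sup>2 \<partial>(lborel \<Otimes>\<^sub>M lborel)) / 2"
proof -
  let ?h = "\<lambda>z. heat a (snd z - fst z) * q (snd z - fst z)"
  note [measurable] = borel_measurable_heat_pair q(1) f(1)
  note 1 = heat_pair_fst[OF q(1-3)] and 2 = heat_pair_snd[OF q]
  have h0: "0 \<le> ?h z" for z using q(2) by simp
  have pw: "?h z * (f (fst z) \<bullet> f (snd z)) = (1/2) * (?h z * (norm (f (fst z)))\<^sup>2 + ?h z * (norm (f (snd z)))\<^sup>2
      - ?h z * (norm (f (snd z) - f (fst z)))\<^sup>2)" for z
    unfolding power2_norm_eq_inner by (simp add: inner_diff_left inner_diff_right inner_commute algebra_simps)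
  show 3: "integrable (lborel \<Otimes>\<^sub>M lborel) (\<lambda>z. ?h z * (norm (f (snd z) - f (fst z)))\<^sup>2)"
  proof (rule Bochner_Integration.integrable_bound)
    show "integrable (lborel \<Otimes>\<^sub>M lborel) (\<lambda>z. 2 * (?h z * (norm (f (fst z)))\<^sup>2 + ?h z * (norm (f (snd z)))\<^sup>2))"
      by (intro integrable_mult_right Bochner_Integration.integrable_add 1 2)
    have "(norm (u - v))\<^sup>2 \<le> 2 * ((norm v)\<^sup>2 + (norm u)\<^sup>2)" for u v :: 'b
      using power_mono[OF norm_triangle_ineq4[of u v], of 2] sum_squares_ge_zero[of "norm u - norm v" 0]
      by (simp add: power2_eq_square algebra_simps)
    then have "?h z * (norm (f (snd z) - f (fst z)))\<^sup>2 \<le> ?h z * (2 * ((norm (f (fst z)))\<^sup>2 + (norm (f (snd z)))\<^sup>2))" for z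
      using h0 by (intro mult_left_mono) auto
    then have "?h z * (norm (f (snd z) - f (fst z)))\<^sup>2 \<le> 2 * (?h z * (norm (f (fst z)))\<^sup>2 + ?h z * (norm (f (snd z)))\<^sup>2)" for z
      by (simp only: distrib_left mult.left_commute[of 2])
    then show "AE z in lborel \<Otimes>\<^sub>M lborel. norm (?h z * (norm (f (snd z) - f (fst z)))\<^sup>2) \<le>
        norm (2 * (?h z * (norm (f (fst z)))\<^sup>2 + ?h z * (norm (f (snd z)))\<^sup>2))"
      using h0 by (intro AE_I2) (simp add: abs_mult q(2))
  qed measurable
  show "integrable (lborel \<Otimes>\<^sub>M lborel) (\<lambda>z. ?h z * (f (fst z) \<bullet> f (snd z)))"
    unfolding pw by (intro integrable_mult_right Bochner_Integration.integrable_diff Bochner_Integration.integrable_add 1 2 3)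
  show "(\<integral>z. ?h z * (f (fst z) \<bullet> f (snd z)) \<partial>(lborel \<Otimes>\<^sub>M lborel)) =
      (\<integral>u. heat a u * q u \<partial>lborel) * (\<integral>x. (norm (f x))\<^sup>2 \<partial>lborel) -
      (\<integral>z. ?h z * (norm (f (snd z) - f (fst z)))\<^sup>2 \<partial>(lborel \<Otimes>\<^sub>M lborel)) / 2"
    unfolding pw integral_mult_right_zero
      Bochner_Integration.integral_diff[OF Bochner_Integration.integrable_add[OF 1(1) 2(1)] 3]
      Bochner_Integration.integral_add[OF 1(1) 2(1)] 1(2) 2(2)
    by simp
qed

end

lemma lebesgue_measurable_borel: "f \<in> borel_measurable borel \<Longrightarrow> f \<in> borel_measurable lebesgue"
  by (rule measurable_completion) simp

text \<open>Only one of the two factors of the squared increment is estimated by the Lipschitz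
  constant; the other is bounded by the sum of the two values, so that integrability of
  \<open>f\<close> closes the estimate. The rate is crude, but it makes the energy vanish as
  \<open>a\<close> tends to infinity.\<close>

lemma schwartz_heat_energy_bound:
  fixes f :: "real ^ 'm \<Rightarrow> 'b::euclidean_space"
  assumes f: "schwartz f"
  shows "\<exists>K. \<forall>a>0. heat_energy a f \<le> K / sqrt a"
proof -
  obtain L where L: "\<And>x y. norm (f x - f y) \<le> L * norm (x - y)"
    using schwartz_lipschitz[OF f] by blast
  have L0: "0 \<le> L"
    using order_trans[OF norm_ge_zero L[of "axis undefined 1" 0]] by (simp add: norm_axis_1)
  note [measurable] = schwartz_borel_measurable[OF f]
  \<comment> \<open>The square root brings \<open>norm (f x)\<close> into the form
    \<open>(norm (g x))\<^sup>2\<close> that \<open>heat_pair_fst\<close> and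
    \<open>heat_pair_snd\<close> require.\<close>
  define g where "g x = sqrt (norm (f x))" for x
  have g: "g \<in> borel_measurable borel" "integrable lborel (\<lambda>x. (norm (g x))\<^sup>2)"
    using schwartz_integrable[OF f] unfolding g_def by simp_all
  define K where "K = L * (1 + CARD('m) / 2) * (\<integral>x. norm (f x) \<partial>lborel)"
  have "heat_energy a f \<le> K / sqrt a" if a: "a > 0" for a
  proof -
    \<comment> \<open>By Young's inequality \<open>2 * norm u \<le> q u\<close>. The balance is
      right at length \<open>1 / sqrt a\<close>, the scale of \<open>heat a\<close>.\<close>
    define q where "q u = 1 / sqrt a + sqrt a * (norm u)\<^sup>2" for u :: "(real, 'm) vec"
    have sa: "0 < sqrt a" using a by simp
    have q1: "q \<in> borel_measurable borel" unfolding q_def by measurable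
    have q2: "0 \<le> q u" and q4: "q (- u) = q u" for u using sa by (auto simp: q_def)
    have qe: "heat a u * q u = (1 / sqrt a) * heat a u + sqrt a * (heat a u * (norm u)\<^sup>2)" for u
      by (simp add: q_def algebra_simps)
    have q3: "integrable lborel (\<lambda>u. heat a u * q u)"
      unfolding qe by (intro Bochner_Integration.integrable_add integrable_mult_right integrable_heat integrable_heat_norm_sq a)
    have q5: "(\<integral>u. heat a u * q u \<partial>lborel) = (1 + CARD('m) / 2) / sqrt a"
    proof -
      have "(\<integral>u. heat a (u::(real, 'm) vec) * q u \<partial>lborel) = 1 / sqrt a + sqrt a * (CARD('m) / (2 * a))"
        unfolding qe
        by (subst Bochner_Integration.integral_add) (use a in \<open>simp_all add: integrable_heat integrable_heat_norm_sq integral_heat integral_heat_norm_sq\<close>)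
      also have "sqrt a * (CARD('m) / (2 * a)) = CARD('m) / 2 / sqrt a"
        using a by (simp add: field_simps flip: power2_eq_square)
      finally show ?thesis by (simp add: add_divide_distrib)
    qed
    note 1 = heat_pair_fst[OF g a q1 q2 q3, unfolded q5] and 2 = heat_pair_snd[OF g a q1 q2 q3 q4, unfolded q5]
    have ng: "(norm (g x))\<^sup>2 = norm (f x)" for x by (simp add: g_def)
    have pw: "(norm (f y - f x))\<^sup>2 \<le> L / 2 * (q (y - x) * (norm (g x))\<^sup>2 + q (y - x) * (norm (g y))\<^sup>2)" for x y
    proof -
      have "0 \<le> (1 - sqrt a * norm (y - x))\<^sup>2 / sqrt a" using sa by simp
      also have "\<dots> = q (y - x) - 2 * norm (y - x)"
        using a by (simp add: q_def field_simps power2_eq_square)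
      finally have "norm (y - x) \<le> q (y - x) / 2" by simp
      then have "norm (f y - f x) \<le> L * (q (y - x) / 2)"
        using L[of y x] L0 by (meson mult_left_mono order_trans)
      then have "norm (f y - f x) * norm (f y - f x) \<le> L * (q (y - x) / 2) * (norm (f x) + norm (f y))"
        using norm_triangle_ineq4[of "f y" "f x"] L0 q2[of "y - x"] by (intro mult_mono) auto
      then show ?thesis unfolding ng by (simp add: power2_eq_square algebra_simps)
    qed
    have int: "integrable (lborel \<Otimes>\<^sub>M lborel) (\<lambda>z. L / 2 * (heat a (snd z - fst z) * q (snd z - fst z) * (norm (g (fst z)))\<^sup>2
       + heat a (snd z - fst z) * q (snd z - fst z) * (norm (g (snd z)))\<^sup>2))"
      by (intro integrable_mult_right Bochner_Integration.integrable_add 1(1) 2(1))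
    have "heat_energy a f \<le> (\<integral>z. L / 2 * (heat a (snd z - fst z) * q (snd z - fst z) * (norm (g (fst z)))\<^sup>2
       + heat a (snd z - fst z) * q (snd z - fst z) * (norm (g (snd z)))\<^sup>2) \<partial>(lborel \<Otimes>\<^sub>M lborel))"
      unfolding heat_energy_def
    proof (rule integral_mono'[OF int])
      fix z :: "(real, 'm) vec \<times> (real, 'm) vec"
      show "heat a (snd z - fst z) * (norm (f (snd z) - f (fst z)))\<^sup>2 \<le> L / 2 * (heat a (snd z - fst z) * q (snd z - fst z) * (norm (g (fst z)))\<^sup>2
       + heat a (snd z - fst z) * q (snd z - fst z) * (norm (g (snd z)))\<^sup>2)"
        using mult_left_mono[OF pw[of "snd z" "fst z"] heat_nonneg[of a "snd z - fst z"]]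
        by (simp add: algebra_simps)
      show "0 \<le> L / 2 * (heat a (snd z - fst z) * q (snd z - fst z) * (norm (g (fst z)))\<^sup>2
       + heat a (snd z - fst z) * q (snd z - fst z) * (norm (g (snd z)))\<^sup>2)"
        using L0 q2 by (intro mult_nonneg_nonneg add_nonneg_nonneg) auto
    qed
    also have "\<dots> = L / 2 * ((1 + CARD('m) / 2) / sqrt a * (\<integral>x. norm (f x) \<partial>lborel) + (1 + CARD('m) / 2) / sqrt a * (\<integral>x. norm (f x) \<partial>lborel))"
      unfolding integral_mult_right_zero Bochner_Integration.integral_add[OF 1(1) 2(1)] 1(2) 2(2) by (simp only: ng)
    also have "\<dots> = K / sqrt a" by (simp add: K_def)
    finally show ?thesis .
  qed
  then show ?thesis by blast
qed

section \<open>Plancherel's formula for Schwartz functions\<close>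

context
  fixes f :: "real ^ 'm::{finite,linorder} \<Rightarrow> real ^ ('m set)" and \<sigma> :: real
  assumes f: "schwartz f"
begin

lemma cft_schwartz_measurable: "cft \<sigma> f \<in> borel_measurable borel"
  by (rule borel_measurable_cft[OF schwartz_integrable[OF f] zero_less_one])

lemma cft_schwartz_gaussian:
  assumes a: "a > 0"
  shows "integrable lborel (\<lambda>y. (norm (cft \<sigma> f y))\<^sup>2 * exp (- (1 / (4 * a)) * (norm y)\<^sup>2))"
    and "(\<integral>y. (norm (cft \<sigma> f y))\<^sup>2 * exp (- (1 / (4 * a)) * (norm y)\<^sup>2) \<partial>lborel) =
      (\<integral>x. (norm (f x))\<^sup>2 \<partial>lborel) - heat_energy a f / 2"
  using cft_gaussian_norm[OF schwartz_integrable[OF f] a]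
    heat_pair_diff_integrable(3)[OF schwartz_borel_measurable[OF f] schwartz_integrable_sq[OF f] a, of "\<lambda>_. 1"]
  by (simp_all add: heat_energy_def integrable_heat[OF a] integral_heat[OF a])

text \<open>Along \<open>a = real (Suc n)\<close> the weights increase to 1, so monotone convergence
  applies to the weighted norms, while the heat energy tends to 0.\<close>

lemma cft_schwartz_norm: "l2_norm_sq (cft \<sigma> f) = l2_norm_sq f"
proof -
  note [measurable] = cft_schwartz_measurable
  define u where "u n y = (norm (cft \<sigma> f y))\<^sup>2 * exp (- (1 / (4 * real (Suc n))) * (norm y)\<^sup>2)" for n y
  obtain K where K: "\<And>a. a > 0 \<Longrightarrow> heat_energy a f \<le> K / sqrt a"
    using schwartz_heat_energy_bound[OF f] by blast
  have E0: "0 \<le> heat_energy a f" for a unfolding heat_energy_def by (rule Bochner_Integration.integral_nonneg) simp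
  have "(\<lambda>n. heat_energy (real (Suc n)) f) \<longlonglongrightarrow> 0"
  proof (rule tendsto_sandwich[OF _ _ tendsto_const])
    show "\<forall>\<^sub>F n in sequentially. 0 \<le> heat_energy (real (Suc n)) f" using E0 by simp
    show "\<forall>\<^sub>F n in sequentially. heat_energy (real (Suc n)) f \<le> K / sqrt (real (Suc n))"
      using K by simp
    show "(\<lambda>n. K / sqrt (real (Suc n))) \<longlonglongrightarrow> 0" by real_asymp
  qed
  then have "(\<lambda>n. (\<integral>x. (norm (f x))\<^sup>2 \<partial>lborel) - heat_energy (real (Suc n)) f / 2) \<longlonglongrightarrow> (\<integral>x. (norm (f x))\<^sup>2 \<partial>lborel) - 0 / 2"
    by (intro tendsto_intros) simp_all
  then have 1: "(\<lambda>n. ennreal (\<integral>y. u n y \<partial>lborel)) \<longlonglongrightarrow> ennreal (\<integral>x. (norm (f x))\<^sup>2 \<partial>lborel)"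
    using cft_schwartz_gaussian(2)[OF of_nat_0_less_iff[THEN iffD2, OF zero_less_Suc]]
    unfolding u_def by (intro tendsto_ennrealI) (simp only: diff_zero div_0)
  have 2: "(\<lambda>n. \<integral>\<^sup>+y. ennreal (u n y) \<partial>lborel) \<longlonglongrightarrow> (\<integral>\<^sup>+y. ennreal ((norm (cft \<sigma> f y))\<^sup>2) \<partial>lborel)"
  proof (rule nn_integral_LIMSEQ)
    show "incseq (\<lambda>n y. ennreal (u n y))"
    proof (intro incseq_SucI le_funI ennreal_leI)
      fix n and y :: "(real, 'm) vec"
      have "1 / (4 * real (Suc (Suc n))) \<le> 1 / (4 * real (Suc n))" by (intro divide_left_mono) auto
      then have "1 / (4 * real (Suc (Suc n))) * (norm y)\<^sup>2 \<le> 1 / (4 * real (Suc n)) * (norm y)\<^sup>2"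
        by (rule mult_right_mono) simp
      then show "u n y \<le> u (Suc n) y" unfolding u_def by (intro mult_left_mono) simp_all
    qed
    show "(\<lambda>n. ennreal (u n y)) \<longlonglongrightarrow> ennreal ((norm (cft \<sigma> f y))\<^sup>2)" for y
    proof (intro tendsto_ennrealI)
      have "(\<lambda>n. exp (- (1 / (4 * real (Suc n))) * (norm y)\<^sup>2)) \<longlonglongrightarrow> 1" by real_asymp
      from tendsto_mult[OF tendsto_const this] show "(\<lambda>n. u n y) \<longlonglongrightarrow> (norm (cft \<sigma> f y))\<^sup>2"
        unfolding u_def by simp
    qed
    show "(\<lambda>y. ennreal (u n y)) \<in> borel_measurable lborel" for n unfolding u_def by measurable
  qed
  have "(\<integral>\<^sup>+y. ennreal (u n y) \<partial>lborel) = ennreal (\<integral>y. u n y \<partial>lborel)" for n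
    using cft_schwartz_gaussian(1)[OF of_nat_0_less_iff[THEN iffD2, OF zero_less_Suc], of n]
    unfolding u_def by (rule nn_integral_eq_integral) simp
  with 1 2 have "(\<integral>\<^sup>+y. ennreal ((norm (cft \<sigma> f y))\<^sup>2) \<partial>lborel) = ennreal (\<integral>x. (norm (f x))\<^sup>2 \<partial>lborel)"
    by (simp add: LIMSEQ_unique)
  also have "\<dots> = (\<integral>\<^sup>+x. ennreal ((norm (f x))\<^sup>2) \<partial>lborel)"
    by (rule nn_integral_eq_integral[symmetric]) (simp_all add: schwartz_integrable_sq[OF f])
  finally show ?thesis by (simp add: l2_norm_sq_def nn_integral_completion)
qed

lemma schwartz_square_integrable: "square_integrable f" "square_integrable (cft \<sigma> f)"
proof -
  have "l2_norm_sq f < \<infinity>"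
    using schwartz_integrable_sq[OF f]
    by (simp add: l2_norm_sq_def nn_integral_completion nn_integral_eq_integral)
  then show "square_integrable f" "square_integrable (cft \<sigma> f)"
    unfolding square_integrable_def cft_schwartz_norm
    using lebesgue_measurable_borel[OF cft_schwartz_measurable]
      lebesgue_measurable_borel[OF schwartz_borel_measurable[OF f]] by simp_all
qed

end

text \<open>The equation is stated almost everywhere because \<open>cft_integrable\<close> provides
  convergence of the defining integrals only for almost every \<open>y\<close>.\<close>

lemma cft_diff:
  assumes f: "schwartz f" and g: "schwartz g"
  shows "AE y in lebesgue. cft \<sigma> (\<lambda>x. f x - g x) y = cft \<sigma> f y - cft \<sigma> g y"
proof -
  have "AE y in lborel. cft \<sigma> (\<lambda>x. f x - g x) y = cft \<sigma> f y - cft \<sigma> g y"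
    using cft_integrable[OF schwartz_integrable[OF f] zero_less_one, of \<sigma>]
      cft_integrable[OF schwartz_integrable[OF g] zero_less_one, of \<sigma>]
  proof eventually_elim
    case (elim y)
    have "cft_kernel \<sigma> x y \<odot> cl_complexify (f x - g x) =
       cft_kernel \<sigma> x y \<odot> cl_complexify (f x) - cft_kernel \<sigma> x y \<odot> cl_complexify (g x)" for x
      by (simp add: linear_diff[OF bounded_linear.linear[OF bounded_linear_cl_complexify]]
          bounded_bilinear.diff_right[OF bounded_bilinear_cl_mult])
    then show ?case
      using elim
      by (simp add: cft_eq_lborel[OF schwartz_integrable[OF f] zero_less_one] cft_eq_lborel[OF schwartz_integrable[OF g] zero_less_one]
          cft_eq_lborel[OF schwartz_integrable[OF schwartz_diff[OF f g]] zero_less_one] scaleR_diff_right)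
  qed
  then show ?thesis by (rule AE_completion)
qed

section \<open>The squared L2 distance\<close>

lemma l2_norm_sq_cong_AE: "AE x in lebesgue. f x = g x \<Longrightarrow> l2_norm_sq f = l2_norm_sq g"
  unfolding l2_norm_sq_def by (intro nn_integral_cong_AE) (auto elim!: eventually_mono)

lemma norm_add_sq_le: "(norm (u + v))\<^sup>2 \<le> 2 * (norm u)\<^sup>2 + 2 * (norm v :: real)\<^sup>2"
proof -
  have "(norm (u + v))\<^sup>2 \<le> (norm u + norm v)\<^sup>2" by (intro power_mono norm_triangle_ineq) simp
  also have "\<dots> \<le> 2 * (norm u)\<^sup>2 + 2 * (norm v)\<^sup>2"
    using zero_le_power2[of "norm u - norm v"] by (simp add: power2_eq_square algebra_simps)
  finally show ?thesis .
qed

lemma l2_norm_sq_add: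
  assumes [measurable]: "f \<in> borel_measurable lebesgue" "g \<in> borel_measurable lebesgue"
  shows "l2_norm_sq (\<lambda>x. f x + g x) \<le> 2 * l2_norm_sq f + 2 * l2_norm_sq g"
proof -
  have "l2_norm_sq (\<lambda>x. f x + g x) \<le> (\<integral>\<^sup>+x. 2 * ennreal ((norm (f x))\<^sup>2) + 2 * ennreal ((norm (g x))\<^sup>2) \<partial>lebesgue)"
    unfolding l2_norm_sq_def
  proof (rule nn_integral_mono)
    fix x
    have "ennreal ((norm (f x + g x))\<^sup>2) \<le> ennreal (2 * (norm (f x))\<^sup>2 + 2 * (norm (g x))\<^sup>2)"
      by (intro ennreal_leI norm_add_sq_le)
    then show "ennreal ((norm (f x + g x))\<^sup>2) \<le> 2 * ennreal ((norm (f x))\<^sup>2) + 2 * ennreal ((norm (g x))\<^sup>2)"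
      by (simp add: ennreal_plus ennreal_mult)
  qed
  also have "\<dots> = 2 * l2_norm_sq f + 2 * l2_norm_sq g"
    unfolding l2_norm_sq_def by (subst nn_integral_add) (simp_all add: nn_integral_cmult)
  finally show ?thesis .
qed

text \<open>Squared distances satisfy the triangle inequality up to a factor 2. This is where the
  numerical constants in the construction of the extension come from.\<close>

lemma l2_norm_sq_triangle:
  fixes f g h :: "'a::euclidean_space \<Rightarrow> 'b::euclidean_space"
  assumes [measurable]: "f \<in> borel_measurable lebesgue" "g \<in> borel_measurable lebesgue" "h \<in> borel_measurable lebesgue"
  shows "l2_norm_sq (\<lambda>x. f x - h x) \<le> 2 * l2_norm_sq (\<lambda>x. f x - g x) + 2 * l2_norm_sq (\<lambda>x. g x - h x)"
  using l2_norm_sq_add[OF borel_measurable_diff[OF assms(1,2)] borel_measurable_diff[OF assms(2,3)]] by simp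

lemma l2_norm_sq_minus_commute: "l2_norm_sq (\<lambda>x. f x - g x) = l2_norm_sq (\<lambda>x. g x - f x)"
  unfolding l2_norm_sq_def by (simp add: norm_minus_commute)

lemma l2_norm_sq_cft_diff:
  assumes "schwartz f" "schwartz g"
  shows "l2_norm_sq (\<lambda>y. cft \<sigma> f y - cft \<sigma> g y) = l2_norm_sq (\<lambda>x. f x - g x)"
  unfolding cft_schwartz_norm[OF schwartz_diff[OF assms], of \<sigma>, symmetric]
  by (rule l2_norm_sq_cong_AE) (use cft_diff[OF assms, of \<sigma>] in \<open>auto elim!: eventually_mono\<close>)

section \<open>Density of the Schwartz functions\<close>

lemma polynomial_function_exp_bound:
  fixes q :: "'a::euclidean_space \<Rightarrow> 'b::euclidean_space"
  assumes q: "polynomial_function q"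
  shows "\<exists>C D. 0 \<le> C \<and> 0 \<le> D \<and> (\<forall>y. norm (q y) \<le> C * exp (D * norm y))"
proof -
  obtain C D where CD: "0 \<le> C" "0 \<le> D" "\<And>y. \<bar>q y \<bullet> q y\<bar> \<le> C * exp (D * norm y)"
    using real_polynomial_function_exp_bound[OF real_polynomial_function_inner[OF q q]] by blast
  have "norm (q y) \<le> (1 + C) * exp (D * norm y)" for y
  proof -
    have "2 * norm (q y) \<le> (norm (q y))\<^sup>2 + 1"
      using zero_le_power2[of "norm (q y) - 1"] by (simp add: power2_diff)
    then have "norm (q y) \<le> 1 + (norm (q y))\<^sup>2" using norm_ge_zero[of "q y"] by linarith
    also have "(norm (q y))\<^sup>2 \<le> C * exp (D * norm y)"
      using CD(3)[of y] by (simp add: power2_norm_eq_inner)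
    also have "1 \<le> exp (D * norm y)" using CD(2) by simp
    finally show ?thesis by (simp add: distrib_right)
  qed
  then show ?thesis using CD by (intro exI[of _ "1 + C"] exI[of _ D]) auto
qed

lemma polynomial_function_partial:
  fixes q :: "real ^ 'm \<Rightarrow> 'b::euclidean_space"
  assumes q: "polynomial_function q"
  shows "polynomial_function (partial_derivative k q)"
  unfolding polynomial_function_iff_Basis_inner
proof
  fix b :: 'b assume "b \<in> Basis"
  then have qb: "real_polynomial_function (\<lambda>x. q x \<bullet> b)"
    using q unfolding polynomial_function_iff_Basis_inner by blast
  have "partial_derivative k q x \<bullet> b = frechet_derivative (\<lambda>x. q x \<bullet> b) (at x) (axis k 1)" for x
    unfolding partial_derivative_def
    by (subst frechet_derivative_at[symmetric, OF has_derivative_inner_left[OF has_derivative_partial[OF differentiable_at_polynomial_function[OF q]]]]) simp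
  then show "real_polynomial_function (\<lambda>x. partial_derivative k q x \<bullet> b)"
    using real_polynomial_function_frechet[OF qb] by simp
qed

text \<open>Products of a fixed \<open>exp (- p x)\<close> with polynomials are closed under partial
  derivatives, which settles all iterated derivatives in \<open>schwartz\<close> at once.\<close>

lemma fold_partial_exp_polynomial:
  fixes p :: "real ^ 'm \<Rightarrow> real" and q :: "real ^ 'm \<Rightarrow> 'b::euclidean_space"
  assumes p: "real_polynomial_function p" and q: "polynomial_function q"
  shows "\<exists>q'. polynomial_function q' \<and>
    fold partial_derivative ks (\<lambda>x. exp (- p x) *\<^sub>R q x) = (\<lambda>x. exp (- p x) *\<^sub>R q' x)"
  using q
proof (induction ks arbitrary: q)
  case Nil
  then show ?case by (intro exI[of _ q]) simp
next
  case (Cons k ks)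
  let ?q = "\<lambda>x. partial_derivative k q x - partial_derivative k p x *\<^sub>R q x"
  have "polynomial_function ?q"
    using p Cons.prems by (intro polynomial_function_diff polynomial_function_mult polynomial_function_partial)
      (simp_all add: real_polynomial_function_eq)
  moreover have "partial_derivative k (\<lambda>x. exp (- p x) *\<^sub>R q x) = (\<lambda>x. exp (- p x) *\<^sub>R ?q x)"
  proof
    fix x
    have "(p has_derivative (\<lambda>h. frechet_derivative p (at x) h)) (at x)"
      by (rule has_derivative_partial[OF differentiable_at_real_polynomial_function[OF p]])
    then have "((\<lambda>x. exp (- p x)) has_derivative (\<lambda>h. exp (- p x) * (- frechet_derivative p (at x) h))) (at x)"
      by (auto intro!: derivative_eq_intros)
    from has_derivative_scaleR[OF this has_derivative_partial[OF differentiable_at_polynomial_function[OF Cons.prems]]]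
    show "partial_derivative k (\<lambda>x. exp (- p x) *\<^sub>R q x) x = exp (- p x) *\<^sub>R ?q x"
      unfolding partial_derivative_def[of k q] partial_derivative_def[of k p]
      by (subst partial_derivative_eq) (simp_all add: scaleR_diff_right)
  qed
  ultimately show ?case using Cons.IH[of ?q] by simp
qed

text \<open>Every iterated derivative has the same shape, so only decay is left: the Gaussian bound
  on \<open>exp (- p x)\<close> beats the exponential bound of a polynomial. The slack
  \<open>1\<close> in the lower bound admits high powers of the squared norm, which fall below it in
  the unit ball.\<close>

lemma schwartz_exp_polynomial:
  fixes p :: "real ^ 'm \<Rightarrow> real" and q :: "real ^ 'm \<Rightarrow> 'b::euclidean_space"
  assumes p: "real_polynomial_function p" and q: "polynomial_function q"
    and c: "c > 0" "\<And>x. c * (norm x)\<^sup>2 - 1 \<le> p x"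
  shows "schwartz (\<lambda>x. exp (- p x) *\<^sub>R q x)"
  unfolding schwartz_def
proof (intro allI conjI)
  fix ks :: "'m list" and x and N :: nat
  obtain q' where q': "polynomial_function q'"
    and eq: "fold partial_derivative ks (\<lambda>x. exp (- p x) *\<^sub>R q x) = (\<lambda>x. exp (- p x) *\<^sub>R q' x)"
    using fold_partial_exp_polynomial[OF p q] by blast
  have "((\<lambda>x. exp (- p x)) has_derivative (\<lambda>h. exp (- p x) * (- frechet_derivative p (at x) h))) (at x)"
    using has_derivative_partial[OF differentiable_at_real_polynomial_function[OF p], of x]
    by (auto intro!: derivative_eq_intros)
  then show "fold partial_derivative ks (\<lambda>x. exp (- p x) *\<^sub>R q x) differentiable at x"
    unfolding eq by (rule differentiable_scaleR[OF differentiableI differentiable_at_polynomial_function[OF q']])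
  obtain C D where CD: "0 \<le> C" "0 \<le> D" "\<And>y. norm (q' y) \<le> C * exp (D * norm y)"
    using polynomial_function_exp_bound[OF q'] by blast
  have "norm (norm x ^ N *\<^sub>R (exp (- p x) *\<^sub>R q' x)) \<le> C * exp ((real N + D)\<^sup>2 / (4 * c) + 1)" for x
  proof -
    define t where "t = norm x"
    have "norm (norm x ^ N *\<^sub>R (exp (- p x) *\<^sub>R q' x)) = t ^ N * (exp (- p x) * norm (q' x))"
      by (simp add: t_def)
    also have "\<dots> \<le> exp (real N * t) * (exp (1 - c * t\<^sup>2) * (C * exp (D * t)))"
      using CD c(2)[of x] by (intro mult_mono power_le_exp) (auto simp: t_def)
    also have "\<dots> = C * exp ((real N + D) * t - c * t\<^sup>2 + 1)"
      by (simp add: mult_exp_exp algebra_simps)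
    also have "(real N + D) * t - c * t\<^sup>2 \<le> (real N + D)\<^sup>2 / (4 * c)"
    proof -
      have "0 \<le> (real N + D - 2 * c * t)\<^sup>2 / (4 * c)" using c by simp
      also have "\<dots> = (real N + D)\<^sup>2 / (4 * c) - ((real N + D) * t - c * t\<^sup>2)"
        using c by (simp add: power2_eq_square field_simps)
      finally show ?thesis by simp
    qed
    finally show ?thesis using CD(1) by (simp add: mult_left_mono)
  qed
  then show "bounded (range (\<lambda>x. norm x ^ N *\<^sub>R fold partial_derivative ks (\<lambda>x. exp (- p x) *\<^sub>R q x) x))"
    unfolding eq by (auto simp: bounded_iff)
qed

lemma l2_norm_sq_dominated:
  fixes F :: "nat \<Rightarrow> 'a::euclidean_space \<Rightarrow> 'b::euclidean_space"
  assumes [measurable]: "\<And>n. F n \<in> borel_measurable lebesgue" "f \<in> borel_measurable lebesgue" "W \<in> borel_measurable lebesgue"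
    and W: "\<And>n. AE x in lebesgue. (norm (f x - F n x))\<^sup>2 \<le> W x" "(\<integral>\<^sup>+x. ennreal (W x) \<partial>lebesgue) < \<infinity>"
    and lim: "AE x in lebesgue. (\<lambda>n. F n x) \<longlonglongrightarrow> f x"
  shows "(\<lambda>n. l2_norm_sq (\<lambda>x. f x - F n x)) \<longlonglongrightarrow> 0"
proof -
  have "(\<lambda>n. \<integral>\<^sup>+x. ennreal ((norm (f x - F n x))\<^sup>2) \<partial>lebesgue) \<longlonglongrightarrow> (\<integral>\<^sup>+x. 0 \<partial>(lebesgue :: 'a measure))"
  proof (rule nn_integral_dominated_convergence[where w = "\<lambda>x. ennreal (W x)"])
    show "AE x in lebesgue. ennreal ((norm (f x - F n x))\<^sup>2) \<le> ennreal (W x)" for n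
      using W(1)[of n] by eventually_elim (rule ennreal_leI)
    show "AE x in lebesgue. (\<lambda>n. ennreal ((norm (f x - F n x))\<^sup>2)) \<longlonglongrightarrow> 0"
      using lim
    proof eventually_elim
      case (elim x)
      then have "(\<lambda>n. (norm (f x - F n x))\<^sup>2) \<longlonglongrightarrow> (norm (f x - f x))\<^sup>2" by (intro tendsto_intros)
      then have "(\<lambda>n. ennreal ((norm (f x - F n x))\<^sup>2)) \<longlonglongrightarrow> ennreal ((norm (f x - f x))\<^sup>2)" by (rule tendsto_ennrealI)
      then show ?case by simp
    qed
    show "(\<integral>\<^sup>+x. ennreal (W x) \<partial>lebesgue) < \<infinity>" by (rule W(2))
  qed measurable
  then show ?thesis by (simp add: l2_norm_sq_def)
qed

text \<open>Membership in the L2 closure of the Schwartz functions. Since it is stable under L2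
  limits, density can be reached by a chain: polynomials cut off to a ball, continuous functions cut
  off to a ball, bounded functions vanishing off a ball, all square integrable functions.\<close>

definition schwartz_close :: "(real ^ 'm \<Rightarrow> 'b::euclidean_space) \<Rightarrow> bool" where
  "schwartz_close f \<longleftrightarrow> (\<forall>e>0. \<exists>g. schwartz g \<and> l2_norm_sq (\<lambda>x. f x - g x) \<le> ennreal e)"

lemma tendsto_0_ennreal_le:
  fixes u :: "nat \<Rightarrow> ennreal"
  assumes "u \<longlonglongrightarrow> 0" "e > 0" shows "\<exists>n. u n \<le> ennreal e"
proof -
  have "\<forall>\<^sub>F n in sequentially. u n < ennreal e" using assms by (intro order_tendstoD(2)) auto
  then show ?thesis by (auto simp: eventually_sequentially intro: less_imp_le)
qed

lemma schwartz_close_limit: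
  fixes f :: "real ^ 'm \<Rightarrow> 'b::euclidean_space"
  assumes m: "\<And>n. F n \<in> borel_measurable lebesgue" "f \<in> borel_measurable lebesgue"
    and F: "\<And>n. schwartz_close (F n)" and lim: "(\<lambda>n. l2_norm_sq (\<lambda>x. f x - F n x)) \<longlonglongrightarrow> 0"
  shows "schwartz_close f"
  unfolding schwartz_close_def
proof (intro allI impI)
  fix e :: real assume e: "e > 0"
  then obtain n where n: "l2_norm_sq (\<lambda>x. f x - F n x) \<le> ennreal (e / 4)"
    using tendsto_0_ennreal_le[OF lim, of "e / 4"] by auto
  obtain g where g: "schwartz g" "l2_norm_sq (\<lambda>x. F n x - g x) \<le> ennreal (e / 4)"
    using F[of n] e unfolding schwartz_close_def by (meson divide_pos_pos zero_less_numeral)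
  have "l2_norm_sq (\<lambda>x. f x - g x) \<le> 2 * l2_norm_sq (\<lambda>x. f x - F n x) + 2 * l2_norm_sq (\<lambda>x. F n x - g x)"
    by (intro l2_norm_sq_triangle m lebesgue_measurable_borel schwartz_borel_measurable g)
  also have "\<dots> \<le> 2 * ennreal (e / 4) + 2 * ennreal (e / 4)"
    by (intro add_mono mult_left_mono n g) auto
  also have "\<dots> = ennreal e" using e by (simp add: ennreal_mult[symmetric] ennreal_plus[symmetric] ennreal_numeral[symmetric] del: ennreal_numeral ennreal_plus)
  finally show "\<exists>g. schwartz g \<and> l2_norm_sq (\<lambda>x. f x - g x) \<le> ennreal e" using g(1) by blast
qed

lemma schwartz_close_schwartz: "schwartz f \<Longrightarrow> schwartz_close f"
  unfolding schwartz_close_def by (intro allI impI exI[of _ f]) (simp add: l2_norm_sq_def)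

lemma measurable_ball_scaleR:
  fixes f :: "'a::euclidean_space \<Rightarrow> 'b::euclidean_space"
  assumes "f \<in> borel_measurable lebesgue"
  shows "(\<lambda>x. indicat_real (ball 0 R) x *\<^sub>R f x) \<in> borel_measurable lebesgue"
  by (intro borel_measurable_scaleR assms borel_measurable_indicator) simp

text \<open>The functions \<open>exp (- (|x|/R)\<^sup>2\<^sup>k)\<close> are Schwartz and converge to the indicator of the ball
  of radius \<open>R\<close> off the sphere.\<close>

lemma schwartz_close_polynomial_ball:
  fixes q :: "real ^ 'm \<Rightarrow> 'b::euclidean_space"
  assumes q: "polynomial_function q" and R: "R > 0"
  shows "schwartz_close (\<lambda>x. indicat_real (ball 0 R) x *\<^sub>R q x)"
proof -
  define t where "t x = (norm x)\<^sup>2 / R\<^sup>2" for x :: "(real, 'm) vec"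
  define F where "F n x = exp (- (t x ^ Suc n)) *\<^sub>R q x" for n x
  have t0: "0 \<le> t x" for x by (simp add: t_def)
  \<comment> \<open>For \<open>t x < 1\<close> the left side is negative, for larger values powers
    increase. This yields a Gaussian majorant that does not depend on \<open>n\<close>.\<close>
  have tle: "t x - 1 \<le> t x ^ Suc n" for n x
    using self_le_power[of "t x" "Suc n"] zero_le_power[OF t0[of x], of "Suc n"] by linarith
  have pt: "real_polynomial_function (\<lambda>x. t x ^ Suc n)" for n
  proof -
    have "real_polynomial_function (\<lambda>x :: (real, 'm) vec. (x \<bullet> x) * (1 / R\<^sup>2))"
      by (intro real_polynomial_function.intros(4) real_polynomial_function.intros(2) real_polynomial_function_inner polynomial_function_id)
    then show ?thesis unfolding t_def power2_norm_eq_inner by (intro real_polynomial_function_power) simp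
  qed
  have S: "schwartz (F n)" for n
    unfolding F_def[abs_def]
  proof (rule schwartz_exp_polynomial[OF pt q, of "1 / R\<^sup>2"])
    show "1 / R\<^sup>2 * (norm x)\<^sup>2 - 1 \<le> t x ^ Suc n" for x :: "(real, 'm) vec" using tle[of x n] by (simp add: t_def)
  qed (use R in simp)
  have qm [measurable]: "q \<in> borel_measurable lebesgue"
    by (intro lebesgue_measurable_borel borel_measurable_continuous_onI continuous_on_polymonial_function q)
  obtain C D where CD: "0 \<le> C" "0 \<le> D" "\<And>y. norm (q y) \<le> C * exp (D * norm y)"
    using polynomial_function_exp_bound[OF q] by blast
  define W where "W x = C\<^sup>2 * exp 2 * (exp (2 * D * norm x) * exp (- (2 / R\<^sup>2) * (norm x)\<^sup>2))" for x :: "(real, 'm) vec"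
  have "(\<lambda>n. l2_norm_sq (\<lambda>x. indicat_real (ball 0 R) x *\<^sub>R q x - F n x)) \<longlonglongrightarrow> 0"
  proof (rule l2_norm_sq_dominated)
    show "F n \<in> borel_measurable lebesgue" for n
      by (intro lebesgue_measurable_borel schwartz_borel_measurable S)
    show "(\<lambda>x. indicat_real (ball 0 R) x *\<^sub>R q x) \<in> borel_measurable lebesgue"
      by (rule measurable_ball_scaleR[OF qm])
    show "W \<in> borel_measurable lebesgue"
      by (rule lebesgue_measurable_borel) (simp add: W_def[abs_def])
    have "integrable lborel W"
      unfolding W_def[abs_def] by (intro integrable_mult_right integrable_exp_norm_gaussian) (use R in simp)
    then have "(\<integral>\<^sup>+x. ennreal (W x) \<partial>lborel) = ennreal (\<integral>x. W x \<partial>lborel)"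
      by (rule nn_integral_eq_integral) (simp add: W_def)
    then show "(\<integral>\<^sup>+x. ennreal (W x) \<partial>lebesgue) < \<infinity>"
      by (simp add: nn_integral_completion)
    have "\<bar>indicat_real (ball 0 R) x - exp (- (t x ^ Suc n))\<bar> \<le> exp (1 - t x)" for x n
    proof (cases "x \<in> ball 0 R")
      case True
      then have "(norm x)\<^sup>2 \<le> R\<^sup>2" by (intro power_mono) auto
      then have "t x \<le> 1" using R by (simp add: t_def)
      then have "1 \<le> exp (1 - t x)" by simp
      moreover have "exp (- (t x ^ Suc n)) \<le> 1" using t0 by simp
      ultimately show ?thesis using True exp_gt_zero[of "- (t x ^ Suc n)"] by (simp only: indicator_simps)
    next
      case False
      then show ?thesis using tle[of x n] by simp
    qed
    note le1 = this
    show "AE x in lebesgue. (norm (indicat_real (ball 0 R) x *\<^sub>R q x - F n x))\<^sup>2 \<le> W x" for n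
    proof (rule AE_I2)
      fix x
      have "norm (indicat_real (ball 0 R) x *\<^sub>R q x - F n x) = \<bar>indicat_real (ball 0 R) x - exp (- (t x ^ Suc n))\<bar> * norm (q x)"
        unfolding F_def scaleR_diff_left[symmetric] by simp
      also have "\<dots> \<le> exp (1 - t x) * (C * exp (D * norm x))"
        by (intro mult_mono le1 CD(3)) auto
      finally have "(norm (indicat_real (ball 0 R) x *\<^sub>R q x - F n x))\<^sup>2 \<le> (exp (1 - t x) * (C * exp (D * norm x)))\<^sup>2"
        by (intro power_mono) auto
      also have "\<dots> = W x"
        by (simp add: W_def t_def power_mult_distrib exp_double[symmetric] mult_exp_exp algebra_simps)
      finally show "(norm (indicat_real (ball 0 R) x *\<^sub>R q x - F n x))\<^sup>2 \<le> W x" .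
    qed
    \<comment> \<open>On the sphere \<open>t x = 1\<close>, so \<open>F n x\<close> is
      \<open>exp (- 1) *\<^sub>R q x\<close> for all \<open>n\<close>, which need not be the desired
      limit; the sphere is a null set.\<close>
    have "AE x in lebesgue. x \<notin> sphere (0 :: (real, 'm) vec) R"
      using negligible_sphere[of "0 :: (real, 'm) vec" R] by (intro AE_not_in) (simp add: negligible_iff_null_sets)
    then show "AE x in lebesgue. (\<lambda>n. F n x) \<longlonglongrightarrow> indicat_real (ball 0 R) x *\<^sub>R q x"
    proof eventually_elim
      case (elim x)
      show ?case
      proof (cases "norm x < R")
        case True
        then have "t x < 1" using R by (simp add: t_def power_strict_mono)
        then have "(\<lambda>n. t x ^ Suc n) \<longlonglongrightarrow> 0" by (intro LIMSEQ_Suc LIMSEQ_realpow_zero t0)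
        then have "(\<lambda>n. exp (- (t x ^ Suc n)) *\<^sub>R q x) \<longlonglongrightarrow> exp (- 0) *\<^sub>R q x" by (intro tendsto_intros)
        then show ?thesis using True by (simp add: F_def)
      next
        case False
        with elim have "R < norm x" by simp
        then have "R\<^sup>2 < (norm x)\<^sup>2" using R by (intro power_strict_mono) auto
        then have "1 < t x" using R by (simp add: t_def)
        then have "filterlim (\<lambda>n. t x ^ n) at_infinity sequentially"
          by (intro filterlim_realpow_sequentially_gt1) simp
        moreover have "\<forall>\<^sub>F n in sequentially. 0 < t x ^ n" using \<open>1 < t x\<close> by simp
        ultimately have "filterlim (\<lambda>n. t x ^ n) at_top sequentially"
          by (rule filterlim_at_infinity_imp_filterlim_at_top)
        then have "filterlim (\<lambda>n. t x ^ Suc n) at_top sequentially" by (rule filterlim_compose[OF _ filterlim_Suc])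
        then have "(\<lambda>n. exp (- (t x ^ Suc n))) \<longlonglongrightarrow> 0"
          by (intro filterlim_compose[OF exp_at_bot] filterlim_compose[OF filterlim_uminus_at_bot_at_top])
        then have "(\<lambda>n. exp (- (t x ^ Suc n)) *\<^sub>R q x) \<longlonglongrightarrow> 0 *\<^sub>R q x" by (intro tendsto_intros)
        then show ?thesis using False by (simp add: F_def)
      qed
    qed
  qed
  then show ?thesis
    by (rule schwartz_close_limit[OF lebesgue_measurable_borel[OF schwartz_borel_measurable[OF S]]
          measurable_ball_scaleR[OF qm] schwartz_close_schwartz[OF S]])
qed

lemma finite_ball_integral: "(\<integral>\<^sup>+x. ennreal (c * indicat_real (ball (0 :: 'a::euclidean_space) R) x) \<partial>lebesgue) < \<infinity>"
proof -
  have "integrable lebesgue (indicat_real (ball (0 :: 'a) R))"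
    using emeasure_bounded_finite[of "ball (0 :: 'a) R"] by (simp add: integrable_indicator_iff)
  then have "integrable lebesgue (\<lambda>x. c * indicat_real (ball (0 :: 'a) R) x)" by simp
  then have "(\<integral>\<^sup>+x. ennreal (norm (c * indicat_real (ball (0 :: 'a) R) x)) \<partial>lebesgue) < \<infinity>"
    unfolding integrable_iff_bounded by blast
  moreover have "(\<integral>\<^sup>+x. ennreal (c * indicat_real (ball (0 :: 'a) R) x) \<partial>lebesgue) \<le>
      (\<integral>\<^sup>+x. ennreal (norm (c * indicat_real (ball (0 :: 'a) R) x)) \<partial>lebesgue)"
    unfolding real_norm_def by (intro nn_integral_mono ennreal_leI abs_ge_self)
  ultimately show ?thesis by (rule order.strict_trans1[rotated])
qed

text \<open>Stone--Weierstrass gives uniform approximation by polynomials on the closed ball, and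
  uniform convergence on a set of finite measure is L2 convergence.\<close>

lemma schwartz_close_continuous_ball:
  fixes \<phi> :: "real ^ 'm \<Rightarrow> 'b::euclidean_space"
  assumes \<phi>: "continuous_on UNIV \<phi>" and R: "R > 0"
  shows "schwartz_close (\<lambda>x. indicat_real (ball 0 R) x *\<^sub>R \<phi> x)"
proof -
  have "\<exists>q. polynomial_function q \<and> (\<forall>x\<in>cball 0 R. norm (\<phi> x - q x) < 1 / real (Suc n))" for n
    using continuous_on_subset[OF \<phi>] by (intro Stone_Weierstrass_polynomial_function) auto
  then obtain q where q: "\<And>n. polynomial_function (q n)" "\<And>n x. x \<in> cball 0 R \<Longrightarrow> norm (\<phi> x - q n x) < 1 / real (Suc n)"
    by metis
  have qm: "q n \<in> borel_measurable lebesgue" "\<phi> \<in> borel_measurable lebesgue" for n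
    by (intro lebesgue_measurable_borel borel_measurable_continuous_onI continuous_on_polymonial_function q \<phi>)+
  have b: "norm (indicat_real (ball 0 R) x *\<^sub>R \<phi> x - indicat_real (ball 0 R) x *\<^sub>R q n x) \<le> 1 / real (Suc n) * indicat_real (ball 0 R) x" for n x
    using q(2)[of x n] by (cases "x \<in> ball 0 R") (auto simp: less_imp_le)
  show ?thesis
  proof (rule schwartz_close_limit[where F = "\<lambda>n x. indicat_real (ball 0 R) x *\<^sub>R q n x",
        OF measurable_ball_scaleR[OF qm(1)] measurable_ball_scaleR[OF qm(2)]])
    show "schwartz_close (\<lambda>x. indicat_real (ball 0 R) x *\<^sub>R q n x)" for n
      by (rule schwartz_close_polynomial_ball[OF q(1) R])
    show "(\<lambda>n. l2_norm_sq (\<lambda>x. indicat_real (ball 0 R) x *\<^sub>R \<phi> x - indicat_real (ball 0 R) x *\<^sub>R q n x)) \<longlonglongrightarrow> 0"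
    proof (rule l2_norm_sq_dominated[OF measurable_ball_scaleR[OF qm(1)] measurable_ball_scaleR[OF qm(2)]])
      show "AE x in lebesgue. (norm (indicat_real (ball 0 R) x *\<^sub>R \<phi> x - indicat_real (ball 0 R) x *\<^sub>R q n x))\<^sup>2 \<le> 1 * indicat_real (ball 0 R) x" for n
      proof (rule AE_I2)
        fix x
        have "norm (indicat_real (ball 0 R) x *\<^sub>R \<phi> x - indicat_real (ball 0 R) x *\<^sub>R q n x) \<le> 1 * indicat_real (ball 0 R) x"
          by (rule order_trans[OF b mult_right_mono]) auto
        then have "(norm (indicat_real (ball 0 R) x *\<^sub>R \<phi> x - indicat_real (ball 0 R) x *\<^sub>R q n x))\<^sup>2 \<le> (1 * indicat_real (ball 0 R) x)\<^sup>2"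
          by (rule power_mono) simp
        then show "(norm (indicat_real (ball 0 R) x *\<^sub>R \<phi> x - indicat_real (ball 0 R) x *\<^sub>R q n x))\<^sup>2 \<le> 1 * indicat_real (ball 0 R) x"
          by (cases "x \<in> ball 0 R") (simp_all add: power_le_one)
      qed
      show "AE x in lebesgue. (\<lambda>n. indicat_real (ball 0 R) x *\<^sub>R q n x) \<longlonglongrightarrow> indicat_real (ball 0 R) x *\<^sub>R \<phi> x"
      proof (rule AE_I2)
        fix x :: "(real, 'm) vec"
        have z: "(\<lambda>n. 1 / real (Suc n) * indicat_real (ball 0 R) x) \<longlonglongrightarrow> 0" by real_asymp
        have "(\<lambda>n. indicat_real (ball 0 R) x *\<^sub>R \<phi> x - indicat_real (ball 0 R) x *\<^sub>R q n x) \<longlonglongrightarrow> 0"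
          by (rule Lim_null_comparison[OF _ z]) (use b in auto)
        from tendsto_diff[OF tendsto_const[of "indicat_real (ball 0 R) x *\<^sub>R \<phi> x"] this]
        show "(\<lambda>n. indicat_real (ball 0 R) x *\<^sub>R q n x) \<longlonglongrightarrow> indicat_real (ball 0 R) x *\<^sub>R \<phi> x" by simp
      qed
      show "(\<lambda>x. 1 * indicat_real (ball 0 R) x) \<in> borel_measurable lebesgue"
        by (intro borel_measurable_times borel_measurable_const borel_measurable_indicator) simp
    qed (rule finite_ball_integral)
  qed
qed

lemma schwartz_close_bounded:
  fixes f :: "real ^ 'm \<Rightarrow> 'b::euclidean_space"
  assumes f: "f \<in> borel_measurable lebesgue" and R: "R > 0"
    and b: "\<And>x. norm (f x) \<le> R" "\<And>x. x \<notin> ball 0 R \<Longrightarrow> f x = 0"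
  shows "schwartz_close f"
proof -
  have "f measurable_on UNIV" by (rule lebesgue_measurable_imp_measurable_on[OF f]) simp
  then obtain N g where N: "negligible N" and g: "\<And>n. continuous_on UNIV (g n)"
    and lim: "\<And>x. x \<notin> N \<Longrightarrow> (\<lambda>n. g n x) \<longlonglongrightarrow> f x"
    unfolding measurable_on_def by auto
  \<comment> \<open>The radial retraction to the ball of radius \<open>R\<close>. The continuous
    approximants of a measurable function need not be bounded; \<open>clip\<close> bounds them and
    fixes the values of \<open>f\<close>, so convergence is kept.\<close>
  define clip where "clip v = (R / max R (norm v)) *\<^sub>R v" for v :: 'b
  have clip_cont: "continuous_on UNIV clip"
    unfolding clip_def[abs_def] using R by (intro continuous_intros) auto
  have clip_bound: "norm (clip v) \<le> R" for v
    using R by (simp add: clip_def field_simps max_def)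
  have clip_id: "clip v = v" if "norm v \<le> R" for v
    using that R by (simp add: clip_def max_def)
  let ?F = "\<lambda>n x. indicat_real (ball 0 R) x *\<^sub>R clip (g n x)"
  have cg: "continuous_on UNIV (\<lambda>x. clip (g n x))" for n
    by (rule continuous_on_compose2[OF clip_cont g]) simp
  have fi: "f x = indicat_real (ball 0 R) x *\<^sub>R f x" for x using b(2)[of x] by (cases "x \<in> ball 0 R") auto
  have Fm: "?F n \<in> borel_measurable lebesgue" for n
    by (intro measurable_ball_scaleR lebesgue_measurable_borel borel_measurable_continuous_onI cg)
  show ?thesis
  proof (rule schwartz_close_limit[where F = ?F, OF Fm f])
    show "schwartz_close (?F n)" for n
      by (rule schwartz_close_continuous_ball[OF cg R])
    show "(\<lambda>n. l2_norm_sq (\<lambda>x. f x - ?F n x)) \<longlonglongrightarrow> 0"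
    proof (rule l2_norm_sq_dominated[OF Fm f])
      show "AE x in lebesgue. (norm (f x - ?F n x))\<^sup>2 \<le> (2 * R)\<^sup>2 * indicat_real (ball 0 R) x" for n
      proof (rule AE_I2)
        fix x
        show "(norm (f x - ?F n x))\<^sup>2 \<le> (2 * R)\<^sup>2 * indicat_real (ball 0 R) x"
        proof (cases "x \<in> ball 0 R")
          case True
          have "norm (f x - clip (g n x)) \<le> 2 * R"
            using norm_triangle_ineq4[of "f x" "clip (g n x)"] b(1)[of x] clip_bound[of "g n x"] by linarith
          then have "(norm (f x - clip (g n x)))\<^sup>2 \<le> (2 * R)\<^sup>2" by (rule power_mono) simp
          then show ?thesis using True by simp
        qed (simp add: b(2))
      qed
      have "AE x in lebesgue. x \<notin> N" using N by (intro AE_not_in) (simp add: negligible_iff_null_sets)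
      then show "AE x in lebesgue. (\<lambda>n. ?F n x) \<longlonglongrightarrow> f x"
      proof eventually_elim
        case (elim x)
        have "(\<lambda>n. clip (g n x)) \<longlonglongrightarrow> clip (f x)"
          using continuous_on_tendsto_compose[OF clip_cont lim[OF elim]] by simp
        from tendsto_scaleR[OF tendsto_const[of "indicat_real (ball 0 R) x"] this]
        show ?case using clip_id[OF b(1)[of x]] fi[of x] by simp
      qed
      show "(\<lambda>x. (2 * R)\<^sup>2 * indicat_real (ball 0 R) x) \<in> borel_measurable lebesgue"
        by (intro borel_measurable_times borel_measurable_const borel_measurable_indicator) simp
    qed (rule finite_ball_integral)
  qed
qed

theorem schwartz_dense:
  fixes f :: "real ^ 'm \<Rightarrow> 'b::euclidean_space"
  assumes f: "square_integrable f" and e: "e > 0"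
  shows "\<exists>g. schwartz g \<and> l2_norm_sq (\<lambda>x. f x - g x) \<le> ennreal e"
proof -
  have fm [measurable]: "f \<in> borel_measurable lebesgue" and fi: "l2_norm_sq f < \<infinity>"
    using f by (auto simp: square_integrable_def)
  define F where "F n x = (if norm (f x) \<le> real (Suc n) then indicat_real (ball 0 (real (Suc n))) x *\<^sub>R f x else 0)" for n x
  have Fm: "F n \<in> borel_measurable lebesgue" for n
    unfolding F_def[abs_def] using measurable_ball_scaleR[OF fm, of "real (Suc n)"] by measurable
  have "schwartz_close f"
  proof (rule schwartz_close_limit[OF Fm fm])
    show "schwartz_close (F n)" for n
      by (rule schwartz_close_bounded[OF Fm, of "real (Suc n)"]) (auto simp: F_def indicator_def)
    show "(\<lambda>n. l2_norm_sq (\<lambda>x. f x - F n x)) \<longlonglongrightarrow> 0"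
    proof (rule l2_norm_sq_dominated[OF Fm fm])
      show "AE x in lebesgue. (norm (f x - F n x))\<^sup>2 \<le> (norm (f x))\<^sup>2" for n
        by (rule AE_I2) (simp add: F_def indicator_def)
      show "(\<integral>\<^sup>+x. ennreal ((norm (f x))\<^sup>2) \<partial>lebesgue) < \<infinity>" using fi by (simp add: l2_norm_sq_def)
      show "AE x in lebesgue. (\<lambda>n. F n x) \<longlonglongrightarrow> f x"
      proof (rule AE_I2)
        fix x
        obtain k :: nat where k: "max (norm (f x)) (norm x) < real k" using reals_Archimedean2 by blast
        then have "\<forall>\<^sub>F n in sequentially. F n x = f x"
          unfolding eventually_sequentially by (intro exI[of _ k]) (auto simp: F_def)
        then show "(\<lambda>n. F n x) \<longlonglongrightarrow> f x" by (rule tendsto_eventually)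
      qed
    qed measurable
  qed
  then show ?thesis using e unfolding schwartz_close_def by blast
qed

section \<open>The extension to square integrable functions\<close>

text \<open>Even after multiplication by \<open>2 ^ n\<close> the squared increments have summable
  integrals, so their weighted sum is finite almost everywhere. Young's inequality with the same
  factor bounds the increments themselves by a summable sequence.\<close>

lemma l2_fast_Cauchy_convergent:
  fixes G :: "nat \<Rightarrow> 'a::euclidean_space \<Rightarrow> 'b::euclidean_space"
  assumes [measurable]: "\<And>n. G n \<in> borel_measurable lebesgue"
    and K: "\<And>n. l2_norm_sq (\<lambda>x. G (Suc n) x - G n x) \<le> ennreal (K / 4 ^ n)" "0 \<le> K"
  shows "AE x in lebesgue. convergent (\<lambda>n. G n x)"
proof -
  define d where "d n x = G (Suc n) x - G n x" for n x
  have dm [measurable]: "d n \<in> borel_measurable lebesgue" for n unfolding d_def by measurable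
  have "(\<integral>\<^sup>+x. (\<Sum>n. ennreal (2 ^ n * (norm (d n x))\<^sup>2)) \<partial>lebesgue) = (\<Sum>n. \<integral>\<^sup>+x. ennreal (2 ^ n * (norm (d n x))\<^sup>2) \<partial>lebesgue)"
    by (rule nn_integral_suminf) measurable
  also have "\<dots> \<le> (\<Sum>n. ennreal (K * (1 / 2) ^ n))"
  proof (rule suminf_le)
    fix n
    have "(\<integral>\<^sup>+x. ennreal (2 ^ n * (norm (d n x))\<^sup>2) \<partial>lebesgue) = ennreal (2 ^ n) * l2_norm_sq (d n)"
      unfolding l2_norm_sq_def by (subst nn_integral_cmult[symmetric]) (simp_all add: ennreal_mult)
    also have "\<dots> \<le> ennreal (2 ^ n) * ennreal (K / 4 ^ n)"
      using K(1)[of n] unfolding d_def by (rule mult_left_mono) simp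
    also have "\<dots> = ennreal (K * (1 / 2) ^ n)"
    proof -
      have "(4::real) ^ n = 2 ^ n * 2 ^ n" by (simp flip: power_mult_distrib)
      then have "2 ^ n * (K / 4 ^ n) = K * (1 / 2) ^ n" by (simp add: power_divide)
      then show ?thesis using K(2) by (simp add: ennreal_mult[symmetric])
    qed
    finally show "(\<integral>\<^sup>+x. ennreal (2 ^ n * (norm (d n x))\<^sup>2) \<partial>lebesgue) \<le> ennreal (K * (1 / 2) ^ n)" .
  qed auto
  also have "\<dots> = ennreal (\<Sum>n. K * (1 / 2) ^ n)"
    using K(2) by (intro suminf_ennreal2 summable_mult summable_geometric) auto
  also have "\<dots> < \<infinity>" by simp
  finally have fin: "(\<integral>\<^sup>+x. (\<Sum>n. ennreal (2 ^ n * (norm (d n x))\<^sup>2)) \<partial>lebesgue) \<noteq> \<infinity>" by simp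
  have "AE x in lebesgue. (\<Sum>n. ennreal (2 ^ n * (norm (d n x))\<^sup>2)) \<noteq> \<infinity>"
    by (rule nn_integral_PInf_AE[OF _ fin]) measurable
  then show ?thesis
  proof eventually_elim
    case (elim x)
    then have s: "summable (\<lambda>n. 2 ^ n * (norm (d n x))\<^sup>2)"
      by (intro summable_suminf_not_top) auto
    have "norm (d n x) \<le> (2 ^ n * (norm (d n x))\<^sup>2 + (1 / 2) ^ n) / 2" for n
    proof -
      have "0 \<le> (2 ^ n * norm (d n x) - 1)\<^sup>2 / (2 * 2 ^ n)" by simp
      also have "\<dots> = (2 ^ n * (norm (d n x))\<^sup>2 + (1 / 2) ^ n) / 2 - norm (d n x)"
        by (simp add: power2_eq_square field_simps power_divide)
      finally show ?thesis by simp
    qed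
    moreover have "summable (\<lambda>n. (2 ^ n * (norm (d n x))\<^sup>2 + (1 / 2) ^ n) / 2)"
      by (rule summable_divide[OF summable_add[OF s summable_geometric]]) simp
    ultimately have "summable (\<lambda>n. d n x)"
      by (rule summable_comparison_test'[rotated, where N = 0])
    then have "convergent (\<lambda>n. (\<Sum>k<n. d k x) + G 0 x)"
      unfolding summable_iff_convergent by (intro convergent_add convergent_const)
    then show ?case using sum_lessThan_telescope[of "\<lambda>k. G k x"] by (simp add: d_def)
  qed
qed

text \<open>Fatou's lemma passes a uniform distance bound on to the almost everywhere limit.\<close>

lemma l2_norm_sq_liminf:
  fixes G :: "nat \<Rightarrow> 'a::euclidean_space \<Rightarrow> 'b::euclidean_space"
  assumes [measurable]: "\<And>n. G n \<in> borel_measurable lebesgue" "g \<in> borel_measurable lebesgue"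
    and lim: "AE x in lebesgue. (\<lambda>n. G n x) \<longlonglongrightarrow> H x"
    and B: "\<And>n. l2_norm_sq (\<lambda>x. G n x - g x) \<le> B"
  shows "l2_norm_sq (\<lambda>x. H x - g x) \<le> B"
proof -
  have "l2_norm_sq (\<lambda>x. H x - g x) = (\<integral>\<^sup>+x. liminf (\<lambda>n. ennreal ((norm (G n x - g x))\<^sup>2)) \<partial>lebesgue)"
    unfolding l2_norm_sq_def
  proof (rule nn_integral_cong_AE)
    show "AE x in lebesgue. ennreal ((norm (H x - g x))\<^sup>2) = liminf (\<lambda>n. ennreal ((norm (G n x - g x))\<^sup>2))"
      using lim
    proof eventually_elim
      case (elim x)
      then have "(\<lambda>n. ennreal ((norm (G n x - g x))\<^sup>2)) \<longlonglongrightarrow> ennreal ((norm (H x - g x))\<^sup>2)"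
        by (intro tendsto_ennrealI tendsto_intros)
      then show ?case by (intro lim_imp_Liminf[symmetric]) simp
    qed
  qed
  also have "\<dots> \<le> liminf (\<lambda>n. \<integral>\<^sup>+x. ennreal ((norm (G n x - g x))\<^sup>2) \<partial>lebesgue)"
    by (rule nn_integral_liminf) measurable
  also have "\<dots> \<le> liminf (\<lambda>n. B)"
    using B unfolding l2_norm_sq_def by (intro Liminf_mono always_eventually) simp
  also have "\<dots> = B" by (simp add: Liminf_const)
  finally show ?thesis .
qed

text \<open>Choosing the constant sequence when \<open>f\<close> is itself a Schwartz function makes
  the extension agree with \<open>cft\<close> there by construction.\<close>

lemma ex_schwartz_sequence:
  fixes f :: "real ^ 'm \<Rightarrow> 'b::euclidean_space"
  assumes f: "square_integrable f"
  shows "\<exists>s. (\<forall>n. schwartz (s n)) \<and> (\<forall>n. l2_norm_sq (\<lambda>x. f x - s n x) \<le> ennreal (1 / 4 ^ n)) \<and> (schwartz f \<longrightarrow> (\<forall>n. s n = f))"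
proof (cases "schwartz f")
  case True
  then show ?thesis by (intro exI[of _ "\<lambda>_. f"]) (simp add: l2_norm_sq_def)
next
  case False
  have "\<exists>g. schwartz g \<and> l2_norm_sq (\<lambda>x. f x - g x) \<le> ennreal (1 / 4 ^ n)" for n
    by (rule schwartz_dense[OF f]) simp
  then show ?thesis using False by metis
qed

text \<open>The extension is the almost everywhere limit of the transforms of rapidly converging
  Schwartz approximations.\<close>

lemma is_cft_extension_exists:
  "\<exists>T :: (real ^ 'm::{finite,linorder} \<Rightarrow> real ^ ('m set)) \<Rightarrow> _. is_cft_extension \<sigma> T"
proof -
  have "\<forall>f :: (real, 'm) vec \<Rightarrow> real ^ ('m set). \<exists>s. square_integrable f \<longrightarrow> (\<forall>n. schwartz (s n)) \<and>
      (\<forall>n. l2_norm_sq (\<lambda>x. f x - s n x) \<le> ennreal (1 / 4 ^ n)) \<and> (schwartz f \<longrightarrow> (\<forall>n. s n = f))"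
    using ex_schwartz_sequence by blast
  from choice[OF this] obtain s :: "((real, 'm) vec \<Rightarrow> real ^ ('m set)) \<Rightarrow> nat \<Rightarrow> (real, 'm) vec \<Rightarrow> real ^ ('m set)"
    where s: "\<And>f n. square_integrable f \<Longrightarrow> schwartz (s f n)"
      "\<And>f n. square_integrable f \<Longrightarrow> l2_norm_sq (\<lambda>x. f x - s f n x) \<le> ennreal (1 / 4 ^ n)"
      "\<And>f n. square_integrable f \<Longrightarrow> schwartz f \<Longrightarrow> s f n = f"
    by blast
  define G where "G f n = cft \<sigma> (s f n)" for f n
  define T where "T f y = lim (\<lambda>n. G f n y)" for f y
  have sm: "s f n \<in> borel_measurable lebesgue" "G f n \<in> borel_measurable lebesgue" "f \<in> borel_measurable lebesgue"
    if "square_integrable f" for f n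
    using that s(1)[OF that] unfolding G_def
    by (auto simp: square_integrable_def intro: lebesgue_measurable_borel schwartz_borel_measurable cft_schwartz_measurable)
  have GG: "l2_norm_sq (\<lambda>y. G f n y - G g k y) = l2_norm_sq (\<lambda>x. s f n x - s g k x)"
    if "square_integrable f" "square_integrable g" for f g n k
    unfolding G_def by (intro l2_norm_sq_cft_diff s that)
  have ss: "l2_norm_sq (\<lambda>x. s f n x - s f k x) \<le> ennreal (4 / 4 ^ k)" if f: "square_integrable f" and "k \<le> n" for f n k
  proof -
    have "l2_norm_sq (\<lambda>x. s f n x - s f k x) \<le> 2 * l2_norm_sq (\<lambda>x. s f n x - f x) + 2 * l2_norm_sq (\<lambda>x. f x - s f k x)"
      by (intro l2_norm_sq_triangle sm f)
    also have "\<dots> \<le> 2 * ennreal (1 / 4 ^ n) + 2 * ennreal (1 / 4 ^ k)"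
      using s(2)[OF f] by (intro add_mono mult_left_mono) (auto simp: l2_norm_sq_minus_commute[of "s f n"])
    also have "\<dots> \<le> 2 * ennreal (1 / 4 ^ k) + 2 * ennreal (1 / 4 ^ k)"
      using \<open>k \<le> n\<close> by (intro add_mono mult_left_mono ennreal_leI divide_left_mono power_increasing) auto
    also have "\<dots> = ennreal (4 / 4 ^ k)"
      by (simp add: ennreal_mult[symmetric] ennreal_plus[symmetric] ennreal_numeral[symmetric] del: ennreal_numeral ennreal_plus)
    finally show ?thesis .
  qed
  have Tm: "T f \<in> borel_measurable lebesgue" if "square_integrable f" for f
    unfolding T_def[abs_def] by (rule borel_measurable_lim_metric) (rule sm(2)[OF that])
  have Tlim: "AE y in lebesgue. (\<lambda>n. G f n y) \<longlonglongrightarrow> T f y" if f: "square_integrable f" for f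
  proof -
    have "AE y in lebesgue. convergent (\<lambda>n. G f n y)"
      using ss[OF f, of _ "Suc _"] GG[OF f f] ss[OF f le_SucI[OF order_refl]]
      by (intro l2_fast_Cauchy_convergent[of _ 4] sm(2)[OF f]) simp_all
    then show ?thesis by eventually_elim (simp add: T_def convergent_LIMSEQ_iff)
  qed
  have TG: "l2_norm_sq (\<lambda>y. T f y - G f k y) \<le> ennreal (4 / 4 ^ k)" if f: "square_integrable f" for f k
  proof (rule l2_norm_sq_liminf[where G = "\<lambda>n. G f (n + k)"])
    show "AE x in lebesgue. (\<lambda>n. G f (n + k) x) \<longlonglongrightarrow> T f x"
      using Tlim[OF f] by eventually_elim (rule LIMSEQ_ignore_initial_segment)
    show "l2_norm_sq (\<lambda>x. G f (n + k) x - G f k x) \<le> ennreal (4 / 4 ^ k)" for n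
      unfolding GG[OF f f] by (rule ss[OF f]) simp
  qed (intro sm f)+
  have Tsq: "square_integrable (T f)" if f: "square_integrable f" for f
    unfolding square_integrable_def
  proof (intro conjI Tm f)
    have "l2_norm_sq (\<lambda>y. (T f y - G f 0 y) + G f 0 y) \<le> 2 * l2_norm_sq (\<lambda>y. T f y - G f 0 y) + 2 * l2_norm_sq (G f 0)"
      by (intro l2_norm_sq_add borel_measurable_diff Tm sm f)
    also have "\<dots> \<le> 2 * ennreal (4 / 4 ^ 0) + 2 * l2_norm_sq (G f 0)"
      by (intro add_mono mult_left_mono TG f) auto
    also have "\<dots> < \<infinity>"
      using schwartz_square_integrable(2)[OF s(1)[OF f], of \<sigma> 0]
      by (simp add: square_integrable_def G_def ennreal_mult_less_top)
    finally show "l2_norm_sq (T f) < \<infinity>" by simp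
  qed
  \<comment> \<open>Continuity as a Lipschitz bound for squared distances. Four nested triangle
    inequalities give the factor \<open>16 = 2 ^ 4\<close> and a remainder
    \<open>48 * (1 / 4) ^ k\<close>, which vanishes as \<open>k\<close> grows.\<close>
  have lip: "l2_norm_sq (\<lambda>y. T g y - T f y) \<le> 16 * l2_norm_sq (\<lambda>x. g x - f x)"
    if f: "square_integrable f" and g: "square_integrable g" for f g
  proof -
    have le: "l2_norm_sq (\<lambda>y. T g y - T f y) \<le> ennreal (48 * (1 / 4) ^ k) + 16 * l2_norm_sq (\<lambda>x. g x - f x)" for k
    proof -
      let ?c = "ennreal ((1 / 4) ^ k)"
      have c: "ennreal (4 / 4 ^ k) = 4 * ?c" "ennreal (1 / 4 ^ k) = ?c" "ennreal (48 * (1 / 4) ^ k) = 48 * ?c"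
        by (simp_all add: ennreal_mult[symmetric] power_divide ennreal_numeral[symmetric] del: ennreal_numeral)
      have "l2_norm_sq (\<lambda>y. T g y - T f y) \<le> 2 * l2_norm_sq (\<lambda>y. T g y - G g k y) + 2 * l2_norm_sq (\<lambda>y. G g k y - T f y)"
        by (intro l2_norm_sq_triangle Tm sm f g)
      also have "l2_norm_sq (\<lambda>y. G g k y - T f y) \<le> 2 * l2_norm_sq (\<lambda>y. G g k y - G f k y) + 2 * l2_norm_sq (\<lambda>y. G f k y - T f y)"
        by (intro l2_norm_sq_triangle Tm sm f g)
      also have "l2_norm_sq (\<lambda>y. G g k y - G f k y) \<le> 2 * l2_norm_sq (\<lambda>x. s g k x - g x) + 2 * l2_norm_sq (\<lambda>x. g x - s f k x)"
        unfolding GG[OF g f] by (intro l2_norm_sq_triangle sm f g)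
      also have "l2_norm_sq (\<lambda>x. g x - s f k x) \<le> 2 * l2_norm_sq (\<lambda>x. g x - f x) + 2 * l2_norm_sq (\<lambda>x. f x - s f k x)"
        by (intro l2_norm_sq_triangle sm f g)
      also have "l2_norm_sq (\<lambda>x. f x - s f k x) \<le> ?c" using s(2)[OF f, of k] unfolding c .
      also have "l2_norm_sq (\<lambda>x. s g k x - g x) \<le> ?c"
        using s(2)[OF g, of k] unfolding c l2_norm_sq_minus_commute[of g] .
      also have "l2_norm_sq (\<lambda>y. G f k y - T f y) \<le> 4 * ?c"
        using TG[OF f, of k] unfolding c l2_norm_sq_minus_commute[of "T f"] .
      also have "l2_norm_sq (\<lambda>y. T g y - G g k y) \<le> 4 * ?c"
        using TG[OF g, of k] unfolding c .
      finally have "l2_norm_sq (\<lambda>y. T g y - T f y) \<le> 2 * (4 * ?c) + 2 * (2 * (2 * ?c + 2 * (2 * l2_norm_sq (\<lambda>x. g x - f x) + 2 * ?c)) + 2 * (4 * ?c))"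
        by (simp add: mult_left_mono add_mono)
      also have "\<dots> = 48 * ?c + 16 * l2_norm_sq (\<lambda>x. g x - f x)"
      proof -
        have "48 * ?c = 8 * ?c + (8 * ?c + (16 * ?c + 16 * ?c))"
          by (simp only: distrib_right[symmetric]) simp
        then show ?thesis by (simp add: algebra_simps)
      qed
      finally show ?thesis unfolding c .
    qed
    have "(\<lambda>k. ennreal (48 * (1 / 4) ^ k)) \<longlonglongrightarrow> ennreal (48 * 0)"
      by (intro tendsto_ennrealI tendsto_intros LIMSEQ_realpow_zero) auto
    then have "(\<lambda>k. ennreal (48 * (1 / 4) ^ k) + 16 * l2_norm_sq (\<lambda>x. g x - f x)) \<longlonglongrightarrow> 0 + 16 * l2_norm_sq (\<lambda>x. g x - f x)"
      by (intro tendsto_add tendsto_const) simp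
    then show ?thesis using le by (intro LIMSEQ_le_const) auto
  qed
  have "is_cft_extension \<sigma> T"
    unfolding is_cft_extension_def
  proof (intro conjI allI impI)
    show "square_integrable (T f)" if "square_integrable f" for f using Tsq[OF that] .
    show "AE y in lebesgue. T f y = cft \<sigma> f y" if "schwartz f" for f
      using s(3)[OF schwartz_square_integrable(1)[OF that] that] by (simp add: T_def G_def)
    fix f :: "(real, 'm) vec \<Rightarrow> real ^ ('m set)" and g
    assume *: "square_integrable f \<and> (\<forall>n. square_integrable (g n)) \<and> (\<lambda>n. l2_norm_sq (\<lambda>x. g n x - f x)) \<longlonglongrightarrow> 0"
    then have "(\<lambda>n. 16 * l2_norm_sq (\<lambda>x. g n x - f x)) \<longlonglongrightarrow> 16 * 0"
      by (intro ennreal_tendsto_cmult) auto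
    then have "(\<lambda>n. 16 * l2_norm_sq (\<lambda>x. g n x - f x)) \<longlonglongrightarrow> 0" by simp
    then show "(\<lambda>n. l2_norm_sq (\<lambda>y. T (g n) y - T f y)) \<longlonglongrightarrow> 0"
    proof (rule tendsto_sandwich[OF _ _ tendsto_const, rotated 2])
      show "\<forall>\<^sub>F n in sequentially. l2_norm_sq (\<lambda>y. T (g n) y - T f y) \<le> 16 * l2_norm_sq (\<lambda>x. g n x - f x)"
        by (rule always_eventually, rule allI, rule lip) (use * in simp_all)
    qed simp
  qed
  then show ?thesis by blast
qed

lemma cft_l2_extension: "is_cft_extension \<sigma> (cft_l2 \<sigma>)"
  unfolding cft_l2_def by (rule someI_ex[OF is_cft_extension_exists])

section \<open>Plancherel's formula and the heat energy for square integrable functions\<close>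

lemma integral_norm_sq_tendsto:
  fixes u :: "'a::euclidean_space \<Rightarrow> 'b::euclidean_space"
  assumes [measurable]: "u \<in> borel_measurable M" "\<And>n. U n \<in> borel_measurable M"
    and int: "integrable M (\<lambda>x. (norm (u x))\<^sup>2)" "\<And>n. integrable M (\<lambda>x. (norm (U n x - u x))\<^sup>2)"
    and lim: "(\<lambda>n. \<integral>x. (norm (U n x - u x))\<^sup>2 \<partial>M) \<longlonglongrightarrow> 0"
  shows "(\<lambda>n. \<integral>x. (norm (U n x))\<^sup>2 \<partial>M) \<longlonglongrightarrow> (\<integral>x. (norm (u x))\<^sup>2 \<partial>M)"
proof -
  define e where "e n = (\<integral>x. (norm (U n x - u x))\<^sup>2 \<partial>M)" for n
  \<comment> \<open>Balances the two parts of Young's inequality: both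
    \<open>e n / \<delta> n\<close> and \<open>\<delta> n\<close> tend to 0. The summand
    \<open>1 / real (Suc n)\<close> keeps \<open>\<delta> n\<close> positive when
    \<open>e n = 0\<close>.\<close>
  define \<delta> where "\<delta> n = sqrt (e n) + 1 / real (Suc n)" for n
  let ?I = "\<integral>x. (norm (u x))\<^sup>2 \<partial>M"
  have e0: "0 \<le> e n" for n unfolding e_def by (rule Bochner_Integration.integral_nonneg) simp
  have \<delta>0: "0 < \<delta> n" for n using e0[of n] by (simp add: \<delta>_def add_nonneg_pos)
  have intU: "integrable M (\<lambda>x. (norm (U n x))\<^sup>2)" for n
  proof (rule Bochner_Integration.integrable_bound)
    show "integrable M (\<lambda>x. 2 * (norm (U n x - u x))\<^sup>2 + 2 * (norm (u x))\<^sup>2)"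
      by (intro Bochner_Integration.integrable_add integrable_mult_right int)
    show "AE x in M. norm ((norm (U n x))\<^sup>2) \<le> norm (2 * (norm (U n x - u x))\<^sup>2 + 2 * (norm (u x))\<^sup>2)"
    proof (rule AE_I2)
      fix x
      show "norm ((norm (U n x))\<^sup>2) \<le> norm (2 * (norm (U n x - u x))\<^sup>2 + 2 * (norm (u x))\<^sup>2)"
        using norm_add_sq_le[of "U n x - u x" "u x"] by simp
    qed
  qed measurable
  have "\<bar>(\<integral>x. (norm (U n x))\<^sup>2 \<partial>M) - ?I\<bar> \<le> e n + sqrt (e n) + \<delta> n * ?I" for n
  proof -
    have pw: "\<bar>(norm (U n x))\<^sup>2 - (norm (u x))\<^sup>2\<bar> \<le> (1 + 1 / \<delta> n) * (norm (U n x - u x))\<^sup>2 + \<delta> n * (norm (u x))\<^sup>2" for x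
    proof -
      let ?d = "U n x - u x"
      have "(norm (U n x))\<^sup>2 - (norm (u x))\<^sup>2 = (norm ?d)\<^sup>2 + 2 * (?d \<bullet> u x)"
        unfolding power2_norm_eq_inner by (simp add: inner_diff_left inner_diff_right inner_commute)
      moreover have "\<bar>?d \<bullet> u x\<bar> \<le> norm ?d * norm (u x)" by (rule Cauchy_Schwarz_ineq2)
      moreover have "2 * (norm ?d * norm (u x)) \<le> 1 / \<delta> n * (norm ?d)\<^sup>2 + \<delta> n * (norm (u x))\<^sup>2"
      proof -
        have "0 \<le> (norm ?d - \<delta> n * norm (u x))\<^sup>2 / \<delta> n" using \<delta>0[of n] by simp
        also have "\<dots> = 1 / \<delta> n * (norm ?d)\<^sup>2 + \<delta> n * (norm (u x))\<^sup>2 - 2 * (norm ?d * norm (u x))"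
          using \<delta>0[of n] by (simp add: power2_eq_square field_simps)
        finally show ?thesis by simp
      qed
      ultimately show ?thesis using zero_le_power2[of "norm ?d"] by (simp only: distrib_right)
    qed
    have "\<bar>\<integral>x. (norm (U n x))\<^sup>2 - (norm (u x))\<^sup>2 \<partial>M\<bar> \<le> (\<integral>x. (1 + 1 / \<delta> n) * (norm (U n x - u x))\<^sup>2 + \<delta> n * (norm (u x))\<^sup>2 \<partial>M)"
      by (rule integral_abs_bound_integral) (intro Bochner_Integration.integrable_diff Bochner_Integration.integrable_add integrable_mult_right intU int pw)+
    also have "\<dots> = (1 + 1 / \<delta> n) * e n + \<delta> n * ?I"
      unfolding e_def Bochner_Integration.integral_add[OF integrable_mult_right[OF int(2)] integrable_mult_right[OF int(1)]] integral_mult_right_zero ..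
    also have "1 / \<delta> n * e n \<le> sqrt (e n)"
    proof -
      have "e n = sqrt (e n) * sqrt (e n)" using e0 by simp
      also have "\<dots> \<le> sqrt (e n) * \<delta> n" using e0 by (intro mult_left_mono) (simp_all add: \<delta>_def)
      finally show ?thesis using \<delta>0[of n] by (simp add: field_simps)
    qed
    then have "(1 + 1 / \<delta> n) * e n + \<delta> n * ?I \<le> e n + sqrt (e n) + \<delta> n * ?I" by (simp only: distrib_right)
    finally show ?thesis unfolding Bochner_Integration.integral_diff[OF intU int(1)] .
  qed
  then have b: "\<forall>\<^sub>F n in sequentially. norm ((\<integral>x. (norm (U n x))\<^sup>2 \<partial>M) - ?I) \<le> e n + sqrt (e n) + \<delta> n * ?I"
    by (simp only: real_norm_def always_eventually simp_thms)
  have "(\<lambda>n. e n + sqrt (e n) + \<delta> n * ?I) \<longlonglongrightarrow> 0 + sqrt 0 + (sqrt 0 + 0) * ?I"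
    unfolding \<delta>_def by (intro tendsto_intros lim[folded e_def] LIMSEQ_Suc[OF lim_1_over_n])
  then have "(\<lambda>n. e n + sqrt (e n) + \<delta> n * ?I) \<longlonglongrightarrow> 0" by simp
  with b have "(\<lambda>n. (\<integral>x. (norm (U n x))\<^sup>2 \<partial>M) - ?I) \<longlonglongrightarrow> 0"
    by (rule Lim_null_comparison)
  then show ?thesis by (simp add: LIM_zero_iff)
qed

lemma heat_energy_nonneg: "0 \<le> heat_energy a f"
  unfolding heat_energy_def by (rule Bochner_Integration.integral_nonneg) simp

context
  fixes f :: "'a::euclidean_space \<Rightarrow> 'b::euclidean_space" and a :: real
  assumes f: "f \<in> borel_measurable borel" "integrable lborel (\<lambda>x. (norm (f x))\<^sup>2)" and a: "a > 0"
begin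

lemma heat_energy_integrable:
  "integrable (lborel \<Otimes>\<^sub>M lborel) (\<lambda>z. heat a (snd z - fst z) * (norm (f (snd z) - f (fst z)))\<^sup>2)"
  using heat_pair_diff_integrable(1)[OF f a, of "\<lambda>_. 1"] by (simp add: integrable_heat[OF a])

lemma heat_energy_eq:
  "heat_energy a f = 2 * (\<integral>x. (norm (f x))\<^sup>2 \<partial>lborel) -
     2 * (\<integral>z. heat a (snd z - fst z) * (f (fst z) \<bullet> f (snd z)) \<partial>(lborel \<Otimes>\<^sub>M lborel))"
  using heat_pair_diff_integrable(3)[OF f a, of "\<lambda>_. 1"]
  by (simp add: heat_energy_def integrable_heat[OF a] integral_heat[OF a])

text \<open>Applied to differences, this makes the heat energy continuous in L2 at fixed
  \<open>a\<close>.\<close>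

lemma heat_energy_le: "heat_energy a f \<le> 4 * (\<integral>x. (norm (f x))\<^sup>2 \<partial>lborel)"
proof -
  note 1 = heat_pair_fst[OF f a, of "\<lambda>_. 1"] and 2 = heat_pair_snd[OF f a, of "\<lambda>_. 1"]
  have i: "integrable (lborel \<Otimes>\<^sub>M lborel) (\<lambda>z. heat a (snd z - fst z) * (norm (f (fst z)))\<^sup>2)"
    "integrable (lborel \<Otimes>\<^sub>M lborel) (\<lambda>z. heat a (snd z - fst z) * (norm (f (snd z)))\<^sup>2)"
    using 1(1) 2(1) by (simp_all add: integrable_heat[OF a])
  have "heat_energy a f \<le> (\<integral>z. 2 * (heat a (snd z - fst z) * (norm (f (snd z)))\<^sup>2) + 2 * (heat a (snd z - fst z) * (norm (f (fst z)))\<^sup>2) \<partial>(lborel \<Otimes>\<^sub>M lborel))"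
    unfolding heat_energy_def
  proof (rule integral_mono[OF heat_energy_integrable])
    show "integrable (lborel \<Otimes>\<^sub>M lborel) (\<lambda>z. 2 * (heat a (snd z - fst z) * (norm (f (snd z)))\<^sup>2) + 2 * (heat a (snd z - fst z) * (norm (f (fst z)))\<^sup>2))"
      by (intro Bochner_Integration.integrable_add integrable_mult_right i)
    fix z :: "'a \<times> 'a"
    have "(norm (f (snd z) - f (fst z)))\<^sup>2 \<le> 2 * (norm (f (snd z)))\<^sup>2 + 2 * (norm (f (fst z)))\<^sup>2"
      using norm_add_sq_le[of "f (snd z)" "- f (fst z)"] by simp
    from mult_left_mono[OF this heat_nonneg[of a "snd z - fst z"]]
    show "heat a (snd z - fst z) * (norm (f (snd z) - f (fst z)))\<^sup>2 \<le>
        2 * (heat a (snd z - fst z) * (norm (f (snd z)))\<^sup>2) + 2 * (heat a (snd z - fst z) * (norm (f (fst z)))\<^sup>2)"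
      by (simp add: algebra_simps)
  qed
  also have "\<dots> = 4 * (\<integral>x. (norm (f x))\<^sup>2 \<partial>lborel)"
    unfolding Bochner_Integration.integral_add[OF integrable_mult_right[OF i(2)] integrable_mult_right[OF i(1)]] integral_mult_right_zero
    using 1(2) 2(2) by (simp add: integrable_heat[OF a] integral_heat[OF a])
  finally show ?thesis .
qed

end

lemma square_integrable_iff:
  "square_integrable f \<longleftrightarrow> f \<in> borel_measurable lebesgue \<and> integrable lebesgue (\<lambda>x. (norm (f x))\<^sup>2)"
  unfolding square_integrable_def l2_norm_sq_def integrable_iff_bounded
  by (auto intro: borel_measurable_power borel_measurable_norm)

lemma l2_norm_sq_eq_integral:
  "square_integrable f \<Longrightarrow> l2_norm_sq f = ennreal (\<integral>x. (norm (f x))\<^sup>2 \<partial>lebesgue)"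
  unfolding square_integrable_iff l2_norm_sq_def by (intro nn_integral_eq_integral) auto

lemma square_integrable_diff:
  fixes f g :: "'a::euclidean_space \<Rightarrow> 'b::euclidean_space"
  assumes "square_integrable f" "square_integrable g"
  shows "square_integrable (\<lambda>x. f x - g x)"
proof -
  have m: "f \<in> borel_measurable lebesgue" "g \<in> borel_measurable lebesgue"
    using assms by (auto simp: square_integrable_def)
  have "l2_norm_sq (\<lambda>x. f x - g x) \<le> 2 * l2_norm_sq (\<lambda>x. f x - 0) + 2 * l2_norm_sq (\<lambda>x. 0 - g x)"
    by (intro l2_norm_sq_triangle m borel_measurable_const)
  also have "\<dots> < \<infinity>"
    using assms by (simp add: square_integrable_def l2_norm_sq_def ennreal_mult_less_top)
  finally show ?thesis unfolding square_integrable_def using borel_measurable_diff[OF m] by blast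
qed

lemma l2_norm_sq_tendsto_0_iff:
  assumes "\<And>n. square_integrable (U n)"
  shows "(\<lambda>n. l2_norm_sq (U n)) \<longlonglongrightarrow> 0 \<longleftrightarrow> (\<lambda>n. \<integral>x. (norm (U n x))\<^sup>2 \<partial>lebesgue) \<longlonglongrightarrow> 0"
  unfolding l2_norm_sq_eq_integral[OF assms]
  by (rule ennreal_tendsto_0_iff) (simp add: Bochner_Integration.integral_nonneg)

text \<open>Both identities hold for Schwartz functions and all terms are L2 continuous. The
  weighted norm is treated as the plain norm of \<open>sqrt\<close> of the weight times
  \<open>T f\<close>, the heat energy as the norm of \<open>sqrt\<close> of the heat kernel times
  the increment, so that \<open>integral_norm_sq_tendsto\<close> covers every limit.\<close>

lemma cft_extension_norms:
  fixes f :: "real ^ 'm::{finite,linorder} \<Rightarrow> real ^ ('m set)"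
  assumes T: "is_cft_extension \<sigma> T"
    and f: "f \<in> borel_measurable borel" "square_integrable f" and a: "a > 0"
  shows "(\<integral>y. (norm (T f y))\<^sup>2 \<partial>lebesgue) = (\<integral>x. (norm (f x))\<^sup>2 \<partial>lborel)"
    and "(\<integral>y. exp (- (1 / (4 * a)) * (norm y)\<^sup>2) * (norm (T f y))\<^sup>2 \<partial>lebesgue) =
      (\<integral>x. (norm (f x))\<^sup>2 \<partial>lborel) - heat_energy a f / 2"
proof -
  let ?w = "\<lambda>y :: (real, 'm) vec. exp (- (1 / (4 * a)) * (norm y)\<^sup>2)"
  obtain s where s: "\<And>n. schwartz (s n)" and sl: "\<And>n. l2_norm_sq (\<lambda>x. f x - s n x) \<le> ennreal (1 / 4 ^ n)"
    using ex_schwartz_sequence[OF f(2)] by blast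
  have ssq: "square_integrable (s n)" for n by (rule schwartz_square_integrable(1)[OF s])
  have sb: "s n \<in> borel_measurable borel" for n by (rule schwartz_borel_measurable[OF s])
  have Tsq: "square_integrable (T g)" if "square_integrable g" for g
    using T that unfolding is_cft_extension_def by blast
  have Ts: "AE y in lebesgue. T (s n) y = cft \<sigma> (s n) y" for n
    using T s unfolding is_cft_extension_def by blast
  have lim: "(\<lambda>n. l2_norm_sq (\<lambda>x. s n x - f x)) \<longlonglongrightarrow> 0"
  proof (rule tendsto_sandwich[OF _ _ tendsto_const, rotated 2])
    show "\<forall>\<^sub>F n in sequentially. l2_norm_sq (\<lambda>x. s n x - f x) \<le> ennreal ((1 / 4) ^ n)"
      using sl by (intro always_eventually) (simp add: l2_norm_sq_minus_commute[of f] power_divide)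
    have "(\<lambda>n. ennreal ((1 / 4) ^ n)) \<longlonglongrightarrow> ennreal 0"
      by (intro tendsto_ennrealI LIMSEQ_realpow_zero) auto
    then show "(\<lambda>n. ennreal ((1 / 4) ^ n)) \<longlonglongrightarrow> 0" by simp
  qed simp
  then have "(\<lambda>n. l2_norm_sq (\<lambda>y. T (s n) y - T f y)) \<longlonglongrightarrow> 0"
    using T f(2) ssq unfolding is_cft_extension_def by blast
  then have limT: "(\<lambda>n. \<integral>y. (norm (T (s n) y - T f y))\<^sup>2 \<partial>lebesgue) \<longlonglongrightarrow> 0"
    by (subst (asm) l2_norm_sq_tendsto_0_iff) (intro square_integrable_diff Tsq ssq f)
  have limf: "(\<lambda>n. \<integral>x. (norm (s n x - f x))\<^sup>2 \<partial>lebesgue) \<longlonglongrightarrow> 0"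
    using lim by (subst (asm) l2_norm_sq_tendsto_0_iff) (intro square_integrable_diff ssq f)
  have leb: "integrable lebesgue (\<lambda>x. (norm (g x))\<^sup>2) = integrable lborel (\<lambda>x. (norm (g x))\<^sup>2)"
     "(\<integral>x. (norm (g x))\<^sup>2 \<partial>lebesgue) = (\<integral>x. (norm (g x))\<^sup>2 \<partial>lborel)"
    if [measurable]: "g \<in> borel_measurable borel" for g :: "(real, 'm) vec \<Rightarrow> real ^ ('m set)"
    by (simp_all add: integrable_completion integral_completion)
  have sf: "(\<lambda>n. \<integral>x. (norm (s n x))\<^sup>2 \<partial>lborel) \<longlonglongrightarrow> (\<integral>x. (norm (f x))\<^sup>2 \<partial>lborel)"
    using integral_norm_sq_tendsto[OF _ _ _ _ limf] f ssq square_integrable_diff[OF ssq f(2)]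
    unfolding square_integrable_iff by (simp add: leb sb)
  have TT: "(\<lambda>n. \<integral>y. (norm (T (s n) y))\<^sup>2 \<partial>lebesgue) \<longlonglongrightarrow> (\<integral>y. (norm (T f y))\<^sup>2 \<partial>lebesgue)"
    using Tsq[OF f(2)] Tsq[OF ssq] square_integrable_diff[OF Tsq[OF ssq] Tsq[OF f(2)]]
    unfolding square_integrable_iff by (intro integral_norm_sq_tendsto limT) blast+
  have eqT: "(\<integral>y. (norm (T (s n) y))\<^sup>2 \<partial>lebesgue) = (\<integral>x. (norm (s n x))\<^sup>2 \<partial>lborel)" for n
  proof -
    have "l2_norm_sq (T (s n)) = l2_norm_sq (s n)"
      using l2_norm_sq_cong_AE[OF Ts[of n]] cft_schwartz_norm[OF s[of n], of \<sigma>] by simp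
    then have "ennreal (\<integral>y. (norm (T (s n) y))\<^sup>2 \<partial>lebesgue) = ennreal (\<integral>x. (norm (s n x))\<^sup>2 \<partial>lborel)"
      unfolding l2_norm_sq_eq_integral[OF ssq] l2_norm_sq_eq_integral[OF Tsq[OF ssq]] leb(2)[OF sb] .
    then show ?thesis by (subst (asm) ennreal_inj) (simp_all add: Bochner_Integration.integral_nonneg)
  qed
  show "(\<integral>y. (norm (T f y))\<^sup>2 \<partial>lebesgue) = (\<integral>x. (norm (f x))\<^sup>2 \<partial>lborel)"
    using LIMSEQ_unique[OF TT[unfolded eqT] sf] .
  have sw: "(norm (sqrt r *\<^sub>R v))\<^sup>2 = r * (norm v)\<^sup>2" if "0 \<le> r" for r and v :: "'c::real_normed_vector"
    using that by (simp add: power_mult_distrib)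
  have w1: "0 \<le> ?w y" "?w y \<le> 1" for y using a by auto
  have wm: "(\<lambda>y. sqrt (?w y)) \<in> borel_measurable lebesgue"
    by (rule lebesgue_measurable_borel) measurable
  have wint: "integrable lebesgue (\<lambda>y. ?w y * (norm (g y))\<^sup>2)" if g: "square_integrable g" for g :: "(real, 'm) vec \<Rightarrow> complex ^ ('m set)"
  proof (rule Bochner_Integration.integrable_bound)
    show gi: "integrable lebesgue (\<lambda>y. (norm (g y))\<^sup>2)" using g by (simp add: square_integrable_iff)
    show "(\<lambda>y. ?w y * (norm (g y))\<^sup>2) \<in> borel_measurable lebesgue"
      by (intro borel_measurable_times borel_measurable_integrable[OF gi] lebesgue_measurable_borel) measurable
    show "AE y in lebesgue. norm (?w y * (norm (g y))\<^sup>2) \<le> norm ((norm (g y))\<^sup>2)"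
      using mult_right_mono[OF w1(2)] by (intro AE_I2) (simp add: abs_mult)
  qed
  have limw: "(\<lambda>n. \<integral>y. ?w y * (norm (T (s n) y - T f y))\<^sup>2 \<partial>lebesgue) \<longlonglongrightarrow> 0"
  proof (rule tendsto_sandwich[OF _ _ tendsto_const limT])
    show "\<forall>\<^sub>F n in sequentially. 0 \<le> (\<integral>y. ?w y * (norm (T (s n) y - T f y))\<^sup>2 \<partial>lebesgue)"
      by (intro always_eventually allI Bochner_Integration.integral_nonneg) simp
    have d: "square_integrable (\<lambda>y. T (s n) y - T f y)" for n
      by (intro square_integrable_diff Tsq ssq f)
    show "\<forall>\<^sub>F n in sequentially. (\<integral>y. ?w y * (norm (T (s n) y - T f y))\<^sup>2 \<partial>lebesgue) \<le> (\<integral>y. (norm (T (s n) y - T f y))\<^sup>2 \<partial>lebesgue)"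
    proof (intro always_eventually allI integral_mono wint d)
      show "integrable lebesgue (\<lambda>y. (norm (T (s n) y - T f y))\<^sup>2)" for n
        using d[of n] unfolding square_integrable_iff by blast
      show "?w y * (norm (T (s n) y - T f y))\<^sup>2 \<le> (norm (T (s n) y - T f y))\<^sup>2" for n y
        using mult_right_mono[OF w1(2)[of y], of "(norm (T (s n) y - T f y))\<^sup>2"] by simp
    qed
  qed
  have Tm: "T f \<in> borel_measurable lebesgue" "T (s n) \<in> borel_measurable lebesgue" for n
    using Tsq[OF f(2)] Tsq[OF ssq] by (auto simp: square_integrable_def)
  have WW: "(\<lambda>n. \<integral>y. ?w y * (norm (T (s n) y))\<^sup>2 \<partial>lebesgue) \<longlonglongrightarrow> (\<integral>y. ?w y * (norm (T f y))\<^sup>2 \<partial>lebesgue)"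
  proof -
    have "(\<lambda>n. \<integral>y. (norm (sqrt (?w y) *\<^sub>R T (s n) y))\<^sup>2 \<partial>lebesgue) \<longlonglongrightarrow> (\<integral>y. (norm (sqrt (?w y) *\<^sub>R T f y))\<^sup>2 \<partial>lebesgue)"
    proof (rule integral_norm_sq_tendsto)
      show "(\<lambda>y. sqrt (?w y) *\<^sub>R T f y) \<in> borel_measurable lebesgue" "(\<lambda>y. sqrt (?w y) *\<^sub>R T (s n) y) \<in> borel_measurable lebesgue" for n
        by (intro borel_measurable_scaleR wm Tm)+
      show "integrable lebesgue (\<lambda>y. (norm (sqrt (?w y) *\<^sub>R T f y))\<^sup>2)"
        unfolding sw[OF w1(1)] by (intro wint Tsq f)
      show "integrable lebesgue (\<lambda>y. (norm (sqrt (?w y) *\<^sub>R T (s n) y - sqrt (?w y) *\<^sub>R T f y))\<^sup>2)" for n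
        unfolding scaleR_diff_right[symmetric] sw[OF w1(1)] by (intro wint square_integrable_diff Tsq f ssq)
      show "(\<lambda>n. \<integral>y. (norm (sqrt (?w y) *\<^sub>R T (s n) y - sqrt (?w y) *\<^sub>R T f y))\<^sup>2 \<partial>lebesgue) \<longlonglongrightarrow> 0"
        unfolding scaleR_diff_right[symmetric] sw[OF w1(1)] by (rule limw)
    qed
    then show ?thesis unfolding sw[OF w1(1)] .
  qed
  have eqW: "(\<integral>y. ?w y * (norm (T (s n) y))\<^sup>2 \<partial>lebesgue) = (\<integral>x. (norm (s n x))\<^sup>2 \<partial>lborel) - heat_energy a (s n) / 2" for n
  proof -
    have cm: "(\<lambda>y. (norm (cft \<sigma> (s n) y))\<^sup>2 * ?w y) \<in> borel_measurable lborel"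
      using cft_schwartz_measurable[OF s[of n], of \<sigma>] by measurable
    have "(\<integral>y. ?w y * (norm (T (s n) y))\<^sup>2 \<partial>lebesgue) = (\<integral>y. (norm (cft \<sigma> (s n) y))\<^sup>2 * ?w y \<partial>lebesgue)"
    proof (rule integral_cong_AE)
      show "AE y in lebesgue. ?w y * (norm (T (s n) y))\<^sup>2 = (norm (cft \<sigma> (s n) y))\<^sup>2 * ?w y"
        using Ts[of n] by eventually_elim simp
    qed (use borel_measurable_integrable[OF wint[OF Tsq[OF ssq]]] measurable_completion[OF cm] in auto)
    also have "\<dots> = (\<integral>y. (norm (cft \<sigma> (s n) y))\<^sup>2 * ?w y \<partial>lborel)"
      by (rule integral_completion[OF cm])
    finally show ?thesis unfolding cft_schwartz_gaussian(2)[OF s a] .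
  qed
  have fi: "integrable lborel (\<lambda>x. (norm (f x))\<^sup>2)"
    using f by (simp add: square_integrable_iff leb)
  have EE: "(\<lambda>n. heat_energy a (s n)) \<longlonglongrightarrow> heat_energy a f"
  proof -
    let ?h = "\<lambda>z. heat a (snd z - fst z)"
    let ?u = "\<lambda>g z. sqrt (?h z) *\<^sub>R (g (snd z) - g (fst z)) :: real ^ ('m set)"
    have d: "(\<lambda>x. s n x - f x) \<in> borel_measurable borel" "integrable lborel (\<lambda>x. (norm (s n x - f x))\<^sup>2)" for n
      using borel_measurable_diff[OF sb f(1)] square_integrable_diff[OF ssq f(2)]
      by (simp_all add: square_integrable_iff leb)
    have diff: "?u (s n) z - ?u f z = ?u (\<lambda>x. s n x - f x) z" for n z
      unfolding scaleR_diff_right[symmetric] by (simp add: algebra_simps)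
    have "(\<lambda>n. \<integral>z. (norm (?u (s n) z))\<^sup>2 \<partial>(lborel \<Otimes>\<^sub>M lborel)) \<longlonglongrightarrow> (\<integral>z. (norm (?u f z))\<^sup>2 \<partial>(lborel \<Otimes>\<^sub>M lborel))"
    proof (rule integral_norm_sq_tendsto)
      show "?u f \<in> borel_measurable (lborel \<Otimes>\<^sub>M lborel)" "?u (s n) \<in> borel_measurable (lborel \<Otimes>\<^sub>M lborel)" for n
        using f(1) sb[of n] by measurable
      show "integrable (lborel \<Otimes>\<^sub>M lborel) (\<lambda>z. (norm (?u f z))\<^sup>2)"
        unfolding sw[OF heat_nonneg] by (rule heat_energy_integrable[OF f(1) fi a])
      show "integrable (lborel \<Otimes>\<^sub>M lborel) (\<lambda>z. (norm (?u (s n) z - ?u f z))\<^sup>2)" for n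
        unfolding diff sw[OF heat_nonneg] by (rule heat_energy_integrable[OF d a])
      have "(\<lambda>n. heat_energy a (\<lambda>x. s n x - f x)) \<longlonglongrightarrow> 0"
      proof (rule tendsto_sandwich[OF _ _ tendsto_const])
        show "\<forall>\<^sub>F n in sequentially. heat_energy a (\<lambda>x. s n x - f x) \<le> 4 * (\<integral>x. (norm (s n x - f x))\<^sup>2 \<partial>lborel)"
          by (intro always_eventually allI heat_energy_le d a)
        have "(\<lambda>n. 4 * (\<integral>x. (norm (s n x - f x))\<^sup>2 \<partial>lebesgue)) \<longlonglongrightarrow> 4 * 0"
          by (intro tendsto_mult tendsto_const limf)
        then show "(\<lambda>n. 4 * (\<integral>x. (norm (s n x - f x))\<^sup>2 \<partial>lborel)) \<longlonglongrightarrow> 0"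
          by (simp add: leb d)
      qed (simp add: heat_energy_nonneg)
      then show "(\<lambda>n. \<integral>z. (norm (?u (s n) z - ?u f z))\<^sup>2 \<partial>(lborel \<Otimes>\<^sub>M lborel)) \<longlonglongrightarrow> 0"
        unfolding diff sw[OF heat_nonneg] heat_energy_def .
    qed
    then show ?thesis unfolding sw[OF heat_nonneg] heat_energy_def .
  qed
  have "(\<lambda>n. (\<integral>x. (norm (s n x))\<^sup>2 \<partial>lborel) - heat_energy a (s n) / 2) \<longlonglongrightarrow> (\<integral>x. (norm (f x))\<^sup>2 \<partial>lborel) - heat_energy a f / 2"
    by (intro tendsto_intros sf EE) simp
  from LIMSEQ_unique[OF WW[unfolded eqW] this]
  show "(\<integral>y. ?w y * (norm (T f y))\<^sup>2 \<partial>lebesgue) = (\<integral>x. (norm (f x))\<^sup>2 \<partial>lborel) - heat_energy a f / 2" .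
qed

section \<open>The uncertainty inequality\<close>

text \<open>Heisenberg's inequality with the Dirichlet integral replaced by the heat energy. It is a
  discrete form of \<open>\<integral> \<langle>x f, \<nabla> f\<rangle> = - m/2 \<integral> |f|\<^sup>2\<close>: with \<open>u = x' - x\<close>,
  \<open>|u|\<^sup>2 \<langle>f x, f x'\<rangle>\<close> differs by terms odd in \<open>u\<close> from terms containing \<open>f x' - f x\<close>.\<close>

lemma heat_uncertainty:
  fixes f :: "'a::euclidean_space \<Rightarrow> 'b::euclidean_space"
  assumes f: "f \<in> borel_measurable borel" "integrable lborel (\<lambda>x. (norm (f x))\<^sup>2)"
    and X: "integrable lborel (\<lambda>x. (norm x)\<^sup>2 * (norm (f x))\<^sup>2)"
    and E: "\<And>a. a > 0 \<Longrightarrow> heat_energy a f \<le> M / (2 * a)" and t: "t > 0"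
  shows "DIM('a) * (\<integral>x. (norm (f x))\<^sup>2 \<partial>lborel) \<le> t * (\<integral>x. (norm x)\<^sup>2 * (norm (f x))\<^sup>2 \<partial>lborel) + M / t"
proof -
  let ?A = "\<integral>x. (norm (f x))\<^sup>2 \<partial>lborel"
  let ?X = "\<integral>x. (norm x)\<^sup>2 * (norm (f x))\<^sup>2 \<partial>lborel"
  let ?P = "lborel \<Otimes>\<^sub>M (lborel :: 'a measure)"
  let ?c = "2 powr (DIM('a) / 2) :: real"
  note [measurable] = f(1)
  \<comment> \<open>A comparison of the terms of order \<open>1 / a\<close>, multiplied by
    \<open>2 * a\<close>. The last summand is what is left of the terms of order
    \<open>1 / a\<^sup>2\<close>.\<close>
  have main: "DIM('a) * ?A \<le> t * ?X + M / t + ?c * M / a" if a: "a > 0" for a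
  proof -
    let ?h = "\<lambda>z :: 'a \<times> 'a. heat a (snd z - fst z)"
    let ?q = "\<lambda>u :: 'a. (norm u)\<^sup>2"
    \<comment> \<open>\<open>\<Psi>\<close> is odd in \<open>y - x\<close> and integrates to zero
      for each \<open>x\<close>; it is absolutely integrable because its first moment is dominated
      by a second one. \<open>Q\<close> yields the second moment of \<open>f\<close> divided by
      \<open>2 * a\<close>, and \<open>S\<close> is the remainder, quadratic both in the distance
      and in the increment.\<close>
    define \<Psi> where "\<Psi> x y = heat a (y - x) * ((y - x) \<bullet> x) * (norm (f x))\<^sup>2" for x y
    define Q where "Q x y = heat a (y - x) * ((y - x) \<bullet> x)\<^sup>2 * (norm (f x))\<^sup>2" for x y
    define S where "S z = ?h z * ?q (snd z - fst z) * (norm (f (snd z) - f (fst z)))\<^sup>2" for z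
    have q: "?q \<in> borel_measurable borel" "\<And>u. 0 \<le> ?q u" "integrable lborel (\<lambda>u. heat a u * ?q u)" "\<And>u. ?q (- u) = ?q u"
      by (simp_all add: integrable_heat_norm_sq[OF a])
    note D = heat_pair_diff_integrable[OF f a q, folded S_def]
    have hv: "integrable lborel (\<lambda>u. heat a u * (u \<bullet> v))" for v :: 'a
      by (intro integrable_heat_polynomial[OF a] real_polynomial_function.intros(1) bounded_linear_inner_left)
    have \<Psi>I: "integrable ?P (\<lambda>z. \<Psi> (fst z) (snd z))" and \<Psi>0: "(\<integral>z. \<Psi> (fst z) (snd z) \<partial>?P) = 0"
    proof -
      let ?k = "\<lambda>x u. heat a u * (u \<bullet> x) * (norm (f x))\<^sup>2"
      have m: "(\<lambda>z. ?k (fst z) (snd z)) \<in> borel_measurable borel"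
        unfolding borel_prod[symmetric] by measurable
      have i: "integrable lborel (?k x)" for x using hv[of x] by simp
      have K: "(\<integral>u. \<bar>?k x u\<bar> \<partial>lborel) \<le> (1 + (norm x)\<^sup>2 / (2 * a)) * (norm (f x))\<^sup>2" for x
      proof -
        have "(\<integral>u. \<bar>?k x u\<bar> \<partial>lborel) \<le> (\<integral>u. (heat a u + heat a u * (u \<bullet> x)\<^sup>2) * (norm (f x))\<^sup>2 \<partial>lborel)"
        proof (rule integral_mono)
          show "integrable lborel (\<lambda>u. \<bar>?k x u\<bar>)" by (intro integrable_abs i)
          show "integrable lborel (\<lambda>u. (heat a u + heat a u * (u \<bullet> x)\<^sup>2) * (norm (f x))\<^sup>2)"
            by (intro integrable_mult_left Bochner_Integration.integrable_add integrable_heat integrable_heat_inner_sq a)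
          fix u
          have "\<bar>u \<bullet> x\<bar> \<le> 1 + (u \<bullet> x)\<^sup>2"
          proof -
            have "2 * \<bar>u \<bullet> x\<bar> \<le> (u \<bullet> x)\<^sup>2 + 1"
              using zero_le_power2[of "\<bar>u \<bullet> x\<bar> - 1"] by (simp add: power2_diff)
            then show ?thesis using zero_le_power2[of "u \<bullet> x"] by linarith
          qed
          from mult_right_mono[OF mult_left_mono[OF this heat_nonneg[of a u]], of "(norm (f x))\<^sup>2"]
          show "\<bar>?k x u\<bar> \<le> (heat a u + heat a u * (u \<bullet> x)\<^sup>2) * (norm (f x))\<^sup>2"
            by (simp add: abs_mult distrib_left)
        qed
        also have "\<dots> = (1 + (norm x)\<^sup>2 / (2 * a)) * (norm (f x))\<^sup>2"
          by (simp add: integrable_heat[OF a] integrable_heat_inner_sq[OF a] integral_heat[OF a] integral_heat_inner_sq[OF a])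
        finally show ?thesis .
      qed
      have Ki: "integrable lborel (\<lambda>x. (1 + (norm x)\<^sup>2 / (2 * a)) * (norm (f x))\<^sup>2)"
        using Bochner_Integration.integrable_add[OF f(2) integrable_mult_right[OF X, of "1 / (2 * a)"]]
        by (simp add: distrib_right)
      show "integrable ?P (\<lambda>z. \<Psi> (fst z) (snd z))" unfolding \<Psi>_def
        by (rule pair_translate_integral(1)[OF m i K Ki])
      have "(\<integral>z. \<Psi> (fst z) (snd z) \<partial>?P) = (\<integral>x. (\<integral>u. ?k x u \<partial>lborel) \<partial>lborel)" unfolding \<Psi>_def
        by (rule pair_translate_integral(2)[OF m i K Ki])
      also have "\<dots> = 0" by (simp add: integral_heat_inner[OF a])
      finally show "(\<integral>z. \<Psi> (fst z) (snd z) \<partial>?P) = 0" .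
    qed
    have QI: "integrable ?P (\<lambda>z. Q (fst z) (snd z))" and QX: "(\<integral>z. Q (fst z) (snd z) \<partial>?P) = ?X / (2 * a)"
    proof -
      let ?k = "\<lambda>x u. heat a u * (u \<bullet> x)\<^sup>2 * (norm (f x))\<^sup>2"
      have m: "(\<lambda>z. ?k (fst z) (snd z)) \<in> borel_measurable borel"
        unfolding borel_prod[symmetric] by measurable
      have i: "integrable lborel (?k x)" for x
        by (intro integrable_mult_left integrable_heat_inner_sq[OF a])
      have e: "(\<integral>u. ?k x u \<partial>lborel) = 1 / (2 * a) * ((norm x)\<^sup>2 * (norm (f x))\<^sup>2)" for x
        by (simp add: integral_heat_inner_sq[OF a])
      have K: "(\<integral>u. \<bar>?k x u\<bar> \<partial>lborel) \<le> 1 / (2 * a) * ((norm x)\<^sup>2 * (norm (f x))\<^sup>2)" for x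
        using e[of x] by (simp add: abs_mult)
      note p = pair_translate_integral[OF m i K integrable_mult_right[OF X]]
      show "integrable ?P (\<lambda>z. Q (fst z) (snd z))" unfolding Q_def by (rule p(1))
      show "(\<integral>z. Q (fst z) (snd z) \<partial>?P) = ?X / (2 * a)"
        unfolding Q_def p(2) e integral_mult_right_zero by simp
    qed
    note \<Psi>s = pair_swap_integral[OF \<Psi>I, unfolded \<Psi>0] and Qs = pair_swap_integral[OF QI, unfolded QX]
    note EI = heat_energy_integrable[OF f a]
    have sym: "heat a (x - y) = heat a (y - x)" for x y :: 'a using heat_minus[of a "y - x"] by simp
    \<comment> \<open>The parameter \<open>t\<close> remains free here; it is optimised in
      \<open>square_le_of_young\<close>.\<close>
    have young: "r * (v \<bullet> w) \<le> t / 2 * (r\<^sup>2 * (norm v)\<^sup>2) + (norm w)\<^sup>2 / (2 * t)" for r and v w :: 'b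
    proof -
      have "r * (v \<bullet> w) \<le> \<bar>r\<bar> * (norm v * norm w)"
      proof -
        have "r * (v \<bullet> w) \<le> \<bar>r * (v \<bullet> w)\<bar>" by (rule abs_ge_self)
        also have "\<dots> = \<bar>r\<bar> * \<bar>v \<bullet> w\<bar>" by (rule abs_mult)
        also have "\<dots> \<le> \<bar>r\<bar> * (norm v * norm w)"
          by (intro mult_left_mono Cauchy_Schwarz_ineq2) simp
        finally show ?thesis .
      qed
      also have "\<dots> \<le> t / 2 * (r\<^sup>2 * (norm v)\<^sup>2) + (norm w)\<^sup>2 / (2 * t)"
      proof -
        have "0 \<le> (t * (\<bar>r\<bar> * norm v) - norm w)\<^sup>2 / (2 * t)" using t by simp
        also have "\<dots> = t / 2 * (r\<^sup>2 * (norm v)\<^sup>2) + (norm w)\<^sup>2 / (2 * t) - \<bar>r\<bar> * (norm v * norm w)"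
          using t by (simp add: power2_diff power_mult_distrib field_simps power2_eq_square)
        finally show ?thesis by simp
      qed
      finally show ?thesis .
    qed
    have pw: "?h z * ?q (snd z - fst z) * (f (fst z) \<bullet> f (snd z)) \<le>
        t / 2 * (Q (fst z) (snd z) + Q (snd z) (fst z)) + 1 / t * (?h z * (norm (f (snd z) - f (fst z)))\<^sup>2)
        - (\<Psi> (fst z) (snd z) + \<Psi> (snd z) (fst z))" for z
    proof -
      define x y where "x = fst z" and "y = snd z"
      define d where "d = f y - f x"
      \<comment> \<open>An exact identity resting on \<open>(norm (y - x))\<^sup>2 = (y - x)
        \<bullet> y - (y - x) \<bullet> x\<close>. The two terms with \<open>d\<close> are meant for
        Young's inequality; the other two are the odd terms \<open>\<Psi>\<close>.\<close>
      have "?q (y - x) * (f x \<bullet> f y) = (- ((y - x) \<bullet> x)) * (f x \<bullet> d) + (- ((y - x) \<bullet> y)) * (f y \<bullet> d)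
          + ((y - x) \<bullet> y) * (f y \<bullet> f y) - ((y - x) \<bullet> x) * (f x \<bullet> f x)"
        unfolding power2_norm_eq_inner d_def by (simp add: inner_diff_left inner_diff_right inner_commute algebra_simps)
      also have "\<dots> \<le> (t / 2 * (((y - x) \<bullet> x)\<^sup>2 * (norm (f x))\<^sup>2) + (norm d)\<^sup>2 / (2 * t)) +
          (t / 2 * (((y - x) \<bullet> y)\<^sup>2 * (norm (f y))\<^sup>2) + (norm d)\<^sup>2 / (2 * t))
          + ((y - x) \<bullet> y) * (f y \<bullet> f y) - ((y - x) \<bullet> x) * (f x \<bullet> f x)"
        using young[of "- ((y - x) \<bullet> x)" "f x" d] young[of "- ((y - x) \<bullet> y)" "f y" d] by simp
      also have "\<dots> = t / 2 * (((y - x) \<bullet> x)\<^sup>2 * (norm (f x))\<^sup>2 + ((y - x) \<bullet> y)\<^sup>2 * (norm (f y))\<^sup>2) + 1 / t * (norm d)\<^sup>2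
          + ((y - x) \<bullet> y) * (norm (f y))\<^sup>2 - ((y - x) \<bullet> x) * (norm (f x))\<^sup>2"
        using t unfolding power2_norm_eq_inner[of "f _"] by (simp add: field_simps)
      finally have "heat a (y - x) * (?q (y - x) * (f x \<bullet> f y)) \<le> heat a (y - x) * \<dots>"
        by (rule mult_left_mono) simp
      also have "\<dots> = t / 2 * (Q x y + Q y x) + 1 / t * (heat a (y - x) * (norm d)\<^sup>2) - (\<Psi> x y + \<Psi> y x)"
      proof -
        have n: "(x - y) \<bullet> y = - ((y - x) \<bullet> y)" by (simp add: inner_diff_left)
        obtain r1 r2 where r: "(y - x) \<bullet> x = r1" "(y - x) \<bullet> y = r2" by blast
        show ?thesis unfolding Q_def \<Psi>_def sym[of x y] n r power2_minus by (simp add: algebra_simps)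
      qed
      finally show ?thesis by (simp add: x_def y_def d_def mult.assoc)
    qed
    have RI: "integrable ?P (\<lambda>z. t / 2 * (Q (fst z) (snd z) + Q (snd z) (fst z)))"
      "integrable ?P (\<lambda>z. 1 / t * (?h z * (norm (f (snd z) - f (fst z)))\<^sup>2))"
      "integrable ?P (\<lambda>z. \<Psi> (fst z) (snd z) + \<Psi> (snd z) (fst z))"
      by (intro integrable_mult_right Bochner_Integration.integrable_add QI Qs EI \<Psi>I \<Psi>s)+
    have "(\<integral>z. ?h z * ?q (snd z - fst z) * (f (fst z) \<bullet> f (snd z)) \<partial>?P) \<le>
       (\<integral>z. t / 2 * (Q (fst z) (snd z) + Q (snd z) (fst z)) + 1 / t * (?h z * (norm (f (snd z) - f (fst z)))\<^sup>2)
        - (\<Psi> (fst z) (snd z) + \<Psi> (snd z) (fst z)) \<partial>?P)"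
      by (rule integral_mono[OF D(2) _ pw]) (intro Bochner_Integration.integrable_diff Bochner_Integration.integrable_add RI)
    also have "\<dots> = t / 2 * (?X / (2 * a) + ?X / (2 * a)) + 1 / t * heat_energy a f"
      unfolding Bochner_Integration.integral_diff[OF Bochner_Integration.integrable_add[OF RI(1,2)] RI(3)]
        Bochner_Integration.integral_add[OF RI(1,2)] integral_mult_right_zero
        Bochner_Integration.integral_add[OF QI Qs(1)] Bochner_Integration.integral_add[OF \<Psi>I \<Psi>s(1)] QX Qs(2) \<Psi>0 \<Psi>s(2) heat_energy_def
      by simp
    also have "\<dots> \<le> t * ?X / (2 * a) + M / (2 * a) / t"
      using divide_right_mono[OF E[OF a], of t] t by (simp add: field_simps)
    finally have 1: "DIM('a) / (2 * a) * ?A - (\<integral>z. S z \<partial>?P) / 2 \<le> t * ?X / (2 * a) + M / (2 * a) / t"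
      unfolding D(3) integral_heat_norm_sq[OF a] .
    \<comment> \<open>\<open>heat_norm_sq_le\<close> turns the extra squared distance into
      \<open>1 / a\<close>, and the heat energy at \<open>a / 2\<close> is again of order
      \<open>1 / a\<close>.\<close>
    have "(\<integral>z. S z \<partial>?P) \<le> (\<integral>z. ?c / a * (heat (a / 2) (snd z - fst z) * (norm (f (snd z) - f (fst z)))\<^sup>2) \<partial>?P)"
    proof (rule integral_mono[OF D(1)])
      show "integrable ?P (\<lambda>z. ?c / a * (heat (a / 2) (snd z - fst z) * (norm (f (snd z) - f (fst z)))\<^sup>2))"
        using a by (intro integrable_mult_right heat_energy_integrable[OF f]) simp
      show "S z \<le> ?c / a * (heat (a / 2) (snd z - fst z) * (norm (f (snd z) - f (fst z)))\<^sup>2)" for z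
        using mult_right_mono[OF heat_norm_sq_le[OF a, of "snd z - fst z"], of "(norm (f (snd z) - f (fst z)))\<^sup>2"]
        by (simp add: S_def mult.assoc)
    qed
    also have "\<dots> = ?c / a * heat_energy (a / 2) f"
      unfolding integral_mult_right_zero heat_energy_def ..
    also have "\<dots> \<le> ?c / a * (M / a)"
      using E[of "a / 2"] a by (intro mult_left_mono) auto
    finally have 2: "(\<integral>z. S z \<partial>?P) \<le> ?c / a * (M / a)" .
    have "DIM('a) / (2 * a) * ?A \<le> (t * ?X / (2 * a) + M / (2 * a) / t) + ?c / a * (M / a) / 2"
    proof -
      have "u \<le> v + w / 2" if "u - s / 2 \<le> v" "s \<le> w" for u v w s :: real
        using that by linarith
      then show ?thesis using 1 2 .
    qed
    then have "2 * a * (DIM('a) / (2 * a) * ?A) \<le> 2 * a * ((t * ?X / (2 * a) + M / (2 * a) / t) + ?c / a * (M / a) / 2)"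
      using a by (intro mult_left_mono) auto
    moreover have "2 * a * (d / (2 * a) * A) = d * A"
        "2 * a * ((t * x / (2 * a) + M / (2 * a) / t) + c / a * (M / a) / 2) = t * x + M / t + c * M / a" for d A x c
      using a t by (simp_all add: field_simps)
    ultimately show ?thesis by (simp only:)
  qed
  have "(\<lambda>n. t * ?X + M / t + ?c * M / real (Suc n)) \<longlonglongrightarrow> t * ?X + M / t + 0"
    by (intro tendsto_add tendsto_const LIMSEQ_Suc[OF lim_const_over_n])
  then have "DIM('a) * ?A \<le> t * ?X + M / t + 0"
    by (rule LIMSEQ_le_const) (intro exI allI impI main, simp)
  then show ?thesis by simp
qed

text \<open>The optimal parameter is \<open>t = sqrt (M / X)\<close>. Adding \<open>s > 0\<close> to
  both \<open>X\<close> and \<open>M\<close> avoids the cases where one of them vanishes; then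
  \<open>s\<close> tends to 0.\<close>

lemma square_le_of_young:
  fixes A X M :: real
  assumes le: "\<And>t. t > 0 \<Longrightarrow> A \<le> t * X + M / t" and nn: "0 \<le> A" "0 \<le> X" "0 \<le> M"
  shows "A\<^sup>2 \<le> 4 * (X * M)"
proof -
  have "A\<^sup>2 \<le> 4 * ((X + s) * (M + s))" if s: "s > 0" for s
  proof -
    define P R where "P = sqrt (X + s)" and "R = sqrt (M + s)"
    define t where "t = R / P"
    have PR: "X + s = P * P" "M + s = R * R" and pos: "0 < P" "0 < R"
      using nn s by (auto simp: P_def R_def)
    then have t: "t > 0" by (simp add: t_def)
    have "t * (X + s) = R * P" "(M + s) / t = R * P"
      using pos unfolding PR t_def by simp_all
    moreover have "t * X + M / t \<le> t * (X + s) + (M + s) / t"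
      using t s by (intro add_mono mult_left_mono divide_right_mono) auto
    ultimately have "A \<le> 2 * (R * P)" using le[OF t] by linarith
    then have "A\<^sup>2 \<le> (2 * (R * P))\<^sup>2" using nn(1) by (rule power_mono)
    then show ?thesis unfolding PR by (simp add: power2_eq_square mult_ac)
  qed
  note le' = this
  have "(\<lambda>n. 4 * ((X + 1 / real (Suc n)) * (M + 1 / real (Suc n)))) \<longlonglongrightarrow> 4 * ((X + 0) * (M + 0))"
    by (intro tendsto_intros LIMSEQ_Suc[OF lim_1_over_n])
  then have "A\<^sup>2 \<le> 4 * ((X + 0) * (M + 0))"
    by (rule LIMSEQ_le_const) (intro exI allI impI le', simp)
  then show ?thesis by simp
qed

text \<open>By the parallelogram law the inner product of the values at \<open>x\<close> and
  \<open>x + u\<close> is a Gaussian in \<open>u\<close> times the squared norm at the midpoint, so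
  the integral over \<open>x\<close>, taken first, is explicit. Only an upper bound for the energy
  is sought, since the opposite direction is the uncertainty inequality; it follows from
  \<open>1 - s \<le> exp (- s)\<close>.\<close>

lemma heat_energy_gaussian:
  fixes v :: "'b::euclidean_space" and p a :: real
  assumes p: "p > 0" and a: "a > 0"
  defines "f \<equiv> \<lambda>x::'a::euclidean_space. exp (- p * (norm x)\<^sup>2) *\<^sub>R v"
  shows "integrable lborel (\<lambda>x. (norm (f x))\<^sup>2)"
    and "integrable lborel (\<lambda>x. (norm x)\<^sup>2 * (norm (f x))\<^sup>2)"
    and "(\<integral>x. (norm x)\<^sup>2 * (norm (f x))\<^sup>2 \<partial>lborel) = DIM('a) / (4 * p) * (\<integral>x. (norm (f x))\<^sup>2 \<partial>lborel)"
    and "2 * a * heat_energy a f \<le> DIM('a) * p * (\<integral>x. (norm (f x))\<^sup>2 \<partial>lborel)"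
proof -
  let ?w = "\<lambda>x :: 'a. exp (- (2 * p) * (norm x)\<^sup>2)"
  \<comment> \<open>The total mass of the squared norm of \<open>f\<close>, which is
    \<open>C\<close> times the probability density \<open>heat (2 * p)\<close>.\<close>
  define C where "C = (norm v)\<^sup>2 / (2 * p / pi) powr (DIM('a) / 2)"
  have nf: "(norm (f x))\<^sup>2 = C * heat (2 * p) x" for x
  proof -
    have "(exp (- p * (norm x)\<^sup>2))\<^sup>2 = ?w x" by (simp add: exp_double[symmetric])
    then show ?thesis using p by (simp add: f_def heat_def C_def power_mult_distrib)
  qed
  have p2: "2 * p > 0" using p by simp
  show f2: "integrable lborel (\<lambda>x. (norm (f x))\<^sup>2)"
    unfolding nf by (intro integrable_mult_right integrable_heat p2)
  have A: "(\<integral>x. (norm (f x))\<^sup>2 \<partial>lborel) = C" unfolding nf by (simp add: integral_heat[OF p2])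
  have xf: "(norm x)\<^sup>2 * (norm (f x))\<^sup>2 = C * (heat (2 * p) x * (norm x)\<^sup>2)" for x unfolding nf by simp
  show "integrable lborel (\<lambda>x. (norm x)\<^sup>2 * (norm (f x))\<^sup>2)"
    unfolding xf by (intro integrable_mult_right integrable_heat_norm_sq p2)
  show "(\<integral>x. (norm x)\<^sup>2 * (norm (f x))\<^sup>2 \<partial>lborel) = DIM('a) / (4 * p) * (\<integral>x. (norm (f x))\<^sup>2 \<partial>lborel)"
    unfolding xf A by (simp add: integral_heat_norm_sq[OF p2])
  have fm: "f \<in> borel_measurable borel" unfolding f_def by measurable
  define k where "k x u = heat a u * exp (- (p / 2) * (norm u)\<^sup>2) * (norm (f (x + (1 / 2) *\<^sub>R u)))\<^sup>2" for x u
  have k0: "0 \<le> k x u" for x u by (simp add: k_def)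
  have kf: "k x u = heat a u * (f x \<bullet> f (x + u))" for x u
  proof -
    have "(norm x)\<^sup>2 + (norm (x + u))\<^sup>2 = 2 * (norm (x + (1 / 2) *\<^sub>R u))\<^sup>2 + (1 / 2) * (norm u)\<^sup>2"
      unfolding power2_norm_eq_inner by (simp add: algebra_simps inner_commute)
    then have "- (p / 2) * (norm u)\<^sup>2 + - p * (norm (x + (1 / 2) *\<^sub>R u))\<^sup>2 + - p * (norm (x + (1 / 2) *\<^sub>R u))\<^sup>2
        = - p * (norm x)\<^sup>2 + - p * (norm (x + u))\<^sup>2"
      by (simp add: algebra_simps flip: distrib_left)
    then have "exp (- (p / 2) * (norm u)\<^sup>2) * exp (- p * (norm (x + (1 / 2) *\<^sub>R u))\<^sup>2) * exp (- p * (norm (x + (1 / 2) *\<^sub>R u))\<^sup>2)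
        = exp (- p * (norm x)\<^sup>2) * exp (- p * (norm (x + u))\<^sup>2)"
      by (simp only: exp_add[symmetric])
    then show ?thesis
      by (simp add: k_def f_def power_mult_distrib power2_norm_eq_inner[of v] power2_eq_square[of "exp _"] mult.assoc[symmetric])
  qed
  have kb: "(\<lambda>z. k (fst z) (snd z)) \<in> borel_measurable borel"
    unfolding borel_prod[symmetric] k_def using fm by measurable
  have ku: "integrable lborel (\<lambda>x. k x u)"
    "(\<integral>x. k x u \<partial>lborel) = heat a u * exp (- (p / 2) * (norm u)\<^sup>2) * C" for u
  proof -
    have "integrable lborel (\<lambda>x. (norm (f (x + (1 / 2) *\<^sub>R u)))\<^sup>2)"
      using integrable_lborel_translate[OF f2, of "(1 / 2) *\<^sub>R u"] by (simp add: add.commute)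
    then show "integrable lborel (\<lambda>x. k x u)" unfolding k_def by (rule integrable_mult_right)
    have "(\<integral>x. (norm (f (x + (1 / 2) *\<^sub>R u)))\<^sup>2 \<partial>lborel) = C"
      using integral_lborel_translate[of "\<lambda>x. (norm (f x))\<^sup>2" "(1 / 2) *\<^sub>R u"] fm
      by (simp add: add.commute A)
    then show "(\<integral>x. k x u \<partial>lborel) = heat a u * exp (- (p / 2) * (norm u)\<^sup>2) * C"
      unfolding k_def by simp
  qed
  have C0: "0 \<le> C" by (simp add: C_def)
  have hi: "integrable lborel (\<lambda>u :: 'a. heat a u * exp (- (p / 2) * (norm u)\<^sup>2) * C)"
  proof (rule integrable_mult_left, rule Bochner_Integration.integrable_bound[OF integrable_heat[OF a]])
    show "AE u in lborel. norm (heat a (u::'a) * exp (- (p / 2) * (norm u)\<^sup>2)) \<le> norm (heat a u)"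
      using p by (intro AE_I2) (simp add: abs_mult mult_left_le)
  qed measurable
  have kI: "integrable (lborel \<Otimes>\<^sub>M lborel) (\<lambda>(u, x). k x u)"
  proof (rule lborel_pair.Fubini_integrable)
    have "(\<lambda>z. (snd z, fst z)) \<in> borel_measurable (borel :: ('a \<times> 'a) measure)"
      by (intro borel_measurable_continuous_onI continuous_intros)
    from measurable_compose[OF this kb]
    show "(\<lambda>(u, x). k x u) \<in> borel_measurable (lborel \<Otimes>\<^sub>M lborel)"
      by (simp add: case_prod_unfold lborel_prod)
    show "integrable lborel (\<lambda>u. \<integral>x. norm (case (u, x) of (u, x) \<Rightarrow> k x u) \<partial>lborel)"
      using hi by (simp add: k0 ku)
    show "AE u in lborel. integrable lborel (\<lambda>x. case (u, x) of (u, x) \<Rightarrow> k x u)"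
      by (simp add: ku)
  qed
  have kx: "integrable lborel (k x)" for x
  proof (rule Bochner_Integration.integrable_bound)
    show "integrable lborel (\<lambda>u. (norm v)\<^sup>2 * heat a (u::'a))" by (intro integrable_mult_right integrable_heat a)
    show "k x \<in> borel_measurable lborel"
      using borel_measurable_pair_section(1)[OF kb, of x] by simp
    show "AE u in lborel. norm (k x u) \<le> norm ((norm v)\<^sup>2 * heat a u)"
    proof (rule AE_I2)
      fix u
      have "(norm (f (x + (1 / 2) *\<^sub>R u)))\<^sup>2 \<le> (norm v)\<^sup>2"
        using p by (intro power_mono) (auto simp: f_def mult_left_le_one_le)
      moreover have "exp (- (p / 2) * (norm u)\<^sup>2) \<le> 1" using p by simp
      ultimately have "exp (- (p / 2) * (norm u)\<^sup>2) * (norm (f (x + (1 / 2) *\<^sub>R u)))\<^sup>2 \<le> 1 * (norm v)\<^sup>2"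
        by (intro mult_mono) auto
      from mult_left_mono[OF this heat_nonneg[of a u]]
      show "norm (k x u) \<le> norm ((norm v)\<^sup>2 * heat a u)" by (simp add: k_def abs_mult mult_ac)
    qed
  qed
  have "(\<integral>z. heat a (snd z - fst z) * (f (fst z) \<bullet> f (snd z)) \<partial>(lborel \<Otimes>\<^sub>M lborel)) =
      (\<integral>z. k (fst z) (snd z - fst z) \<partial>(lborel \<Otimes>\<^sub>M lborel))"
    by (simp add: kf)
  also have "\<dots> = (\<integral>x. (\<integral>u. k x u \<partial>lborel) \<partial>lborel)"
    by (rule pair_translate_integral(2)[OF kb kx _ lborel_pair.integrable_snd[OF kI]]) (simp add: k0)
  also have "\<dots> = (\<integral>u. (\<integral>x. k x u \<partial>lborel) \<partial>lborel)"
    by (rule lborel_pair.Fubini_integral[OF kI])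
  also have "\<dots> \<ge> (\<integral>u. C * heat a (u::'a) - C * (p / 2) * (heat a u * (norm u)\<^sup>2) \<partial>lborel)"
    unfolding ku
  proof (rule integral_mono[OF _ hi])
    show "integrable lborel (\<lambda>u. C * heat a (u::'a) - C * (p / 2) * (heat a u * (norm u)\<^sup>2))"
      by (intro Bochner_Integration.integrable_diff integrable_mult_right integrable_heat integrable_heat_norm_sq a)
    fix u :: 'a
    have "1 - (p / 2) * (norm u)\<^sup>2 \<le> exp (- (p / 2) * (norm u)\<^sup>2)"
      using exp_ge_add_one_self[of "- (p / 2) * (norm u)\<^sup>2"] by simp
    from mult_left_mono[OF this, of "C * heat a u"] C0
    show "C * heat a u - C * (p / 2) * (heat a u * (norm u)\<^sup>2) \<le> heat a u * exp (- (p / 2) * (norm u)\<^sup>2) * C"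
      by (simp add: algebra_simps)
  qed
  also (xtrans) have "(\<integral>u. C * heat a (u::'a) - C * (p / 2) * (heat a u * (norm u)\<^sup>2) \<partial>lborel) = C - C * (p / 2) * (DIM('a) / (2 * a))"
    by (subst Bochner_Integration.integral_diff)
      (simp_all add: integrable_heat[OF a] integrable_heat_norm_sq[OF a] integral_heat[OF a] integral_heat_norm_sq[OF a])
  finally have "heat_energy a f \<le> 2 * C - 2 * (C - C * (p / 2) * (DIM('a) / (2 * a)))"
    unfolding heat_energy_eq[OF fm f2 a] A by simp
  also have "\<dots> = DIM('a) * p * C / (2 * a)" by simp
  finally show "2 * a * heat_energy a f \<le> DIM('a) * p * (\<integral>x. (norm (f x))\<^sup>2 \<partial>lborel)"
    unfolding A using a by (simp add: field_simps)
qed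

section \<open>Borel representatives and degenerate cases\<close>

lemma lebesgue_measurable_borel_version:
  fixes f :: "'a::euclidean_space \<Rightarrow> 'b::euclidean_space"
  assumes f: "f \<in> borel_measurable lebesgue"
  shows "\<exists>g. g \<in> borel_measurable borel \<and> (AE x in lebesgue. f x = g x)"
proof -
  have "f measurable_on UNIV" by (rule lebesgue_measurable_imp_measurable_on[OF f]) simp
  then obtain N h where N: "negligible N" and h: "\<And>n. continuous_on UNIV (h n)"
    and lim: "\<And>x. x \<notin> N \<Longrightarrow> (\<lambda>n. h n x) \<longlonglongrightarrow> f x"
    unfolding measurable_on_def by auto
  have "(\<lambda>x. lim (\<lambda>n. h n x)) \<in> borel_measurable borel"
    by (intro borel_measurable_lim_metric borel_measurable_continuous_onI h)
  moreover have "AE x in lebesgue. x \<notin> N"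
    using N by (intro AE_not_in) (simp add: negligible_iff_null_sets)
  then have "AE x in lebesgue. f x = lim (\<lambda>n. h n x)"
    by eventually_elim (rule limI[OF lim, symmetric])
  ultimately show ?thesis by blast
qed

text \<open>Continuity of \<open>T\<close> is applied to the constant sequence \<open>f\<close>,
  which converges to \<open>g\<close> because their distance is 0.\<close>

lemma cft_extension_cong:
  fixes f g :: "real ^ 'm::{finite,linorder} \<Rightarrow> real ^ ('m set)"
  assumes T: "is_cft_extension \<sigma> T" and fg: "square_integrable f" "square_integrable g"
    and eq: "AE x in lebesgue. f x = g x"
  shows "AE y in lebesgue. T f y = T g y"
proof -
  have "l2_norm_sq (\<lambda>x. f x - g x) = l2_norm_sq (\<lambda>x :: (real, 'm) vec. 0 :: real ^ ('m set))"
    by (rule l2_norm_sq_cong_AE) (use eq in eventually_elim, simp)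
  then have "(\<lambda>n::nat. l2_norm_sq (\<lambda>x. f x - g x)) \<longlonglongrightarrow> 0" by (simp add: l2_norm_sq_def)
  then have "(\<lambda>n::nat. l2_norm_sq (\<lambda>y. T f y - T g y)) \<longlonglongrightarrow> 0"
    using T[unfolded is_cft_extension_def, THEN conjunct2, THEN conjunct2, rule_format, of g "\<lambda>_. f"] fg by simp
  then have "l2_norm_sq (\<lambda>y. T f y - T g y) = 0" by (simp add: LIMSEQ_const_iff)
  moreover have m: "T f \<in> borel_measurable lebesgue" "T g \<in> borel_measurable lebesgue"
    using T fg unfolding is_cft_extension_def square_integrable_def by blast+
  have "(\<lambda>y. ennreal ((norm (T f y - T g y))\<^sup>2)) \<in> borel_measurable lebesgue"
    using borel_measurable_diff[OF m] by measurable
  ultimately have "AE y in lebesgue. ennreal ((norm (T f y - T g y))\<^sup>2) = 0"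
    unfolding l2_norm_sq_def by (subst (asm) nn_integral_0_iff_AE)
  then show ?thesis by (auto elim: eventually_mono)
qed

text \<open>The moments live in \<open>ennreal\<close>, where zero times infinity is zero. This
  lemma confines a vanishing moment to the case of a function that is zero almost
  everywhere.\<close>

lemma AE_zero_of_moment_zero:
  fixes f :: "'a::euclidean_space \<Rightarrow> 'b::euclidean_space"
  assumes [measurable]: "f \<in> borel_measurable lebesgue"
    and 0: "(\<integral>\<^sup>+x. ennreal ((norm x)\<^sup>2 * (norm (f x))\<^sup>2) \<partial>lebesgue) = 0"
  shows "(\<integral>x. (norm (f x))\<^sup>2 \<partial>lebesgue) = 0"
proof -
  have [measurable]: "(\<lambda>x::'a. norm x) \<in> borel_measurable lebesgue"
    by (rule lebesgue_measurable_borel) measurable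
  have "AE x in lebesgue. ennreal ((norm x)\<^sup>2 * (norm (f x))\<^sup>2) = 0"
    using 0 by (subst (asm) nn_integral_0_iff_AE) measurable
  moreover have "AE x in lebesgue. x \<noteq> (0 :: 'a)"
    by (rule AE_completion[OF AE_lborel_singleton])
  ultimately have "AE x in lebesgue. (norm (f x))\<^sup>2 = 0"
  proof eventually_elim
    case (elim x)
    then have "(norm x)\<^sup>2 * (norm (f x))\<^sup>2 \<le> 0" by (metis ennreal_eq_0_iff)
    then show ?case using elim(2) by (simp add: mult_le_0_iff)
  qed
  then show ?thesis by (rule integral_eq_zero_AE)
qed

section \<open>The inequality for the extended transform, and equality for Gaussians\<close>

context
  fixes f :: "real ^ 'm::{finite,linorder} \<Rightarrow> real ^ ('m set)" and \<sigma> :: real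
    and T :: "(real ^ 'm::{finite,linorder} \<Rightarrow> real ^ ('m set)) \<Rightarrow> real ^ 'm::{finite,linorder} \<Rightarrow> complex ^ ('m set)"
  assumes T: "is_cft_extension \<sigma> T" and f: "f \<in> borel_measurable borel" "square_integrable f"
begin

private lemma Tf: "T f \<in> borel_measurable lebesgue" "integrable lebesgue (\<lambda>y. (norm (T f y))\<^sup>2)"
  using T f unfolding is_cft_extension_def square_integrable_iff by blast+

private lemma f2: "integrable lborel (\<lambda>x. (norm (f x))\<^sup>2)"
proof -
  have "(\<lambda>x. (norm (f x))\<^sup>2) \<in> borel_measurable lborel" using f(1) by measurable
  then show ?thesis using f(2) by (simp add: square_integrable_iff integrable_completion)
qed

text \<open>Plancherel's formula minus its weighted version.\<close>

lemma cft_heat_energy: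
  assumes a: "a > 0"
  shows "integrable lebesgue (\<lambda>y. (1 - exp (- (1 / (4 * a)) * (norm y)\<^sup>2)) * (norm (T f y))\<^sup>2)"
    and "heat_energy a f = 2 * (\<integral>y. (1 - exp (- (1 / (4 * a)) * (norm y)\<^sup>2)) * (norm (T f y))\<^sup>2 \<partial>lebesgue)"
proof -
  let ?w = "\<lambda>y :: (real, 'm) vec. exp (- (1 / (4 * a)) * (norm y)\<^sup>2)"
  have wi: "integrable lebesgue (\<lambda>y. ?w y * (norm (T f y))\<^sup>2)"
  proof (rule Bochner_Integration.integrable_bound[OF Tf(2)])
    show "(\<lambda>y. ?w y * (norm (T f y))\<^sup>2) \<in> borel_measurable lebesgue"
      by (intro borel_measurable_times borel_measurable_integrable[OF Tf(2)] lebesgue_measurable_borel) measurable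
    show "AE y in lebesgue. norm (?w y * (norm (T f y))\<^sup>2) \<le> norm ((norm (T f y))\<^sup>2)"
      using a by (intro AE_I2) (simp add: abs_mult mult_left_le_one_le)
  qed
  have eq: "(1 - ?w y) * (norm (T f y))\<^sup>2 = (norm (T f y))\<^sup>2 - ?w y * (norm (T f y))\<^sup>2" for y
    by (simp add: left_diff_distrib)
  show "integrable lebesgue (\<lambda>y. (1 - ?w y) * (norm (T f y))\<^sup>2)"
    unfolding eq by (intro Bochner_Integration.integrable_diff Tf wi)
  show "heat_energy a f = 2 * (\<integral>y. (1 - ?w y) * (norm (T f y))\<^sup>2 \<partial>lebesgue)"
    unfolding eq Bochner_Integration.integral_diff[OF Tf(2) wi] cft_extension_norms[OF T f a] by simp
qed

text \<open>If both moments are finite, \<open>1 - exp (- s) \<le> s\<close> bounds the heat energy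
  by the second moment of \<open>T f\<close> divided by \<open>2 * a\<close>, and
  \<open>heat_uncertainty\<close> applies. If one moment is infinite, the other is nonzero unless
  \<open>f\<close> vanishes, so the product is infinite.\<close>

lemma cft_uncertainty:
  "ennreal ((real CARD('m))\<^sup>2 / 4) * (l2_norm_sq f)\<^sup>2 \<le>
    (\<integral>\<^sup>+x. ennreal ((norm x)\<^sup>2 * (norm (f x))\<^sup>2) \<partial>lebesgue) *
    (\<integral>\<^sup>+y. ennreal ((norm y)\<^sup>2 * (norm (T f y))\<^sup>2) \<partial>lebesgue)"
proof -
  define A where "A = (\<integral>x. (norm (f x))\<^sup>2 \<partial>lborel)"
  define Xe where "Xe = (\<integral>\<^sup>+x. ennreal ((norm x)\<^sup>2 * (norm (f x))\<^sup>2) \<partial>lebesgue)"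
  define Me where "Me = (\<integral>\<^sup>+y. ennreal ((norm y)\<^sup>2 * (norm (T f y))\<^sup>2) \<partial>lebesgue)"
  have A0: "0 \<le> A" unfolding A_def by (simp add: Bochner_Integration.integral_nonneg)
  have fm: "(\<lambda>x. (norm (f x))\<^sup>2) \<in> borel_measurable lborel"
    "(\<lambda>x. (norm x)\<^sup>2 * (norm (f x))\<^sup>2) \<in> borel_measurable lborel" using f(1) by measurable
  have fA: "(\<integral>x. (norm (f x))\<^sup>2 \<partial>lebesgue) = A" unfolding A_def by (rule integral_completion[OF fm(1)])
  have TA: "(\<integral>y. (norm (T f y))\<^sup>2 \<partial>lebesgue) = A"
    unfolding A_def by (rule cft_extension_norms(1)[OF T f zero_less_one])
  have L: "l2_norm_sq f = ennreal A" unfolding l2_norm_sq_eq_integral[OF f(2)] fA ..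
  have Tm: "(\<lambda>y. (norm y)\<^sup>2 * (norm (T f y))\<^sup>2) \<in> borel_measurable lebesgue"
    by (intro borel_measurable_times borel_measurable_integrable[OF Tf(2)] lebesgue_measurable_borel) measurable
  have "ennreal ((real CARD('m))\<^sup>2 / 4) * (ennreal A)\<^sup>2 \<le> Xe * Me"
  proof (cases "A = 0")
    case False
    then have "Xe \<noteq> 0" "Me \<noteq> 0"
      using AE_zero_of_moment_zero[OF lebesgue_measurable_borel[OF f(1)]] AE_zero_of_moment_zero[OF Tf(1)]
      unfolding Xe_def Me_def fA TA by blast+
    show ?thesis
    proof (cases "Xe = \<infinity> \<or> Me = \<infinity>")
      case True
      with \<open>Xe \<noteq> 0\<close> \<open>Me \<noteq> 0\<close> have "Xe * Me = \<top>"
        by (auto simp: ennreal_mult_top ennreal_top_mult)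
      then show ?thesis by simp
    next
      case False
      define X where "X = (\<integral>x. (norm x)\<^sup>2 * (norm (f x))\<^sup>2 \<partial>lborel)"
      define M where "M = (\<integral>y. (norm y)\<^sup>2 * (norm (T f y))\<^sup>2 \<partial>lebesgue)"
      have Xi: "integrable lborel (\<lambda>x. (norm x)\<^sup>2 * (norm (f x))\<^sup>2)"
        using fm(2) False unfolding integrable_iff_bounded Xe_def nn_integral_completion
        by (simp add: less_top)
      have Mi: "integrable lebesgue (\<lambda>y. (norm y)\<^sup>2 * (norm (T f y))\<^sup>2)"
        using Tm False unfolding integrable_iff_bounded Me_def by (simp add: less_top)
      have XM0: "0 \<le> X" "0 \<le> M" unfolding X_def M_def by (simp_all add: Bochner_Integration.integral_nonneg)
      have XM: "Xe = ennreal X" "Me = ennreal M"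
        unfolding Xe_def X_def Me_def M_def nn_integral_completion
        using nn_integral_eq_integral[OF Xi] nn_integral_eq_integral[OF Mi] by (simp_all add: nn_integral_completion)
      have E: "heat_energy a f \<le> M / (2 * a)" if a: "a > 0" for a
      proof -
        have "(\<integral>y. (1 - exp (- (1 / (4 * a)) * (norm y)\<^sup>2)) * (norm (T f y))\<^sup>2 \<partial>lebesgue) \<le>
            (\<integral>y. 1 / (4 * a) * ((norm y)\<^sup>2 * (norm (T f y))\<^sup>2) \<partial>lebesgue)"
        proof (rule integral_mono[OF cft_heat_energy(1)[OF a] integrable_mult_right[OF Mi]])
          fix y :: "(real, 'm) vec"
          have "1 - exp (- (1 / (4 * a)) * (norm y)\<^sup>2) \<le> 1 / (4 * a) * (norm y)\<^sup>2"
            using exp_ge_add_one_self[of "- (1 / (4 * a)) * (norm y)\<^sup>2"] by simp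
          from mult_right_mono[OF this, of "(norm (T f y))\<^sup>2"]
          show "(1 - exp (- (1 / (4 * a)) * (norm y)\<^sup>2)) * (norm (T f y))\<^sup>2 \<le> 1 / (4 * a) * ((norm y)\<^sup>2 * (norm (T f y))\<^sup>2)"
            by (simp add: mult.assoc)
        qed
        also have "\<dots> = 1 / (4 * a) * M" unfolding M_def by (rule integral_mult_right_zero)
        finally show ?thesis unfolding cft_heat_energy(2)[OF a] by simp
      qed
      have "(CARD('m) * A)\<^sup>2 \<le> 4 * (X * M)"
      proof (rule square_le_of_young)
        show "CARD('m) * A \<le> t * X + M / t" if "t > 0" for t
          using heat_uncertainty[OF f(1) f2 Xi E that] by (simp add: X_def A_def)
      qed (use A0 XM0 in auto)
      then have "(real CARD('m))\<^sup>2 / 4 * A\<^sup>2 \<le> X * M" by (simp add: power_mult_distrib)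
      then have "ennreal ((real CARD('m))\<^sup>2 / 4 * A\<^sup>2) \<le> ennreal (X * M)" by (rule ennreal_leI)
      then show ?thesis
        unfolding XM using A0 XM0 by (simp add: ennreal_mult[symmetric] ennreal_power)
    qed
  qed simp
  then show ?thesis unfolding L Xe_def Me_def .
qed

text \<open>Fatou's lemma along \<open>a = real (Suc n)\<close>, as
  \<open>4 * a * (1 - exp (- r / (4 * a)))\<close> tends to \<open>r\<close>. The factor is
  \<open>4 * a\<close> instead of \<open>2 * a\<close> because the heat energy is twice the integral
  in \<open>cft_heat_energy\<close>.\<close>

lemma cft_moment_le:
  assumes B: "\<And>a. a > 0 \<Longrightarrow> 2 * a * heat_energy a f \<le> B"
  shows "(\<integral>\<^sup>+y. ennreal ((norm y)\<^sup>2 * (norm (T f y))\<^sup>2) \<partial>lebesgue) \<le> ennreal B"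
proof -
  define u where "u n y = 4 * real (Suc n) * ((1 - exp (- (1 / (4 * real (Suc n))) * (norm y)\<^sup>2)) * (norm (T f y))\<^sup>2)" for n y
  have lim: "(\<lambda>n. ennreal (u n y)) \<longlonglongrightarrow> ennreal ((norm y)\<^sup>2 * (norm (T f y))\<^sup>2)" for y
  proof (rule tendsto_ennrealI)
    have "(\<lambda>n. 4 * real (Suc n) * (1 - exp (- (1 / (4 * real (Suc n))) * r))) \<longlonglongrightarrow> r" for r :: real
      by real_asymp
    from tendsto_mult[OF this tendsto_const]
    show "(\<lambda>n. u n y) \<longlonglongrightarrow> (norm y)\<^sup>2 * (norm (T f y))\<^sup>2" unfolding u_def by (simp add: mult.assoc)
  qed
  have ui: "integrable lebesgue (u n)" for n
    unfolding u_def[abs_def] by (intro integrable_mult_right cft_heat_energy(1)) simp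
  have u0: "0 \<le> u n y" for n y by (simp add: u_def)
  have "(\<integral>\<^sup>+y. ennreal ((norm y)\<^sup>2 * (norm (T f y))\<^sup>2) \<partial>lebesgue) = (\<integral>\<^sup>+y. liminf (\<lambda>n. ennreal (u n y)) \<partial>lebesgue)"
    by (intro nn_integral_cong lim_imp_Liminf[symmetric] lim) simp
  also have "\<dots> \<le> liminf (\<lambda>n. \<integral>\<^sup>+y. ennreal (u n y) \<partial>lebesgue)"
    by (rule nn_integral_liminf) (intro measurable_compose[OF borel_measurable_integrable[OF ui] measurable_ennreal])
  also have "\<dots> \<le> liminf (\<lambda>n::nat. ennreal B)"
  proof (intro Liminf_mono always_eventually allI)
    fix n
    have "(\<integral>\<^sup>+y. ennreal (u n y) \<partial>lebesgue) = ennreal (\<integral>y. u n y \<partial>lebesgue)"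
      by (rule nn_integral_eq_integral[OF ui]) (simp add: u0)
    also have "(\<integral>y. u n y \<partial>lebesgue) = 2 * real (Suc n) * heat_energy (real (Suc n)) f"
      unfolding u_def cft_heat_energy(2)[OF of_nat_0_less_iff[THEN iffD2, OF zero_less_Suc]] integral_mult_right_zero by simp
    also have "ennreal \<dots> \<le> ennreal B" by (intro ennreal_leI B) simp
    finally show "(\<integral>\<^sup>+y. ennreal (u n y) \<partial>lebesgue) \<le> ennreal B" .
  qed
  also have "\<dots> = ennreal B" by (simp add: Liminf_const)
  finally show ?thesis .
qed

end

text \<open>With \<open>A\<close> the squared norm, the moments are
  \<open>CARD('m) / (4 * p) * A\<close> and at most \<open>CARD('m) * p * A\<close>, and
  \<open>p\<close> drops out of the product. The upper bound suffices for the second, since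
  \<open>cft_uncertainty\<close> gives the reverse inequality.\<close>

lemma cft_uncertainty_gaussian:
  fixes v :: "real ^ ('m::{finite,linorder} set)" and p :: real
  defines "f \<equiv> \<lambda>x :: real ^ 'm::{finite,linorder}. exp (- p * (norm x)\<^sup>2) *\<^sub>R v"
  assumes T: "is_cft_extension \<sigma> T" and p: "p > 0"
  shows "(\<integral>\<^sup>+x. ennreal ((norm x)\<^sup>2 * (norm (f x))\<^sup>2) \<partial>lebesgue) *
    (\<integral>\<^sup>+y. ennreal ((norm y)\<^sup>2 * (norm (T f y))\<^sup>2) \<partial>lebesgue) =
    ennreal ((real CARD('m))\<^sup>2 / 4) * (l2_norm_sq f)\<^sup>2"
proof (rule antisym)
  have g: "integrable lborel (\<lambda>x. (norm (f x))\<^sup>2)"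
    "integrable lborel (\<lambda>x. (norm x)\<^sup>2 * (norm (f x))\<^sup>2)"
    "(\<integral>x. (norm x)\<^sup>2 * (norm (f x))\<^sup>2 \<partial>lborel) = CARD('m) / (4 * p) * (\<integral>x. (norm (f x))\<^sup>2 \<partial>lborel)"
    "a > 0 \<Longrightarrow> 2 * a * heat_energy a f \<le> CARD('m) * p * (\<integral>x. (norm (f x))\<^sup>2 \<partial>lborel)" for a
    unfolding f_def
    using heat_energy_gaussian(1-3)[OF p zero_less_one, of v, where 'a = "(real, 'm) vec"]
      heat_energy_gaussian(4)[OF p, of a v, where 'a = "(real, 'm) vec"] by simp_all
  define A where "A = (\<integral>x. (norm (f x))\<^sup>2 \<partial>lborel)"
  have A0: "0 \<le> A" unfolding A_def by (simp add: Bochner_Integration.integral_nonneg)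
  have fb: "f \<in> borel_measurable borel" unfolding f_def by measurable
  have L: "l2_norm_sq f = ennreal A"
    unfolding l2_norm_sq_def nn_integral_completion A_def
    by (rule nn_integral_eq_integral[OF g(1)]) simp
  have fs: "square_integrable f"
    using lebesgue_measurable_borel[OF fb] L by (simp add: square_integrable_def)
  show "ennreal ((real CARD('m))\<^sup>2 / 4) * (l2_norm_sq f)\<^sup>2 \<le> (\<integral>\<^sup>+x. ennreal ((norm x)\<^sup>2 * (norm (f x))\<^sup>2) \<partial>lebesgue) *
    (\<integral>\<^sup>+y. ennreal ((norm y)\<^sup>2 * (norm (T f y))\<^sup>2) \<partial>lebesgue)"
    by (rule cft_uncertainty[OF T fb fs])
  have X: "(\<integral>\<^sup>+x. ennreal ((norm x)\<^sup>2 * (norm (f x))\<^sup>2) \<partial>lebesgue) = ennreal (CARD('m) / (4 * p) * A)"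
    unfolding nn_integral_completion
    using nn_integral_eq_integral[OF g(2)] g(3) by (simp add: A_def)
  have M: "(\<integral>\<^sup>+y. ennreal ((norm y)\<^sup>2 * (norm (T f y))\<^sup>2) \<partial>lebesgue) \<le> ennreal (CARD('m) * p * A)"
    by (rule cft_moment_le[OF T fb fs]) (use g(4) in \<open>simp add: A_def\<close>)
  have "(\<integral>\<^sup>+x. ennreal ((norm x)\<^sup>2 * (norm (f x))\<^sup>2) \<partial>lebesgue) *
    (\<integral>\<^sup>+y. ennreal ((norm y)\<^sup>2 * (norm (T f y))\<^sup>2) \<partial>lebesgue) \<le> ennreal (CARD('m) / (4 * p) * A) * ennreal (CARD('m) * p * A)"
    unfolding X by (intro mult_left_mono M) simp
  also have "\<dots> = ennreal ((CARD('m) / (4 * p) * A) * (CARD('m) * p * A))"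
    using A0 p by (intro ennreal_mult[symmetric]) auto
  also have "(CARD('m) / (4 * p) * A) * (CARD('m) * p * A) = (real CARD('m))\<^sup>2 / 4 * A\<^sup>2"
    using p by (simp add: power2_eq_square)
  also have "ennreal \<dots> = ennreal ((real CARD('m))\<^sup>2 / 4) * (l2_norm_sq f)\<^sup>2"
    unfolding L using A0 by (simp add: ennreal_mult[symmetric] ennreal_power)
  finally show "(\<integral>\<^sup>+x. ennreal ((norm x)\<^sup>2 * (norm (f x))\<^sup>2) \<partial>lebesgue) *
    (\<integral>\<^sup>+y. ennreal ((norm y)\<^sup>2 * (norm (T f y))\<^sup>2) \<partial>lebesgue) \<le> ennreal ((real CARD('m))\<^sup>2 / 4) * (l2_norm_sq f)\<^sup>2" .
qed

theorem theorem4p4: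
  fixes f :: "real ^ 'm::{finite,linorder} \<Rightarrow> real ^ ('m set)"
    and \<sigma> :: real
  assumes "\<sigma> = 1 \<or> \<sigma> = -1"
    and "square_integrable f"
  shows "(\<integral>\<^sup>+x. ennreal ((norm (cl_vector x))\<^sup>2 * (norm (f x))\<^sup>2) \<partial>lebesgue) *
         (\<integral>\<^sup>+y. ennreal ((norm (cl_vector y))\<^sup>2 * (norm (cft_l2 \<sigma> f y))\<^sup>2) \<partial>lebesgue)
         \<ge> ennreal ((real CARD('m))\<^sup>2 / 4) * (\<integral>\<^sup>+x. ennreal ((norm (f x))\<^sup>2) \<partial>lebesgue)\<^sup>2
       \<and>
       ((\<exists>p c :: real. p > 0 \<and>
          (AE x in lebesgue. f x = cl_scalar (c * exp (- p * (norm (cl_vector x))\<^sup>2)))) \<longrightarrow>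
         (\<integral>\<^sup>+x. ennreal ((norm (cl_vector x))\<^sup>2 * (norm (f x))\<^sup>2) \<partial>lebesgue) *
         (\<integral>\<^sup>+y. ennreal ((norm (cl_vector y))\<^sup>2 * (norm (cft_l2 \<sigma> f y))\<^sup>2) \<partial>lebesgue)
         = ennreal ((real CARD('m))\<^sup>2 / 4) * (\<integral>\<^sup>+x. ennreal ((norm (f x))\<^sup>2) \<partial>lebesgue)\<^sup>2)"
proof -
  define T where "T = (cft_l2 \<sigma> :: (real ^ 'm::{finite,linorder} \<Rightarrow> real ^ ('m set)) \<Rightarrow> _)"
  have T: "is_cft_extension \<sigma> T" unfolding T_def by (rule cft_l2_extension)
  \<comment> \<open>Every quantity in the statement depends only on the class of \<open>f\<close>
    modulo null sets, so \<open>f\<close> may be exchanged for a Borel function, as the Fubini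
    arguments over \<open>lborel\<close> require.\<close>
  have cong: "square_integrable g"
      "(\<integral>\<^sup>+x. ennreal ((norm x)\<^sup>2 * (norm (f x))\<^sup>2) \<partial>lebesgue) = (\<integral>\<^sup>+x. ennreal ((norm x)\<^sup>2 * (norm (g x))\<^sup>2) \<partial>lebesgue)"
      "(\<integral>\<^sup>+y. ennreal ((norm y)\<^sup>2 * (norm (T f y))\<^sup>2) \<partial>lebesgue) = (\<integral>\<^sup>+y. ennreal ((norm y)\<^sup>2 * (norm (T g y))\<^sup>2) \<partial>lebesgue)"
      "l2_norm_sq f = l2_norm_sq g"
    if g: "g \<in> borel_measurable borel" and eq: "AE x in lebesgue. f x = g x" for g
  proof -
    show l: "l2_norm_sq f = l2_norm_sq g" by (rule l2_norm_sq_cong_AE[OF eq])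
    show gs: "square_integrable g"
      using assms(2) lebesgue_measurable_borel[OF g] l by (simp add: square_integrable_def)
    show "(\<integral>\<^sup>+x. ennreal ((norm x)\<^sup>2 * (norm (f x))\<^sup>2) \<partial>lebesgue) = (\<integral>\<^sup>+x. ennreal ((norm x)\<^sup>2 * (norm (g x))\<^sup>2) \<partial>lebesgue)"
      by (rule nn_integral_cong_AE) (use eq in eventually_elim, simp)
    have "AE y in lebesgue. T f y = T g y" by (rule cft_extension_cong[OF T assms(2) gs eq])
    then show "(\<integral>\<^sup>+y. ennreal ((norm y)\<^sup>2 * (norm (T f y))\<^sup>2) \<partial>lebesgue) = (\<integral>\<^sup>+y. ennreal ((norm y)\<^sup>2 * (norm (T g y))\<^sup>2) \<partial>lebesgue)"
      by (intro nn_integral_cong_AE) (auto elim: eventually_mono)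
  qed
  obtain g where g: "g \<in> borel_measurable borel" "AE x in lebesgue. f x = g x"
    using lebesgue_measurable_borel_version assms(2) unfolding square_integrable_def by blast
  have 1: "ennreal ((real CARD('m))\<^sup>2 / 4) * (l2_norm_sq f)\<^sup>2 \<le>
      (\<integral>\<^sup>+x. ennreal ((norm x)\<^sup>2 * (norm (f x))\<^sup>2) \<partial>lebesgue) * (\<integral>\<^sup>+y. ennreal ((norm y)\<^sup>2 * (norm (T f y))\<^sup>2) \<partial>lebesgue)"
    unfolding cong(2-4)[OF g] by (rule cft_uncertainty[OF T g(1) cong(1)[OF g]])
  have 2: "(\<integral>\<^sup>+x. ennreal ((norm x)\<^sup>2 * (norm (f x))\<^sup>2) \<partial>lebesgue) * (\<integral>\<^sup>+y. ennreal ((norm y)\<^sup>2 * (norm (T f y))\<^sup>2) \<partial>lebesgue)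
      = ennreal ((real CARD('m))\<^sup>2 / 4) * (l2_norm_sq f)\<^sup>2"
    if p: "p > 0" and eq: "AE x in lebesgue. f x = cl_scalar (c * exp (- p * (norm (cl_vector x))\<^sup>2))" for p c :: real
  proof -
    have "cl_scalar (c * exp (- p * (norm (cl_vector x))\<^sup>2)) = exp (- p * (norm x)\<^sup>2) *\<^sub>R (cl_scalar c :: real ^ ('m set))" for x :: "(real, 'm) vec"
      by (simp add: cl_scalar_def vec_eq_iff norm_cl_vector)
    with eq have G: "AE x in lebesgue. f x = exp (- p * (norm x)\<^sup>2) *\<^sub>R cl_scalar c" by simp
    have "(\<lambda>x :: (real, 'm) vec. exp (- p * (norm x)\<^sup>2) *\<^sub>R (cl_scalar c :: real ^ ('m set))) \<in> borel_measurable borel" by measurable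
    from cong(2-4)[OF this G] cft_uncertainty_gaussian[OF T p, of "cl_scalar c"] show ?thesis by simp
  qed
  from 1 2 show ?thesis
    unfolding norm_cl_vector T_def[symmetric] l2_norm_sq_def by blast
qed

end
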